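(* Let $X$ be a Banach space of non-trivial type (equivalently, a $K$-convex Banach space), and let $1<p<\infty$. Then there is a constant $C(p)<\infty$ (which may depend on $p$ and on $X$ but not on $n$) such that for every $n\ge1$ and every function $g:\{-1,1\}^n\to X$, $$\mathbf{E}_{\delta,\varepsilon}\Big\|\sum_{j=1}^n\delta_j\,\Delta^{-1}D_jg(\varepsilon)\Big\|_X^p\le C(p)\,\mathbf{E}_\varepsilon\|g(\varepsilon)\|_X^p.$$
   Context: The Hamming cube $\Omega_n=\{-1,1\}^n$ carries the uniform probability measure (mass $2^{-n}$ at each point). $\varepsilon=(\varepsilon_1,\dots,\varepsilon_n)$ and $\delta=(\delta_1,\dots,\delta_n)$ denote independent uniformly distributed points of $\Omega_n$ (so the $\delta_j$ are independent Rademacher random variables), and $\mathbf{E}_\varepsilon,\mathbf{E}_{\delta,\varepsilon}$ are the expectations over the indicated variables. Every function $f:\Omega_n\to X$ is written uniquely as a multilinear polynomial $f(\varepsilon)=\sum_{S\subseteq\{1,\dots,n\}}\hat f(S)\prod_{i\in S}\varepsilon_i$ with $\hat f(S)\in X$. Here $\partial_i$ is the partial derivative of this polynomial with respect to $\varepsilon_i$, $D_i=\varepsilon_i\partial_i$ (so $D_if=\sum_{S\ni i}\hat f(S)\prod_{k\in S}\varepsilon_k$ and $D_i^2=D_i$), and $\Delta=D_1+\dots+D_n$ (so $\Delta f=\sum_S|S|\hat f(S)\prod_{k\in S}\varepsilon_k$). $\Delta^{-1}$ is the inverse of $\Delta$ on mean-zero functions; since $D_jf$ always has mean zero, $\Delta^{-1}D_jf=\sum_{S\ni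 j}|S|^{-1}\hat f(S)\prod_{k\in S}\varepsilon_k$. A Banach space $X$ has non-trivial type if for some $r\in(1,2]$ there is a constant $T$ with $\big(\mathbf{E}_\delta\|\sum_{j=1}^m\delta_jx_j\|^r\big)^{1/r}\le T\big(\sum_{j=1}^m\|x_j\|^r\big)^{1/r}$ for all $m$ and all $x_1,\dots,x_m\in X$. $X$ is $K$-convex if for some (equivalently, every) $s\in(1,\infty)$ the Rademacher projections $f\mapsto\sum_{i=1}^m\delta_i\,\mathbf{E}_{\delta'}[\delta'_if(\delta')]$ ($\delta'$ uniformly distributed on $\Omega_m$) are bounded on $L^s(\Omega_m;X)$ uniformly in $m$. By a theorem of Pisier these two properties are equivalent. *)

theory Defs
  imports "HOL-Analysis.Analysis"
begin

text \<open>
  A function on the cube is a function on \<^typ>\<open>nat \<Rightarrow> real\<close> of which only the values on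
  \<open>hamming_cube n\<close> matter; the operators below return functions that are extensional on the cube,
  so that equality of functions on the cube is equality in HOL.
\<close>

definition hamming_cube :: "nat \<Rightarrow> (nat \<Rightarrow> real) set" where
  "hamming_cube n = {1..n} \<rightarrow>\<^sub>E {-1, 1}"

definition cube_mean :: "nat \<Rightarrow> ((nat \<Rightarrow> real) \<Rightarrow> 'a) \<Rightarrow> 'a::real_vector" where
  "cube_mean n f = (1 / 2 ^ n) *\<^sub>R (\<Sum>\<epsilon>\<in>hamming_cube n. f \<epsilon>)"

definition multilinear_poly :: "nat \<Rightarrow> (nat set \<Rightarrow> 'a) \<Rightarrow> (nat \<Rightarrow> real) \<Rightarrow> 'a::real_vector" where
  "multilinear_poly n c x = (\<Sum>S\<in>Pow {1..n}. (\<Prod>i\<in>S. x i) *\<^sub>R c S)"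

text \<open>
  Existence and uniqueness of these coefficients are \<open>multilinear_poly_walsh_coeff\<close> and
  \<open>walsh_coeff_unique\<close> below.
\<close>

definition walsh_coeff :: "nat \<Rightarrow> ((nat \<Rightarrow> real) \<Rightarrow> 'a) \<Rightarrow> nat set \<Rightarrow> 'a::real_vector" where
  "walsh_coeff n f = (THE c. (\<forall>S. \<not> S \<subseteq> {1..n} \<longrightarrow> c S = 0) \<and>
     (\<forall>\<epsilon>\<in>hamming_cube n. multilinear_poly n c \<epsilon> = f \<epsilon>))"

definition cube_partial ::
    "nat \<Rightarrow> nat \<Rightarrow> ((nat \<Rightarrow> real) \<Rightarrow> 'a) \<Rightarrow> (nat \<Rightarrow> real) \<Rightarrow> 'a::real_normed_vector" where
  "cube_partial n i f x =
     vector_derivative (\<lambda>t. multilinear_poly n (walsh_coeff n f) (x(i := t))) (at (x i))"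

definition cube_D ::
    "nat \<Rightarrow> nat \<Rightarrow> ((nat \<Rightarrow> real) \<Rightarrow> 'a) \<Rightarrow> (nat \<Rightarrow> real) \<Rightarrow> 'a::real_normed_vector" where
  "cube_D n i f = (\<lambda>\<epsilon>\<in>hamming_cube n. \<epsilon> i *\<^sub>R cube_partial n i f \<epsilon>)"

definition cube_Laplacian ::
    "nat \<Rightarrow> ((nat \<Rightarrow> real) \<Rightarrow> 'a) \<Rightarrow> (nat \<Rightarrow> real) \<Rightarrow> 'a::real_normed_vector" where
  "cube_Laplacian n f = (\<lambda>\<epsilon>\<in>hamming_cube n. \<Sum>i=1..n. cube_D n i f \<epsilon>)"

definition mean_zero_functions :: "nat \<Rightarrow> ((nat \<Rightarrow> real) \<Rightarrow> 'a::real_vector) set" where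
  "mean_zero_functions n = {f \<in> extensional (hamming_cube n). cube_mean n f = 0}"

text \<open>
  The Laplacian is a bijection of the mean-zero functions onto themselves
  (\<open>bij_betw_cube_Laplacian\<close> below).
\<close>

definition cube_Laplacian_inv ::
    "nat \<Rightarrow> ((nat \<Rightarrow> real) \<Rightarrow> 'a) \<Rightarrow> (nat \<Rightarrow> real) \<Rightarrow> 'a::real_normed_vector" where
  "cube_Laplacian_inv n = the_inv_into (mean_zero_functions n) (cube_Laplacian n)"

definition nontrivial_type :: "'a::banach itself \<Rightarrow> bool" where
  "nontrivial_type (_ :: 'a itself) \<longleftrightarrow>
     (\<exists>r T. 1 < r \<and> r \<le> 2 \<and>
       (\<forall>m (x :: nat \<Rightarrow> 'a).
          cube_mean m (\<lambda>\<delta>. norm (\<Sum>j=1..m. \<delta> j *\<^sub>R x j) powr r) powr (1 / r)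
            \<le> T * (\<Sum>j=1..m. norm (x j) powr r) powr (1 / r)))"


subsection \<open>Expansions in Walsh functions\<close>

lemma finite_hamming_cube [simp]: "finite (hamming_cube n)"
  by (auto simp: hamming_cube_def intro!: finite_PiE)

lemma card_hamming_cube: "card (hamming_cube n) = 2 ^ n"
  by (simp add: hamming_cube_def card_PiE numeral_2_eq_2)

lemma walsh_orthogonal:
  assumes "S \<subseteq> {1..n}" "T \<subseteq> {1..n}"
  shows "(\<Sum>\<epsilon>\<in>hamming_cube n. (\<Prod>i\<in>S. \<epsilon> i) * (\<Prod>i\<in>T. \<epsilon> i)) = (if S = T then 2 ^ n else 0)"
proof -
  define h where "h i y = (if i \<in> S then y else 1) * (if i \<in> T then y else 1)" for i and y :: real
  have res: "(\<Prod>i\<in>U. \<epsilon> i) = (\<Prod>i\<in>{1..n}. if i \<in> U then \<epsilon> i else 1)"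
    if "U \<subseteq> {1..n}" for U and \<epsilon> :: "nat \<Rightarrow> real"
    using that by (simp flip: prod.inter_restrict add: Int_absorb1)
  have "(\<Sum>\<epsilon>\<in>hamming_cube n. (\<Prod>i\<in>S. \<epsilon> i) * (\<Prod>i\<in>T. \<epsilon> i))
      = (\<Sum>\<epsilon>\<in>{1..n} \<rightarrow>\<^sub>E {-1, 1}. \<Prod>i\<in>{1..n}. h i (\<epsilon> i))"
    by (simp add: res[OF assms(1)] res[OF assms(2)] h_def prod.distrib hamming_cube_def)
  also have "\<dots> = (\<Prod>i\<in>{1..n}. \<Sum>y\<in>{-1, 1}. h i y)"
    by (subst prod_sum_PiE) auto
  also have "\<dots> = (\<Prod>i\<in>{1..n}. if i \<in> S \<longleftrightarrow> i \<in> T then 2 else 0)"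
    by (intro prod.cong) (auto simp: h_def)
  also have "\<dots> = (if S = T then 2 ^ n else 0)"
  proof (cases "S = T")
    case False
    then obtain i where "i \<in> {1..n}" "(i \<in> S) \<noteq> (i \<in> T)" using assms by blast
    then have "(\<Prod>i\<in>{1..n}. if i \<in> S \<longleftrightarrow> i \<in> T then 2 else 0 :: real) = 0"
      by (intro prod_zero) auto
    with False show ?thesis by simp
  qed simp
  finally show ?thesis .
qed

lemma walsh_orthogonal_dual:
  assumes "\<epsilon> \<in> hamming_cube n" "\<eta> \<in> hamming_cube n"
  shows "(\<Sum>S\<in>Pow {1..n}. (\<Prod>i\<in>S. \<epsilon> i) * (\<Prod>i\<in>S. \<eta> i)) = (if \<epsilon> = \<eta> then 2 ^ n else 0)"
proof -
  have pm: "\<epsilon> i = 1 \<or> \<epsilon> i = -1" "\<eta> i = 1 \<or> \<eta> i = -1" if "i \<in> {1..n}" for i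
    using assms that by (auto simp: hamming_cube_def dest!: PiE_mem)
  have "(\<Sum>S\<in>Pow {1..n}. (\<Prod>i\<in>S. \<epsilon> i) * (\<Prod>i\<in>S. \<eta> i)) = (\<Prod>i\<in>{1..n}. \<epsilon> i * \<eta> i + 1)"
    by (subst prod_add) (auto simp: prod.distrib)
  also have "\<dots> = (if \<epsilon> = \<eta> then 2 ^ n else 0)"
  proof (cases "\<epsilon> = \<eta>")
    case True
    then have "(\<Prod>i\<in>{1..n}. \<epsilon> i * \<eta> i + 1) = (\<Prod>i\<in>{1..n}. 2)"
      using pm by (intro prod.cong) fastforce+
    with True show ?thesis by simp
  next
    case False
    then obtain i where i: "i \<in> {1..n}" "\<epsilon> i \<noteq> \<eta> i"
      using assms unfolding hamming_cube_def by (meson PiE_ext)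
    then have "\<epsilon> i * \<eta> i + 1 = 0" using pm[OF i(1)] by auto
    then have "(\<Prod>i\<in>{1..n}. \<epsilon> i * \<eta> i + 1) = 0"
      using i by (intro prod_zero) auto
    with False show ?thesis by simp
  qed
  finally show ?thesis .
qed

lemma cube_mean_walsh_multilinear_poly:
  assumes "S \<subseteq> {1..n}"
  shows "cube_mean n (\<lambda>\<epsilon>. (\<Prod>i\<in>S. \<epsilon> i) *\<^sub>R multilinear_poly n c \<epsilon>) = c S"
proof -
  have "(\<Sum>\<epsilon>\<in>hamming_cube n. (\<Prod>i\<in>S. \<epsilon> i) *\<^sub>R multilinear_poly n c \<epsilon>)
      = (\<Sum>T\<in>Pow {1..n}. (\<Sum>\<epsilon>\<in>hamming_cube n. (\<Prod>i\<in>S. \<epsilon> i) * (\<Prod>i\<in>T. \<epsilon> i)) *\<^sub>R c T)"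
    unfolding multilinear_poly_def
    by (simp add: scaleR_sum_right scaleR_sum_left sum.swap[of _ "hamming_cube n"])
  also have "\<dots> = (\<Sum>T\<in>Pow {1..n}. if S = T then 2 ^ n *\<^sub>R c T else 0)"
    using assms by (intro sum.cong) (auto simp: walsh_orthogonal)
  also have "\<dots> = 2 ^ n *\<^sub>R c S" using assms by simp
  finally show ?thesis by (simp add: cube_mean_def)
qed

lemma multilinear_poly_cube_mean:
  assumes "\<epsilon> \<in> hamming_cube n"
  shows "multilinear_poly n (\<lambda>S. if S \<subseteq> {1..n}
           then cube_mean n (\<lambda>\<eta>. (\<Prod>i\<in>S. \<eta> i) *\<^sub>R f \<eta>) else 0) \<epsilon> = f \<epsilon>"
proof -
  have "multilinear_poly n (\<lambda>S. if S \<subseteq> {1..n}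
           then cube_mean n (\<lambda>\<eta>. (\<Prod>i\<in>S. \<eta> i) *\<^sub>R f \<eta>) else 0) \<epsilon>
      = (\<Sum>S\<in>Pow {1..n}. \<Sum>\<eta>\<in>hamming_cube n.
           (1 / 2 ^ n) *\<^sub>R ((\<Prod>i\<in>S. \<epsilon> i) * (\<Prod>i\<in>S. \<eta> i)) *\<^sub>R f \<eta>)"
    unfolding multilinear_poly_def cube_mean_def
    by (intro sum.cong refl) (simp add: scaleR_sum_right mult_ac)
  also have "\<dots> = (\<Sum>\<eta>\<in>hamming_cube n. (1 / 2 ^ n) *\<^sub>R
       (\<Sum>S\<in>Pow {1..n}. (\<Prod>i\<in>S. \<epsilon> i) * (\<Prod>i\<in>S. \<eta> i)) *\<^sub>R f \<eta>)"
    by (subst sum.swap) (simp add: scaleR_sum_right scaleR_sum_left)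
  also have "\<dots> = (\<Sum>\<eta>\<in>hamming_cube n. if \<epsilon> = \<eta> then f \<eta> else 0)"
    using assms by (intro sum.cong refl) (simp add: walsh_orthogonal_dual del: One_nat_def)
  also have "\<dots> = f \<epsilon>" using assms by simp
  finally show ?thesis .
qed

lemma walsh_coeff_unique:
  assumes "\<And>S. \<not> S \<subseteq> {1..n} \<Longrightarrow> c S = 0"
    and "\<And>\<epsilon>. \<epsilon> \<in> hamming_cube n \<Longrightarrow> multilinear_poly n c \<epsilon> = f \<epsilon>"
  shows "walsh_coeff n f = c"
proof -
  have det: "d S = (if S \<subseteq> {1..n} then cube_mean n (\<lambda>\<epsilon>. (\<Prod>i\<in>S. \<epsilon> i) *\<^sub>R f \<epsilon>) else 0)"
    if d: "\<forall>S. \<not> S \<subseteq> {1..n} \<longrightarrow> d S = 0" "\<forall>\<epsilon>\<in>hamming_cube n. multilinear_poly n d \<epsilon> = f \<epsilon>"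
    for d S
  proof (cases "S \<subseteq> {1..n}")
    case True
    have "d S = cube_mean n (\<lambda>\<epsilon>. (\<Prod>i\<in>S. \<epsilon> i) *\<^sub>R multilinear_poly n d \<epsilon>)"
      using cube_mean_walsh_multilinear_poly[OF True] by metis
    also have "\<dots> = cube_mean n (\<lambda>\<epsilon>. (\<Prod>i\<in>S. \<epsilon> i) *\<^sub>R f \<epsilon>)"
      using d(2) by (simp add: cube_mean_def)
    finally show ?thesis using True by simp
  qed (use d in simp)
  show ?thesis
    unfolding walsh_coeff_def
  proof (rule the_equality)
    show "(\<forall>S. \<not> S \<subseteq> {1..n} \<longrightarrow> c S = 0) \<and> (\<forall>\<epsilon>\<in>hamming_cube n. multilinear_poly n c \<epsilon> = f \<epsilon>)"
      using assms by blast
    show "d = c" if "(\<forall>S. \<not> S \<subseteq> {1..n} \<longrightarrow> d S = 0) \<and>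
      (\<forall>\<epsilon>\<in>hamming_cube n. multilinear_poly n d \<epsilon> = f \<epsilon>)" for d
      using that det[of d] det[of c] assms by (intro ext) auto
  qed
qed

lemma walsh_coeff_eq:
  "walsh_coeff n f = (\<lambda>S. if S \<subseteq> {1..n}
     then cube_mean n (\<lambda>\<epsilon>. (\<Prod>i\<in>S. \<epsilon> i) *\<^sub>R f \<epsilon>) else 0)"
  by (rule walsh_coeff_unique) (use multilinear_poly_cube_mean in auto)

lemma multilinear_poly_walsh_coeff:
  "\<epsilon> \<in> hamming_cube n \<Longrightarrow> multilinear_poly n (walsh_coeff n f) \<epsilon> = f \<epsilon>"
  unfolding walsh_coeff_eq by (rule multilinear_poly_cube_mean)

lemma walsh_coeff_multilinear_poly:
  assumes "\<And>\<epsilon>. \<epsilon> \<in> hamming_cube n \<Longrightarrow> f \<epsilon> = multilinear_poly n c \<epsilon>"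
  shows "walsh_coeff n f S = (if S \<subseteq> {1..n} then c S else 0)"
proof -
  have "walsh_coeff n f = (\<lambda>S. if S \<subseteq> {1..n} then c S else 0)"
    by (rule walsh_coeff_unique) (auto simp: assms multilinear_poly_def intro!: sum.cong)
  then show ?thesis by simp
qed

lemma cube_partial_eq:
  fixes f :: "(nat \<Rightarrow> real) \<Rightarrow> 'a::real_normed_vector"
  assumes "i \<in> {1..n}"
  shows "cube_partial n i f x =
    (\<Sum>S | S \<subseteq> {1..n} \<and> i \<in> S. (\<Prod>k\<in>S - {i}. x k) *\<^sub>R walsh_coeff n f S)"
proof -
  have "((\<lambda>t. multilinear_poly n (walsh_coeff n f) (x(i := t))) has_vector_derivative
      (\<Sum>S\<in>Pow {1..n}. if i \<in> S then (\<Prod>k\<in>S - {i}. x k) *\<^sub>R walsh_coeff n f S else 0)) (at (x i))"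
    unfolding multilinear_poly_def
  proof (intro has_vector_derivative_sum)
    fix S assume S: "S \<in> Pow {1..n}"
    then have fin: "finite S" by (auto intro: finite_subset)
    show "((\<lambda>t. (\<Prod>k\<in>S. (x(i := t)) k) *\<^sub>R walsh_coeff n f S) has_vector_derivative
       (if i \<in> S then (\<Prod>k\<in>S - {i}. x k) *\<^sub>R walsh_coeff n f S else 0)) (at (x i))"
    proof (cases "i \<in> S")
      case True
      have "(\<Prod>k\<in>S. (x(i := t)) k) = t * (\<Prod>k\<in>S - {i}. x k)" for t
        using fin True by (simp add: prod.remove)
      then show ?thesis using True by (auto intro!: derivative_eq_intros)
    next
      case False
      then have "(\<Prod>k\<in>S. (x(i := t)) k) = (\<Prod>k\<in>S. x k)" for t
        by (intro prod.cong) auto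
      then show ?thesis using False by simp
    qed
  qed
  then have "cube_partial n i f x =
      (\<Sum>S\<in>Pow {1..n}. if i \<in> S then (\<Prod>k\<in>S - {i}. x k) *\<^sub>R walsh_coeff n f S else 0)"
    unfolding cube_partial_def by (rule vector_derivative_at)
  also have "\<dots> = (\<Sum>S\<in>{S \<in> Pow {1..n}. i \<in> S}. (\<Prod>k\<in>S - {i}. x k) *\<^sub>R walsh_coeff n f S)"
    by (rule sum.inter_filter [symmetric]) simp
  also have "{S \<in> Pow {1..n}. i \<in> S} = {S. S \<subseteq> {1..n} \<and> i \<in> S}" by auto
  finally show ?thesis .
qed

lemma cube_D_eq_multilinear_poly:
  assumes "i \<in> {1..n}" "\<epsilon> \<in> hamming_cube n"
  shows "cube_D n i f \<epsilon> = multilinear_poly n (\<lambda>S. if i \<in> S then walsh_coeff n f S else 0) \<epsilon>"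
proof -
  have "cube_D n i f \<epsilon> =
      (\<Sum>S\<in>{S \<in> Pow {1..n}. i \<in> S}. \<epsilon> i *\<^sub>R (\<Prod>k\<in>S - {i}. \<epsilon> k) *\<^sub>R walsh_coeff n f S)"
    using assms by (simp add: cube_D_def cube_partial_eq scaleR_sum_right)
  also have "\<dots> = (\<Sum>S\<in>{S \<in> Pow {1..n}. i \<in> S}. (\<Prod>k\<in>S. \<epsilon> k) *\<^sub>R walsh_coeff n f S)"
  proof (intro sum.cong refl)
    fix S assume "S \<in> {S \<in> Pow {1..n}. i \<in> S}"
    then have "i \<in> S" "finite S" by (auto intro: finite_subset)
    then show "\<epsilon> i *\<^sub>R (\<Prod>k\<in>S - {i}. \<epsilon> k) *\<^sub>R walsh_coeff n f S
        = (\<Prod>k\<in>S. \<epsilon> k) *\<^sub>R walsh_coeff n f S"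
      by (simp add: prod.remove)
  qed
  also have "\<dots> = multilinear_poly n (\<lambda>S. if i \<in> S then walsh_coeff n f S else 0) \<epsilon>"
    unfolding multilinear_poly_def
    by (subst sum.inter_filter) (auto intro!: sum.cong)
  finally show ?thesis .
qed

lemma cube_Laplacian_eq_multilinear_poly:
  assumes "\<epsilon> \<in> hamming_cube n"
  shows "cube_Laplacian n f \<epsilon> = multilinear_poly n (\<lambda>S. real (card S) *\<^sub>R walsh_coeff n f S) \<epsilon>"
proof -
  have "cube_Laplacian n f \<epsilon> = (\<Sum>S\<in>Pow {1..n}. \<Sum>i=1..n.
      (\<Prod>k\<in>S. \<epsilon> k) *\<^sub>R (if i \<in> S then walsh_coeff n f S else 0))"
    using assms
    by (simp add: cube_Laplacian_def cube_D_eq_multilinear_poly multilinear_poly_def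
        sum.swap[of _ "{Suc 0..n}"])
  also have "\<dots> = multilinear_poly n (\<lambda>S. real (card S) *\<^sub>R walsh_coeff n f S) \<epsilon>"
    unfolding multilinear_poly_def
  proof (intro sum.cong refl)
    fix S assume "S \<in> Pow {1..n}"
    then have "(\<Sum>i=1..n. if i \<in> S then walsh_coeff n f S else 0) = real (card S) *\<^sub>R walsh_coeff n f S"
      by (simp flip: sum.inter_restrict add: Int_absorb1 sum_constant_scaleR)
    then show "(\<Sum>i=1..n. (\<Prod>k\<in>S. \<epsilon> k) *\<^sub>R (if i \<in> S then walsh_coeff n f S else 0))
        = (\<Prod>k\<in>S. \<epsilon> k) *\<^sub>R real (card S) *\<^sub>R walsh_coeff n f S"
      by (simp flip: scaleR_sum_right)
  qed
  finally show ?thesis .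
qed

lemma mean_zero_functions_iff:
  "f \<in> mean_zero_functions n \<longleftrightarrow> f \<in> extensional (hamming_cube n) \<and> walsh_coeff n f {} = 0"
  by (simp add: mean_zero_functions_def walsh_coeff_eq)

lemma extensional_eqI_walsh_coeff:
  assumes "f \<in> extensional (hamming_cube n)" "g \<in> extensional (hamming_cube n)"
    and "\<And>S. S \<subseteq> {1..n} \<Longrightarrow> walsh_coeff n f S = walsh_coeff n g S"
  shows "f = g"
proof (rule extensionalityI[OF assms(1,2)])
  fix \<epsilon> assume \<epsilon>: "\<epsilon> \<in> hamming_cube n"
  have "f \<epsilon> = multilinear_poly n (walsh_coeff n f) \<epsilon>"
    using \<epsilon> by (simp add: multilinear_poly_walsh_coeff)
  also have "\<dots> = multilinear_poly n (walsh_coeff n g) \<epsilon>"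
    using assms(3) by (simp add: multilinear_poly_def)
  also have "\<dots> = g \<epsilon>" using \<epsilon> by (simp add: multilinear_poly_walsh_coeff)
  finally show "f \<epsilon> = g \<epsilon>" .
qed

lemma walsh_coeff_cube_Laplacian:
  assumes "S \<subseteq> {1..n}"
  shows "walsh_coeff n (cube_Laplacian n f) S = real (card S) *\<^sub>R walsh_coeff n f S"
  using assms by (simp add: walsh_coeff_multilinear_poly[OF cube_Laplacian_eq_multilinear_poly])

lemma bij_betw_cube_Laplacian:
  "bij_betw (cube_Laplacian n) (mean_zero_functions n)
     (mean_zero_functions n :: ((nat \<Rightarrow> real) \<Rightarrow> 'a::real_normed_vector) set)"
proof (rule bij_betwI')
  have nz: "card S \<noteq> 0" if "S \<subseteq> {1..n}" "S \<noteq> {}" for S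
    using that by (metis card_0_eq finite_atLeastAtMost finite_subset)
  fix f g :: "(nat \<Rightarrow> real) \<Rightarrow> 'a"
  assume f: "f \<in> mean_zero_functions n"
  show "cube_Laplacian n f \<in> mean_zero_functions n"
    using walsh_coeff_cube_Laplacian[of "{}" n f]
    by (simp add: mean_zero_functions_iff) (simp add: cube_Laplacian_def)
  show "cube_Laplacian n f = cube_Laplacian n g \<longleftrightarrow> f = g" if g: "g \<in> mean_zero_functions n"
  proof
    assume eq: "cube_Laplacian n f = cube_Laplacian n g"
    show "f = g"
    proof (rule extensional_eqI_walsh_coeff)
      fix S assume S: "S \<subseteq> {1..n}"
      show "walsh_coeff n f S = walsh_coeff n g S"
      proof (cases "S = {}")
        case True
        then show ?thesis using f g by (simp add: mean_zero_functions_iff)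
      next
        case False
        have "real (card S) *\<^sub>R walsh_coeff n f S = real (card S) *\<^sub>R walsh_coeff n g S"
          using eq S by (metis walsh_coeff_cube_Laplacian)
        then show ?thesis using nz[OF S False] by simp
      qed
    qed (use f g in \<open>auto simp: mean_zero_functions_iff\<close>)
  qed simp
  have coe: "walsh_coeff n (\<lambda>\<epsilon>\<in>hamming_cube n. multilinear_poly n
      (\<lambda>S. (1 / real (card S)) *\<^sub>R walsh_coeff n f S) \<epsilon>) S
      = (1 / real (card S)) *\<^sub>R walsh_coeff n f S" if "S \<subseteq> {1..n}" for S
    using that by (subst walsh_coeff_multilinear_poly) (auto simp: restrict_def)
  show "\<exists>h\<in>mean_zero_functions n. f = cube_Laplacian n h"
  proof
    let ?h = "\<lambda>\<epsilon>\<in>hamming_cube n. multilinear_poly n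
      (\<lambda>S. (1 / real (card S)) *\<^sub>R walsh_coeff n f S) \<epsilon>"
    show "?h \<in> mean_zero_functions n"
      using coe[of "{}"] by (simp add: mean_zero_functions_iff)
    show "f = cube_Laplacian n ?h"
    proof (rule extensional_eqI_walsh_coeff)
      fix S assume S: "S \<subseteq> {1..n}"
      show "walsh_coeff n f S = walsh_coeff n (cube_Laplacian n ?h) S"
        using f nz[OF S] unfolding walsh_coeff_cube_Laplacian[OF S] coe[OF S]
        by (cases "S = {}") (auto simp: mean_zero_functions_iff)
    qed (use f in \<open>auto simp: mean_zero_functions_iff cube_Laplacian_def\<close>)
  qed
qed

lemma cube_D_in_mean_zero_functions:
  assumes "j \<in> {1..n}"
  shows "cube_D n j f \<in> mean_zero_functions n"
proof -
  have "walsh_coeff n (cube_D n j f) {} = 0"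
    using walsh_coeff_multilinear_poly[OF cube_D_eq_multilinear_poly[OF assms], of f "{}"] by simp
  then show ?thesis by (simp add: mean_zero_functions_iff cube_D_def)
qed

lemma cube_Laplacian_inv_cube_D:
  assumes j: "j \<in> {1..n}" and \<epsilon>: "\<epsilon> \<in> hamming_cube n"
  shows "cube_Laplacian_inv n (cube_D n j f) \<epsilon> =
    (\<Sum>S | S \<subseteq> {1..n} \<and> j \<in> S. (\<Prod>k\<in>S. \<epsilon> k) *\<^sub>R (1 / real (card S)) *\<^sub>R walsh_coeff n f S)"
proof -
  define h where "h = cube_Laplacian_inv n (cube_D n j f)"
  have h: "h \<in> mean_zero_functions n" "cube_Laplacian n h = cube_D n j f"
    using bij_betw_cube_Laplacian[of n] cube_D_in_mean_zero_functions[OF j]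
    unfolding h_def cube_Laplacian_inv_def bij_betw_def
    by (metis order_refl the_inv_into_into, metis f_the_inv_into_f)
  have co: "walsh_coeff n h S = (if j \<in> S then (1 / real (card S)) *\<^sub>R walsh_coeff n f S else 0)"
    if S: "S \<subseteq> {1..n}" for S
  proof (cases "S = {}")
    case True
    then show ?thesis using h by (simp add: mean_zero_functions_iff)
  next
    case False
    have "card S \<noteq> 0" using S False by (metis card_0_eq finite_atLeastAtMost finite_subset)
    then have "walsh_coeff n h S = (1 / real (card S)) *\<^sub>R real (card S) *\<^sub>R walsh_coeff n h S"
      by simp
    also have "real (card S) *\<^sub>R walsh_coeff n h S = (if j \<in> S then walsh_coeff n f S else 0)"
      using walsh_coeff_cube_Laplacian[OF S, of h] S
        walsh_coeff_multilinear_poly[OF cube_D_eq_multilinear_poly[OF j], of f S]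
      by (simp add: h(2))
    finally show ?thesis by simp
  qed
  have "h \<epsilon> = (\<Sum>S\<in>Pow {1..n}. (\<Prod>k\<in>S. \<epsilon> k) *\<^sub>R walsh_coeff n h S)"
    using multilinear_poly_walsh_coeff[OF \<epsilon>, of h] by (simp add: multilinear_poly_def)
  also have "\<dots> = (\<Sum>S\<in>Pow {1..n}.
      if j \<in> S then (\<Prod>k\<in>S. \<epsilon> k) *\<^sub>R (1 / real (card S)) *\<^sub>R walsh_coeff n f S else 0)"
    by (intro sum.cong refl) (simp add: co)
  also have "\<dots> = (\<Sum>S\<in>{S \<in> Pow {1..n}. j \<in> S}.
      (\<Prod>k\<in>S. \<epsilon> k) *\<^sub>R (1 / real (card S)) *\<^sub>R walsh_coeff n f S)"
    by (rule sum.inter_filter [symmetric]) simp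
  also have "{S \<in> Pow {1..n}. j \<in> S} = {S. S \<subseteq> {1..n} \<and> j \<in> S}" by auto
  finally show ?thesis unfolding h_def .
qed

end

theory Submission
  imports Defs "HOL-Complex_Analysis.Cauchy_Integral_Formula" "HOL-Real_Asymp.Real_Asymp"
begin

text \<open>
  Write \<open>k\<close> for the multiplier \<open>card (S \<inter> A)\<close>. Type \<open>> 1\<close> gives, for some \<open>N\<close>, the bound
  \<open>3/4 * 2 ^ N\<close> for every product of \<open>N\<close> factors \<open>1 - E\<close> with conditional expectations \<open>E\<close>, hence,
  averaging over random \<open>E\<close>, for \<open>(1 - exp (- t k)) ^ N\<close>. So \<open>1 / (1 + exp (- t k))\<close> is bounded uniformly
  in \<open>t\<close>, and, as in Kato's theorem, so are the resolvents of \<open>k\<close> on the imaginary axis and then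
  \<open>t k exp (- t k)\<close>: the heat semigroup is analytic (Pisier). Its periodicity in imaginary time isolates
  \<open>k = 1\<close>, which bounds the Rademacher projection in the variables of \<open>A\<close>.

  For the theorem, write \<open>1 / card S\<close> as the integral of \<open>(1 - h) ^ (card S - 1)\<close> over \<open>h\<close> in \<open>[0, 1]\<close>.
  The integrand is an average of Rademacher projections over a random set \<open>A\<close> of density \<open>h\<close>. Realising
  \<open>A\<close> as each of about \<open>1 / h\<close> colour classes of a random colouring and using type across the
  colours improves the trivial bound \<open>K / h\<close> to a multiple of \<open>h powr (- b)\<close> with \<open>b < 1\<close>, which is integrable.
\<close>

section \<open>Functions on the cube\<close>

text \<open>The factor \<open>1 + exp (- t k)\<close> appears because the integral of
  \<open>exp (\<i> l s) * exp (- s x)\<close> over the half period from 0 to \<open>pi / l\<close>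
  equals \<open>(1 + exp (- (pi / l) * x)) / (x - \<i> l)\<close>: since
  \<open>exp (\<i> pi) = -1\<close>, cutting off the Laplace integral costs exactly a factor that
  can be inverted. That factor is \<open>2 * (1 - u)\<close> with
  \<open>u = (1 - exp (- t k)) / 2\<close>, but the norm of \<open>u\<close> is only known to be at
  most 1, so its Neumann series need not converge; the bound \<open>3/4\<close> for
  \<open>u ^ N\<close> repairs this. The space is real, so the resolvent occurs through its real and
  imaginary parts, and complex analysis serves only to evaluate one scalar integral. The operators
  are multipliers with finitely many real values, hence limits and integrals are taken
  coefficientwise and controlled by seminorms on a finite-dimensional space. All bounds are uniform
  in \<open>A\<close> as well as in \<open>n\<close>, because the colour classes of a random
  colouring are arbitrary sets.\<close>

lemma convex_on_powr_nonneg: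
  fixes q :: real
  assumes "1 \<le> q"
  shows "convex_on {0..} (\<lambda>x. x powr q)"
proof (rule convex_onI)
  have scale: "(t * z) powr q \<le> t * z powr q" if "0 < t" "t < 1" "0 \<le> z" for t z :: real
  proof -
    have "t powr q \<le> t powr 1" using that assms by (intro powr_mono') auto
    then show ?thesis using that by (simp add: powr_mult mult_right_mono)
  qed
  fix t x y :: real
  assume t: "0 < t" "t < 1" and xy: "x \<in> {0..}" "y \<in> {0..}"
  consider "x = 0" | "y = 0" | "0 < x" "0 < y" using xy by force
  then show "((1 - t) *\<^sub>R x + t *\<^sub>R y) powr q \<le> (1 - t) * x powr q + t * y powr q"
  proof cases
    case 3
    then show ?thesis using convex_onD[OF powr_convex[OF assms], of t x y] t by simp
  qed (use t xy scale[of t y] scale[of "1 - t" x] assms in auto)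
qed simp

lemma power_mean_le:
  fixes q :: real
  assumes "1 \<le> q" "finite I" "I \<noteq> {}" "sum w I = 1"
    and "\<And>i. i \<in> I \<Longrightarrow> 0 \<le> w i" "\<And>i. i \<in> I \<Longrightarrow> 0 \<le> x i"
  shows "(\<Sum>i\<in>I. w i * x i) powr q \<le> (\<Sum>i\<in>I. w i * x i powr q)"
  using convex_on_sum[OF assms(2,3) convex_on_powr_nonneg[OF assms(1)] assms(4), of x] assms(5,6)
  by simp

section \<open>Means over the cube and the L^p norm\<close>

lemma hamming_cube_nonempty [simp]: "hamming_cube n \<noteq> {}"
  using card_hamming_cube[of n] by fastforce

lemma cube_mean_real: "cube_mean n f = (\<Sum>\<epsilon>\<in>hamming_cube n. 1 / 2 ^ n * f \<epsilon>)" for f :: "_ \<Rightarrow> real"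
  by (simp add: cube_mean_def sum_distrib_left)

lemma cube_mean_mono:
  fixes f g :: "_ \<Rightarrow> real"
  shows "(\<And>\<epsilon>. \<epsilon> \<in> hamming_cube n \<Longrightarrow> f \<epsilon> \<le> g \<epsilon>) \<Longrightarrow> cube_mean n f \<le> cube_mean n g"
  unfolding cube_mean_real by (intro sum_mono) (simp add: divide_right_mono)

lemma cube_mean_cong:
  "(\<And>\<epsilon>. \<epsilon> \<in> hamming_cube n \<Longrightarrow> f \<epsilon> = g \<epsilon>) \<Longrightarrow> cube_mean n f = cube_mean n g"
  unfolding cube_mean_def by simp

lemma cube_mean_const [simp]: "cube_mean n (\<lambda>_. c) = c"
  by (simp add: cube_mean_def card_hamming_cube scaleR_sum_right sum_constant_scaleR
      flip: scaleR_sum_left)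

lemma cube_mean_nonneg:
  fixes f :: "_ \<Rightarrow> real"
  shows "(\<And>\<epsilon>. \<epsilon> \<in> hamming_cube n \<Longrightarrow> 0 \<le> f \<epsilon>) \<Longrightarrow> 0 \<le> cube_mean n f"
  using cube_mean_mono[of n "\<lambda>_. 0" f] by simp

lemma cube_mean_cmult: "cube_mean n (\<lambda>\<epsilon>. c * f \<epsilon>) = c * cube_mean n f" for c :: real
  unfolding cube_mean_real by (simp only: sum_distrib_left mult_ac)

lemma cube_mean_sum: "cube_mean n (\<lambda>\<epsilon>. \<Sum>i\<in>I. f i \<epsilon>) = (\<Sum>i\<in>I. cube_mean n (f i))"
  unfolding cube_mean_def by (subst sum.swap) (simp add: scaleR_sum_right)

lemma cube_mean_add: "cube_mean n (\<lambda>\<epsilon>. f \<epsilon> + g \<epsilon>) = cube_mean n f + cube_mean n g"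
  unfolding cube_mean_def by (simp add: sum.distrib scaleR_add_right)

lemma cube_mean_swap:
  "cube_mean n (\<lambda>\<epsilon>. cube_mean m (\<lambda>\<delta>. f \<epsilon> \<delta>)) = cube_mean m (\<lambda>\<delta>. cube_mean n (\<lambda>\<epsilon>. f \<epsilon> \<delta>))"
  unfolding cube_mean_def scaleR_sum_right by (subst sum.swap) (simp add: mult.commute)

lemma cube_mean_powr_le:
  fixes q :: real
  assumes "1 \<le> q" "\<And>\<epsilon>. \<epsilon> \<in> hamming_cube n \<Longrightarrow> 0 \<le> f \<epsilon>"
  shows "cube_mean n f powr q \<le> cube_mean n (\<lambda>\<epsilon>. f \<epsilon> powr q)"
  unfolding cube_mean_real
  by (rule power_mean_le) (use assms in \<open>simp_all add: card_hamming_cube\<close>)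

definition cube_norm :: "real \<Rightarrow> nat \<Rightarrow> ((nat \<Rightarrow> real) \<Rightarrow> 'a::real_normed_vector) \<Rightarrow> real" where
  "cube_norm p n f = cube_mean n (\<lambda>\<epsilon>. norm (f \<epsilon>) powr p) powr (1 / p)"

lemma cube_norm_nonneg [simp]: "0 \<le> cube_norm p n f"
  by (simp add: cube_norm_def)

lemma cube_norm_powr:
  "0 < p \<Longrightarrow> cube_norm p n f powr p = cube_mean n (\<lambda>\<epsilon>. norm (f \<epsilon>) powr p)"
  by (simp add: cube_norm_def powr_powr cube_mean_nonneg)

lemma cube_norm_cong:
  "(\<And>\<epsilon>. \<epsilon> \<in> hamming_cube n \<Longrightarrow> f \<epsilon> = g \<epsilon>) \<Longrightarrow> cube_norm p n f = cube_norm p n g"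
  unfolding cube_norm_def by (metis (mono_tags, lifting) cube_mean_cong)

lemma cube_norm_scaleR:
  "0 < p \<Longrightarrow> cube_norm p n (\<lambda>\<epsilon>. c *\<^sub>R f \<epsilon>) = \<bar>c\<bar> * cube_norm p n f"
  by (simp add: cube_norm_def powr_mult cube_mean_cmult cube_mean_nonneg powr_powr)

lemma cube_norm_eq_0_iff:
  assumes "0 < p"
  shows "cube_norm p n f = 0 \<longleftrightarrow> (\<forall>\<epsilon>\<in>hamming_cube n. f \<epsilon> = 0)"
  using assms by (simp add: cube_norm_def cube_mean_def sum_nonneg_eq_0_iff)

text \<open>Minkowski's inequality from convexity of \<open>x powr p\<close>: with \<open>f\<close>
  and \<open>g\<close> normalised by their norms \<open>a\<close> and \<open>b\<close>, the sum is
  \<open>a + b\<close> times a convex combination, and both normalised functions have norm 1. A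
  vanishing norm is split off because of the division.\<close>

lemma cube_norm_triangle:
  assumes p: "1 \<le> p"
  shows "cube_norm p n (\<lambda>\<epsilon>. f \<epsilon> + g \<epsilon>) \<le> cube_norm p n f + cube_norm p n g"
proof -
  define a b where "a = cube_norm p n f" and "b = cube_norm p n g"
  have nn: "0 \<le> a" "0 \<le> b" by (simp_all add: a_def b_def)
  show ?thesis
  proof (cases "a = 0 \<or> b = 0")
    case True
    then consider "\<forall>\<epsilon>\<in>hamming_cube n. f \<epsilon> = 0" | "\<forall>\<epsilon>\<in>hamming_cube n. g \<epsilon> = 0"
      using p by (auto simp: a_def b_def cube_norm_eq_0_iff)
    then show ?thesis
    proof cases
      case 1
      then have "cube_norm p n (\<lambda>\<epsilon>. f \<epsilon> + g \<epsilon>) = cube_norm p n g" by (intro cube_norm_cong) simp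
      then show ?thesis by simp
    next
      case 2
      then have "cube_norm p n (\<lambda>\<epsilon>. f \<epsilon> + g \<epsilon>) = cube_norm p n f" by (intro cube_norm_cong) simp
      then show ?thesis by simp
    qed
  next
    case False
    with nn have ab: "0 < a" "0 < b" by auto
    define t where "t = b / (a + b)"
    have t: "0 \<le> t" "t \<le> 1" "1 - t = a / (a + b)" using ab by (auto simp: t_def field_simps)
    have "norm (f \<epsilon> + g \<epsilon>) powr p
        \<le> (a + b) powr p * ((1 - t) * (norm (f \<epsilon>) powr p / a powr p) + t * (norm (g \<epsilon>) powr p / b powr p))"
      for \<epsilon>
    proof -
      have eq: "(1 - t) * (norm (f \<epsilon>) / a) + t * (norm (g \<epsilon>) / b)
          = (norm (f \<epsilon>) + norm (g \<epsilon>)) / (a + b)"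
        using ab unfolding t(3) by (simp add: t_def add_divide_distrib)
      have "(norm (f \<epsilon>) + norm (g \<epsilon>)) powr p
          = (a + b) powr p * ((1 - t) * (norm (f \<epsilon>) / a) + t * (norm (g \<epsilon>) / b)) powr p"
        using ab unfolding eq by (simp add: powr_divide)
      also have "\<dots> \<le> (a + b) powr p * ((1 - t) * (norm (f \<epsilon>) / a) powr p + t * (norm (g \<epsilon>) / b) powr p)"
        using convex_onD[OF convex_on_powr_nonneg[OF p] t(1,2), of "norm (f \<epsilon>) / a" "norm (g \<epsilon>) / b"] ab
        by (intro mult_left_mono) auto
      finally show ?thesis
        using ab powr_mono2[OF _ _ norm_triangle_ineq[of "f \<epsilon>" "g \<epsilon>"], of p] p
        by (simp add: powr_divide)
    qed
    then have "cube_norm p n (\<lambda>\<epsilon>. f \<epsilon> + g \<epsilon>) powr p \<le> cube_mean n (\<lambda>\<epsilon>. (a + b) powr p *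
        ((1 - t) / a powr p * norm (f \<epsilon>) powr p + t / b powr p * norm (g \<epsilon>) powr p))"
      using p by (subst cube_norm_powr) (auto intro!: cube_mean_mono)
    also have "\<dots> = (a + b) powr p * ((1 - t) / a powr p * a powr p + t / b powr p * b powr p)"
      using p by (simp only: cube_mean_cmult cube_mean_add a_def b_def cube_norm_powr)
    also have "\<dots> = (a + b) powr p" using ab by simp
    finally have "cube_norm p n (\<lambda>\<epsilon>. f \<epsilon> + g \<epsilon>) powr p \<le> (a + b) powr p" .
    then show ?thesis
      using p ab powr_less_mono2[of p "a + b" "cube_norm p n (\<lambda>\<epsilon>. f \<epsilon> + g \<epsilon>)"]
      unfolding a_def b_def by linarith
  qed
qed

section \<open>The type inequality in L^p\<close>

lemma nontrivial_type_less:
  fixes p :: real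
  assumes "nontrivial_type TYPE('a::banach)" and "1 < p"
  obtains r T where "1 < r" "r < p" "0 \<le> T"
    "\<And>m (x :: nat \<Rightarrow> 'a). cube_mean m (\<lambda>\<delta>. norm (\<Sum>j=1..m. \<delta> j *\<^sub>R x j) powr r)
       \<le> T * (\<Sum>j=1..m. norm (x j) powr r)"
proof -
  obtain r T where r: "1 < r" "r \<le> 2" and T: "\<And>m (x :: nat \<Rightarrow> 'a).
      cube_mean m (\<lambda>\<delta>. norm (\<Sum>j=1..m. \<delta> j *\<^sub>R x j) powr r) powr (1 / r)
        \<le> T * (\<Sum>j=1..m. norm (x j) powr r) powr (1 / r)"
    using assms(1) unfolding nontrivial_type_def by blast
  \<comment> \<open>The midpoint keeps the exponent strictly between 1 and \<open>p\<close>. Type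
    passes to smaller exponents: Jensen handles the mean on the left, the embedding of l^s into l^r
    the sum on the right.\<close>
  define s where "s = min r ((1 + p) / 2)"
  have s: "1 < s" "s < p" "s \<le> r" using r assms(2) unfolding s_def min_def by (auto simp: field_simps)
  have "cube_mean m (\<lambda>\<delta>. norm (\<Sum>j=1..m. \<delta> j *\<^sub>R x j) powr s)
       \<le> \<bar>T\<bar> powr s * (\<Sum>j=1..m. norm (x j) powr s)" for m and x :: "nat \<Rightarrow> 'a"
  proof -
    let ?S = "\<lambda>\<delta>. \<Sum>j=1..m. \<delta> j *\<^sub>R x j"
    define A where "A = cube_mean m (\<lambda>\<delta>. norm (?S \<delta>) powr s)"
    define B where "B = (\<Sum>j=1..m. norm (x j) powr s)"
    have nn: "0 \<le> A" "0 \<le> B" by (auto simp: A_def B_def intro: cube_mean_nonneg sum_nonneg)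
    have rs: "1 \<le> r / s" using s by simp
    have "A powr (r / s) \<le> cube_mean m (\<lambda>\<delta>. (norm (?S \<delta>) powr s) powr (r / s))"
      unfolding A_def by (rule cube_mean_powr_le[OF rs]) simp
    also have "\<dots> = cube_mean m (\<lambda>\<delta>. norm (?S \<delta>) powr r)" using s by (simp add: powr_powr)
    finally have "(A powr (r / s)) powr (1 / r) \<le> cube_mean m (\<lambda>\<delta>. norm (?S \<delta>) powr r) powr (1 / r)"
      using r by (intro powr_mono2) auto
    also have "\<dots> \<le> \<bar>T\<bar> * (\<Sum>j=1..m. norm (x j) powr r) powr (1 / r)"
      using T[of m x] by (rule order_trans) (simp add: mult_right_mono)
    also have "(\<Sum>j=1..m. norm (x j) powr r) \<le> B powr (r / s)"
    proof (cases "B = 0")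
      case True
      then have "\<forall>j\<in>{1..m}. x j = 0" by (auto simp: B_def sum_nonneg_eq_0_iff)
      then show ?thesis by simp
    next
      case False
      then have B: "0 < B" using nn by simp
      have "norm (x j) powr r \<le> norm (x j) powr s * B powr (r / s - 1)" if "j \<in> {1..m}" for j
      proof (cases "x j = 0")
        case False
        have "norm (x j) powr s \<le> B"
          unfolding B_def using that by (intro member_le_sum) auto
        then have "(norm (x j) powr s) powr (r / s - 1) \<le> B powr (r / s - 1)"
          using rs by (intro powr_mono2) auto
        moreover have "norm (x j) powr r = norm (x j) powr s * (norm (x j) powr s) powr (r / s - 1)"
          using s False by (simp add: powr_powr right_diff_distrib flip: powr_add)
        ultimately show ?thesis by (simp add: mult_left_mono)
      qed simp
      then have "(\<Sum>j=1..m. norm (x j) powr r) \<le> (\<Sum>j=1..m. norm (x j) powr s * B powr (r / s - 1))"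
        by (intro sum_mono)
      also have "\<dots> = B * B powr (r / s - 1)" by (simp add: B_def sum_distrib_right)
      also have "\<dots> = B powr (r / s)"
        using B by (simp add: powr_mult_base)
      finally show ?thesis .
    qed
    then have "\<bar>T\<bar> * (\<Sum>j=1..m. norm (x j) powr r) powr (1 / r) \<le> \<bar>T\<bar> * (B powr (r / s)) powr (1 / r)"
      using r by (intro mult_left_mono powr_mono2 sum_nonneg) auto
    finally have "A powr (1 / s) \<le> \<bar>T\<bar> * B powr (1 / s)"
      using r by (simp add: powr_powr)
    then have "(A powr (1 / s)) powr s \<le> (\<bar>T\<bar> * B powr (1 / s)) powr s"
      using s by (intro powr_mono2) auto
    then show ?thesis
      using s nn by (simp add: powr_powr powr_mult A_def B_def)
  qed
  then show ?thesis using s by (intro that[of s "\<bar>T\<bar> powr s"]) auto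
qed

text \<open>For the averages \<open>M q\<close>, Jensen bounds \<open>M 1 powr (p - r)\<close> and
  \<open>M r\<close> by the powers \<open>(p - r) / p\<close> and \<open>r / p\<close> of
  \<open>M p\<close>, and these exponents add up to 1. Constant \<open>a\<close> gives
  equality.\<close>

lemma sum_powr_mult_sum_powr_le:
  fixes a :: "nat \<Rightarrow> real"
  assumes "1 \<le> r" "r < p" "1 \<le> m" "\<And>j. j \<in> {1..m} \<Longrightarrow> 0 \<le> a j"
  shows "(\<Sum>j=1..m. a j) powr (p - r) * (\<Sum>j=1..m. a j powr r)
    \<le> real m powr (p - r) * (\<Sum>j=1..m. a j powr p)"
proof -
  define M where "M q = (\<Sum>j=1..m. 1 / m * a j powr q)" for q
  have mean: "(\<Sum>j=1..m. 1 / m * y j) powr q \<le> (\<Sum>j=1..m. 1 / m * y j powr q)"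
    if "1 \<le> q" "\<And>j. j \<in> {1..m} \<Longrightarrow> 0 \<le> y j" for q :: real and y
    using assms(3) that by (intro power_mean_le) auto
  have nn: "0 \<le> M q" for q by (simp add: M_def sum_nonneg)
  have 1: "M 1 powr p \<le> M p"
    using mean[of p "\<lambda>j. a j"] assms by (simp add: M_def)
  have "M r powr (p / r) \<le> M p"
    using mean[of "p / r" "\<lambda>j. a j powr r"] assms by (simp add: M_def powr_powr)
  then have "(M r powr (p / r)) powr (r / p) \<le> M p powr (r / p)"
    using assms by (intro powr_mono2) auto
  then have 2: "M r \<le> M p powr (r / p)" using assms nn by (simp add: powr_powr)
  have "(M 1 powr p) powr ((p - r) / p) \<le> M p powr ((p - r) / p)"
    using assms 1 by (intro powr_mono2) auto
  then have 3: "M 1 powr (p - r) \<le> M p powr ((p - r) / p)" using assms by (simp add: powr_powr)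
  have "M 1 powr (p - r) * M r \<le> M p powr ((p - r) / p) * M p powr (r / p)"
    using 2 3 nn by (intro mult_mono) auto
  also have "\<dots> = M p" using assms nn by (simp add: diff_divide_distrib flip: powr_add)
  finally have le: "M 1 powr (p - r) * M r \<le> M p" .
  have M: "(\<Sum>j=1..m. a j powr q) = m * M q" for q
    using assms(3) by (simp add: M_def flip: sum_divide_distrib)
  have M1: "(\<Sum>j=1..m. a j) = m * M 1" using M[of 1] assms(4) by simp
  have "(\<Sum>j=1..m. a j) powr (p - r) * (\<Sum>j=1..m. a j powr r)
      = real m powr (p - r) * m * (M 1 powr (p - r) * M r)"
    unfolding M1 M using nn by (simp add: powr_mult)
  also have "\<dots> \<le> real m powr (p - r) * m * M p" using le by (intro mult_left_mono) auto
  also have "\<dots> = real m powr (p - r) * (\<Sum>j=1..m. a j powr p)" unfolding M by simp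
  finally show ?thesis .
qed

text \<open>
  A crude substitute for Kahane's inequality: bounding \<open>p - r\<close> of the \<open>p\<close> factors by the triangle
  inequality costs a power of \<open>m\<close>, but the total exponent of \<open>m\<close> stays below \<open>p\<close>.
\<close>

lemma cube_norm_type:
  fixes p :: real
  assumes "nontrivial_type TYPE('a::banach)" and p: "1 < p"
  obtains T b where "1 \<le> T" "0 < b" "b < 1"
    "\<And>n m (y :: nat \<Rightarrow> (nat \<Rightarrow> real) \<Rightarrow> 'a) B. \<lbrakk>1 \<le> m; \<And>j. j \<in> {1..m} \<Longrightarrow> cube_norm p n (y j) \<le> B\<rbrakk> \<Longrightarrow>
       cube_mean m (\<lambda>s. cube_norm p n (\<lambda>\<epsilon>. \<Sum>j=1..m. s j *\<^sub>R y j \<epsilon>) powr p) \<le> (T * real m powr b * B) powr p"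
proof -
  obtain r T where r: "1 < r" "r < p" "0 \<le> T" and T:
    "\<And>m (x :: nat \<Rightarrow> 'a). cube_mean m (\<lambda>\<delta>. norm (\<Sum>j=1..m. \<delta> j *\<^sub>R x j) powr r)
       \<le> T * (\<Sum>j=1..m. norm (x j) powr r)"
    by (rule nontrivial_type_less[OF assms]) blast
  \<comment> \<open>In the exponent of \<open>m\<close>, the part \<open>p - r\<close> comes from
    the factors estimated by the triangle inequality and the 1 from adding \<open>m\<close> terms of
    size \<open>B powr p\<close>. The quotient is below 1 because \<open>r > 1\<close>.\<close>
  define b where "b = (p - r + 1) / p"
  define T' where "T' = (T + 1) powr (1 / p)"
  have b: "0 < b" "b < 1" using r p unfolding b_def by (simp_all add: field_simps)
  have T': "1 \<le> T'" using p r by (simp add: T'_def ge_one_powr_ge_zero)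
  show ?thesis
  proof (rule that[OF T' b])
    fix n m and y :: "nat \<Rightarrow> (nat \<Rightarrow> real) \<Rightarrow> 'a" and B
    assume m: "1 \<le> m" and yB: "\<And>j. j \<in> {1..m} \<Longrightarrow> cube_norm p n (y j) \<le> B"
    have B: "0 \<le> B" using yB[of 1] m by (auto intro: order_trans[OF cube_norm_nonneg])
    let ?S = "\<lambda>s \<epsilon>. \<Sum>j=1..m. s j *\<^sub>R y j \<epsilon>"
    have pt: "cube_mean m (\<lambda>s. norm (?S s \<epsilon>) powr p)
        \<le> T * (real m powr (p - r) * (\<Sum>j=1..m. norm (y j \<epsilon>) powr p))" for \<epsilon>
    proof -
      define V where "V = (\<Sum>j=1..m. norm (y j \<epsilon>)) powr (p - r)"
      have "norm (?S s \<epsilon>) powr p \<le> V * norm (?S s \<epsilon>) powr r" if "s \<in> hamming_cube m" for s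
      proof -
        have s1: "\<bar>s j\<bar> = 1" if "j \<in> {1..m}" for j
          using PiE_mem[of s "{1..m}" "\<lambda>_. {-1, 1}" j] \<open>s \<in> hamming_cube m\<close> that by (auto simp: hamming_cube_def)
        have "norm (?S s \<epsilon>) \<le> (\<Sum>j=1..m. norm (s j *\<^sub>R y j \<epsilon>))" by (rule norm_sum)
        also have "\<dots> = (\<Sum>j=1..m. norm (y j \<epsilon>))" using s1 by (intro sum.cong) auto
        finally have "norm (?S s \<epsilon>) powr (p - r) \<le> V"
          unfolding V_def using r by (intro powr_mono2) auto
        moreover have "norm (?S s \<epsilon>) powr p = norm (?S s \<epsilon>) powr (p - r) * norm (?S s \<epsilon>) powr r"
          by (simp flip: powr_add)
        ultimately show ?thesis by (simp add: mult_right_mono)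
      qed
      then have "cube_mean m (\<lambda>s. norm (?S s \<epsilon>) powr p) \<le> V * cube_mean m (\<lambda>s. norm (?S s \<epsilon>) powr r)"
        by (subst cube_mean_cmult[symmetric]) (rule cube_mean_mono)
      also have "\<dots> \<le> V * (T * (\<Sum>j=1..m. norm (y j \<epsilon>) powr r))"
        using T[of m "\<lambda>j. y j \<epsilon>"] by (intro mult_left_mono) (auto simp: V_def)
      also have "\<dots> = T * (V * (\<Sum>j=1..m. norm (y j \<epsilon>) powr r))" by simp
      also have "\<dots> \<le> T * (real m powr (p - r) * (\<Sum>j=1..m. norm (y j \<epsilon>) powr p))"
        unfolding V_def using r m by (intro mult_left_mono sum_powr_mult_sum_powr_le) auto
      finally show ?thesis .
    qed
    have "cube_mean m (\<lambda>s. cube_norm p n (?S s) powr p)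
        = cube_mean n (\<lambda>\<epsilon>. cube_mean m (\<lambda>s. norm (?S s \<epsilon>) powr p))"
      using p by (simp add: cube_norm_powr) (rule cube_mean_swap)
    also have "\<dots> \<le> cube_mean n (\<lambda>\<epsilon>. T * (real m powr (p - r) * (\<Sum>j=1..m. norm (y j \<epsilon>) powr p)))"
      by (intro cube_mean_mono pt)
    also have "\<dots> = T * (real m powr (p - r) * (\<Sum>j=1..m. cube_norm p n (y j) powr p))"
      using p by (simp only: cube_mean_cmult cube_mean_sum) (simp add: cube_norm_powr)
    also have "\<dots> \<le> T * (real m powr (p - r) * (\<Sum>j=1..m. B powr p))"
      using yB p r by (intro mult_left_mono sum_mono powr_mono2) auto
    also have "\<dots> = T * (real m powr (p - r + 1) * B powr p)"
      using m by (simp add: powr_add)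
    also have "\<dots> \<le> (T + 1) * (real m powr (p - r + 1) * B powr p)"
      by (intro mult_right_mono) auto
    also have "\<dots> = (T' * real m powr b * B) powr p"
      using p r B by (simp add: T'_def b_def powr_mult powr_powr)
    finally show "cube_mean m (\<lambda>s. cube_norm p n (?S s) powr p) \<le> (T' * real m powr b * B) powr p" .
  qed
qed

section \<open>Fourier multipliers\<close>

text \<open>Abstracts the passage from a real multiplier to the norm of the function it produces. By
  the first clause only the coordinates in \<open>I\<close> count; with \<open>I\<close> finite,
  convergence or integrability in each coordinate is then enough, and no vector-valued integral
  occurs.\<close>

definition seminorm_on :: "'i set \<Rightarrow> (('i \<Rightarrow> real) \<Rightarrow> real) \<Rightarrow> bool" where
  "seminorm_on I Q \<longleftrightarrow> (\<forall>x y. (\<forall>i\<in>I. x i = y i) \<longrightarrow> Q x = Q y) \<and>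
     (\<forall>x y. Q (\<lambda>i. x i + y i) \<le> Q x + Q y) \<and> (\<forall>c x. Q (\<lambda>i. c * x i) = \<bar>c\<bar> * Q x)"

context
  fixes I :: "'i set" and Q
  assumes fin: "finite I" and Q: "seminorm_on I Q"
begin

lemma seminorm_onD:
  "(\<And>i. i \<in> I \<Longrightarrow> x i = y i) \<Longrightarrow> Q x = Q y"
  "Q (\<lambda>i. x i + y i) \<le> Q x + Q y"
  "Q (\<lambda>i. c * x i) = \<bar>c\<bar> * Q x"
  using Q unfolding seminorm_on_def by simp_all

lemma seminorm_on_sum:
  "finite J \<Longrightarrow> Q (\<lambda>i. \<Sum>j\<in>J. c j * x j i) \<le> (\<Sum>j\<in>J. \<bar>c j\<bar> * Q (x j))"
proof (induction J rule: finite_induct)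
  case empty
  from seminorm_onD(3)[of 0 "\<lambda>_. 0"]
  show ?case by simp
next
  case (insert j J)
  have "Q (\<lambda>i. c j * x j i + (\<Sum>j\<in>J. c j * x j i)) \<le> Q (\<lambda>i. c j * x j i) + Q (\<lambda>i. \<Sum>j\<in>J. c j * x j i)"
    by (rule seminorm_onD(2))
  then show ?case using insert seminorm_onD(3)[of "c j" "x j"] by simp
qed

text \<open>Expanding \<open>x - y\<close> in unit vectors gives continuity of \<open>Q\<close>
  under coordinatewise convergence.\<close>

lemma seminorm_on_lipschitz:
  "Q x \<le> Q y + (\<Sum>i\<in>I. \<bar>x i - y i\<bar> * Q (\<lambda>k. if k = i then 1 else 0))"
proof -
  have "Q x = Q (\<lambda>k. y k + (\<Sum>i\<in>I. (x i - y i) * (if k = i then 1 else 0)))"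
  proof -
    have "(\<Sum>i\<in>I. (x i - y i) * (if k = i then 1 else 0)) = x k - y k" if "k \<in> I" for k
      using that fin by (simp add: if_distrib[of "\<lambda>z. _ * z"] cong: if_cong)
    then show ?thesis by (intro seminorm_onD(1)) simp
  qed
  also have "\<dots> \<le> Q y + Q (\<lambda>k. \<Sum>i\<in>I. (x i - y i) * (if k = i then 1 else 0))"
    by (rule seminorm_onD(2))
  also have "Q (\<lambda>k. \<Sum>i\<in>I. (x i - y i) * (if k = i then 1 else 0))
      \<le> (\<Sum>i\<in>I. \<bar>x i - y i\<bar> * Q (\<lambda>k. if k = i then 1 else 0))"
    by (rule seminorm_on_sum[OF fin])
  finally show ?thesis by simp
qed

lemma seminorm_on_tendsto_le:
  assumes "\<And>i. i \<in> I \<Longrightarrow> (\<lambda>m. x m i) \<longlonglongrightarrow> y i" "C \<longlonglongrightarrow> c" "\<And>m. Q (x m) \<le> C m"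
  shows "Q y \<le> c"
proof -
  have "(\<lambda>m. C m + (\<Sum>i\<in>I. \<bar>y i - x m i\<bar> * Q (\<lambda>k. if k = i then 1 else 0)))
      \<longlonglongrightarrow> c + (\<Sum>i\<in>I. \<bar>y i - y i\<bar> * Q (\<lambda>k. if k = i then 1 else 0))"
    using assms(1,2) by (intro tendsto_intros) auto
  moreover have "Q y \<le> C m + (\<Sum>i\<in>I. \<bar>y i - x m i\<bar> * Q (\<lambda>k. if k = i then 1 else 0))" for m
    using seminorm_on_lipschitz[of y "x m"] assms(3)[of m] by linarith
  ultimately show ?thesis using LIMSEQ_le_const by fastforce
qed

text \<open>For Riemann sums this is subadditivity, the lengths of the intervals being nonnegative
  weights. The limit is taken along tagged divisions that serve all coordinates and the bound
  \<open>c\<close> at once.\<close>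

lemma seminorm_on_integral_le:
  fixes a b :: real
  assumes "\<And>i. i \<in> I \<Longrightarrow> ((\<lambda>t. x t i) has_integral L i) {a..b}" "(c has_integral C) {a..b}"
    and "\<And>t. t \<in> {a..b} \<Longrightarrow> Q (x t) \<le> c t"
  shows "Q L \<le> C"
proof -
  have ex: "\<exists>D. (\<forall>i\<in>I. norm ((\<Sum>(t,k)\<in>D. measure lborel k *\<^sub>R x t i) - L i) < e) \<and>
      norm ((\<Sum>(t,k)\<in>D. measure lborel k *\<^sub>R c t) - C) < e \<and> D tagged_division_of {a..b}" if "0 < e" for e
  proof -
    have "\<exists>\<gamma>. gauge \<gamma> \<and> (\<forall>D. D tagged_division_of {a..b} \<and> \<gamma> fine D \<longrightarrow>
        norm ((\<Sum>(t,k)\<in>D. measure lborel k *\<^sub>R x t i) - L i) < e)"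
      if "i \<in> I" for i
      using assms(1)[OF that] \<open>0 < e\<close> unfolding has_integral_real by (elim allE impE)
    then obtain \<gamma> where \<gamma>: "\<And>i. i \<in> I \<Longrightarrow> gauge (\<gamma> i)"
      "\<And>i D. \<lbrakk>i \<in> I; D tagged_division_of {a..b}; \<gamma> i fine D\<rbrakk> \<Longrightarrow>
        norm ((\<Sum>(t,k)\<in>D. measure lborel k *\<^sub>R x t i) - L i) < e" by metis
    have "\<exists>\<gamma>. gauge \<gamma> \<and> (\<forall>D. D tagged_division_of {a..b} \<and> \<gamma> fine D \<longrightarrow>
        norm ((\<Sum>(t,k)\<in>D. measure lborel k *\<^sub>R c t) - C) < e)"
      using assms(2) \<open>0 < e\<close> unfolding has_integral_real by (elim allE impE)
    then obtain \<gamma>' where \<gamma>': "gauge \<gamma>'"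
      "\<And>D. \<lbrakk>D tagged_division_of {a..b}; \<gamma>' fine D\<rbrakk> \<Longrightarrow> norm ((\<Sum>(t,k)\<in>D. measure lborel k *\<^sub>R c t) - C) < e"
      by metis
    \<comment> \<open>The intersection is again a gauge because \<open>I\<close> is finite; this
      yields the common fine division.\<close>
    have "gauge (\<lambda>t. \<gamma>' t \<inter> \<Inter> {\<gamma> i t | i. i \<in> I})"
      using gauge_Int[OF \<gamma>'(1) gauge_Inter[of I "\<gamma>"]] \<gamma>(1) fin by simp
    then obtain D where D: "D tagged_division_of {a..b}" "(\<lambda>t. \<gamma>' t \<inter> \<Inter> {\<gamma> i t | i. i \<in> I}) fine D"
      using fine_division_exists[of _ a b] unfolding box_real by blast
    have fine: "i \<in> I \<Longrightarrow> \<gamma> i fine D" "\<gamma>' fine D" for i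
      using fineD[OF D(2)] by (fastforce intro!: fineI)+
    show ?thesis
    proof (intro exI[of _ D] conjI ballI)
      show "norm ((\<Sum>(t,k)\<in>D. measure lborel k *\<^sub>R x t i) - L i) < e" if "i \<in> I" for i
        by (rule \<gamma>(2)[OF that D(1) fine(1)[OF that]])
      show "norm ((\<Sum>(t,k)\<in>D. measure lborel k *\<^sub>R c t) - C) < e"
        by (rule \<gamma>'(2)[OF D(1) fine(2)])
    qed (rule D(1))
  qed
  have "\<forall>m. \<exists>D. (\<forall>i\<in>I. norm ((\<Sum>(t,k)\<in>D. measure lborel k *\<^sub>R x t i) - L i) < inverse (real (Suc m))) \<and>
      norm ((\<Sum>(t,k)\<in>D. measure lborel k *\<^sub>R c t) - C) < inverse (real (Suc m)) \<and> D tagged_division_of {a..b}"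
    using ex by simp
  then obtain D where
    D1: "\<And>m i. i \<in> I \<Longrightarrow> norm ((\<Sum>(t,k)\<in>D m. measure lborel k *\<^sub>R x t i) - L i) < inverse (real (Suc m))" and
    D2: "\<And>m. norm ((\<Sum>(t,k)\<in>D m. measure lborel k *\<^sub>R c t) - C) < inverse (real (Suc m))" and
    D3: "\<And>m. D m tagged_division_of {a..b}" by metis
  show ?thesis
  proof (rule seminorm_on_tendsto_le)
    show "(\<lambda>m. \<Sum>(t,k)\<in>D m. measure lborel k *\<^sub>R x t i) \<longlonglongrightarrow> L i" if "i \<in> I" for i
      by (rule Lim_transform_bound[OF _ LIMSEQ_inverse_real_of_nat, THEN LIM_zero_cancel])
        (use D1[OF that] in \<open>auto intro!: always_eventually less_imp_le\<close>)
    show "(\<lambda>m. \<Sum>(t,k)\<in>D m. measure lborel k *\<^sub>R c t) \<longlonglongrightarrow> C"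
      by (rule Lim_transform_bound[OF _ LIMSEQ_inverse_real_of_nat, THEN LIM_zero_cancel])
        (use D2 in \<open>auto intro!: always_eventually less_imp_le\<close>)
    show "Q (\<lambda>i. \<Sum>(t,k)\<in>D m. measure lborel k *\<^sub>R x t i) \<le> (\<Sum>(t,k)\<in>D m. measure lborel k *\<^sub>R c t)" for m
    proof -
      have "Q (\<lambda>i. \<Sum>d\<in>D m. measure lborel (snd d) * x (fst d) i) \<le> (\<Sum>d\<in>D m. \<bar>measure lborel (snd d)\<bar> * Q (x (fst d)))"
        by (rule seminorm_on_sum) (use D3[of m] in auto)
      also have "\<dots> \<le> (\<Sum>d\<in>D m. measure lborel (snd d) * c (fst d))"
      proof (rule sum_mono)
        fix d assume d: "d \<in> D m"
        then have "fst d \<in> {a..b}" using tag_in_interval[OF D3[of m]] by (cases d) auto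
        then show "\<bar>measure lborel (snd d)\<bar> * Q (x (fst d)) \<le> measure lborel (snd d) * c (fst d)"
          using assms(3) by (simp add: mult_left_mono)
      qed
      finally show ?thesis by (simp add: case_prod_beta)
    qed
  qed
qed

end

section \<open>Real multipliers acting on Walsh expansions\<close>

definition walsh_mult :: "nat \<Rightarrow> (nat set \<Rightarrow> real) \<Rightarrow> ((nat \<Rightarrow> real) \<Rightarrow> 'a) \<Rightarrow> (nat \<Rightarrow> real) \<Rightarrow> 'a::real_vector" where
  "walsh_mult n \<phi> f = multilinear_poly n (\<lambda>S. \<phi> S *\<^sub>R walsh_coeff n f S)"

lemma walsh_mult_cong: "(\<And>S. S \<subseteq> {1..n} \<Longrightarrow> \<phi> S = \<psi> S) \<Longrightarrow> walsh_mult n \<phi> f = walsh_mult n \<psi> f"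
  by (auto simp: walsh_mult_def multilinear_poly_def intro!: ext sum.cong)

lemma walsh_mult_walsh_mult:
  "walsh_mult n \<phi> (walsh_mult n \<psi> f) = walsh_mult n (\<lambda>S. \<phi> S * \<psi> S) f"
proof -
  have "walsh_coeff n (walsh_mult n \<psi> f) S = \<psi> S *\<^sub>R walsh_coeff n f S" if "S \<subseteq> {1..n}" for S
    using that by (subst walsh_coeff_multilinear_poly[where c = "\<lambda>S. \<psi> S *\<^sub>R walsh_coeff n f S"])
      (simp_all add: walsh_mult_def)
  then show ?thesis
    unfolding walsh_mult_def[of n \<phi>] walsh_mult_def[of n "\<lambda>S. \<phi> S * \<psi> S"]
    by (auto simp: multilinear_poly_def intro!: ext sum.cong)
qed

lemma walsh_mult_add: "walsh_mult n (\<lambda>S. \<phi> S + \<psi> S) f \<epsilon> = walsh_mult n \<phi> f \<epsilon> + walsh_mult n \<psi> f \<epsilon>"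
  by (simp add: walsh_mult_def multilinear_poly_def scaleR_add_left scaleR_add_right sum.distrib)

lemma walsh_mult_cmult: "walsh_mult n (\<lambda>S. c * \<phi> S) f \<epsilon> = c *\<^sub>R walsh_mult n \<phi> f \<epsilon>"
  by (simp add: walsh_mult_def multilinear_poly_def scaleR_sum_right mult_ac)

lemma walsh_mult_sum:
  "walsh_mult n (\<lambda>S. \<Sum>i\<in>I. c i * \<phi> i S) f \<epsilon> = (\<Sum>i\<in>I. c i *\<^sub>R walsh_mult n (\<phi> i) f \<epsilon>)"
  unfolding walsh_mult_def multilinear_poly_def scaleR_sum_right scaleR_sum_left
  by (subst sum.swap) (simp add: mult_ac)

lemma walsh_mult_one: "\<epsilon> \<in> hamming_cube n \<Longrightarrow> walsh_mult n (\<lambda>_. 1) f \<epsilon> = f \<epsilon>"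
  by (simp add: walsh_mult_def multilinear_poly_walsh_coeff)

lemma hamming_cube_cases: "\<epsilon> \<in> hamming_cube n \<Longrightarrow> i \<in> {1..n} \<Longrightarrow> \<epsilon> i = -1 \<or> \<epsilon> i = 1"
  by (auto simp: hamming_cube_def dest!: PiE_mem)

lemma bij_betw_hamming_cube_shift:
  assumes "\<eta> \<in> hamming_cube n"
  shows "bij_betw (\<lambda>\<epsilon>. \<lambda>i\<in>{1..n}. \<eta> i * \<epsilon> i) (hamming_cube n) (hamming_cube n)"
proof -
  let ?s = "\<lambda>\<epsilon>. \<lambda>i\<in>{1..n}. \<eta> i * \<epsilon> i"
  have maps: "?s \<in> hamming_cube n \<rightarrow> hamming_cube n"
  proof
    fix \<epsilon> assume "\<epsilon> \<in> hamming_cube n"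
    then have "\<eta> i * \<epsilon> i \<in> {-1, 1}" if "i \<in> {1..n}" for i
      using hamming_cube_cases[OF assms that] hamming_cube_cases[of \<epsilon> n i] that by auto
    then show "?s \<epsilon> \<in> hamming_cube n" unfolding hamming_cube_def by (intro restrict_PiE[THEN iffD2]) auto
  qed
  have inv: "?s (?s \<epsilon>) = \<epsilon>" if "\<epsilon> \<in> hamming_cube n" for \<epsilon>
  proof
    fix i
    show "?s (?s \<epsilon>) i = \<epsilon> i"
    proof (cases "i \<in> {1..n}")
      case True
      then show ?thesis using hamming_cube_cases[OF assms True] by auto
    next
      case False
      then have "\<epsilon> i = undefined" using that PiE_arb unfolding hamming_cube_def by metis
      then show ?thesis using False by (simp only: restrict_apply if_False)
    qed
  qed
  show ?thesis by (rule bij_betwI[where g = ?s]) (rule maps | erule inv)+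
qed

lemma cube_mean_shift:
  assumes "\<eta> \<in> hamming_cube n"
  shows "cube_mean n (\<lambda>\<epsilon>. f (\<lambda>i\<in>{1..n}. \<eta> i * \<epsilon> i)) = cube_mean n f"
  unfolding cube_mean_def using sum.reindex_bij_betw[OF bij_betw_hamming_cube_shift[OF assms], of f] by simp

text \<open>The Walsh multiplier of the conditional expectation that averages out the variables in
  \<open>A\<close>.\<close>

definition avoid :: "nat set \<Rightarrow> nat set \<Rightarrow> real" where
  "avoid A S = (if S \<inter> A = {} then 1 else 0)"

lemma prod_avoid: "finite I \<Longrightarrow> (\<Prod>i\<in>I. avoid (A i) S) = avoid (\<Union>i\<in>I. A i) S"
  by (induction I rule: finite_induct) (auto simp: avoid_def)

text \<open>Put each element of \<open>A\<close> into \<open>B\<close> independently with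
  probability \<open>1 - a\<close>: then \<open>B\<close> misses \<open>S\<close> with probability
  \<open>a ^ card (S \<inter> A)\<close>. For \<open>a\<close> in [0, 1] the noise operator in the
  variables of \<open>A\<close> is thus an average of conditional expectations.\<close>

lemma sum_avoid_eq_power:
  assumes "finite A"
  shows "(\<Sum>B\<in>Pow A. (1 - a) ^ card B * a ^ card (A - B) * avoid B S) = a ^ card (S \<inter> A)"
    and "(\<Sum>B\<in>Pow A. (1 - a) ^ card B * a ^ card (A - B)) = 1"
proof -
  have 1: "(1 - a) ^ card B * a ^ card (A - B) * avoid B S
      = (\<Prod>i\<in>B. if i \<in> S then 0 else 1 - a) * (\<Prod>i\<in>A - B. a)" if "B \<in> Pow A" for B
  proof -
    have "finite B" using that assms finite_subset by auto
    then have "(\<Prod>i\<in>B. if i \<in> S then 0 else 1 - a) = (1 - a) ^ card B * avoid B S"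
      by (induction B rule: finite_induct) (auto simp: avoid_def)
    then show ?thesis by simp
  qed
  have "(\<Sum>B\<in>Pow A. (1 - a) ^ card B * a ^ card (A - B) * avoid B S)
      = (\<Sum>B\<in>Pow A. (\<Prod>i\<in>B. if i \<in> S then 0 else 1 - a) * (\<Prod>i\<in>A - B. a))"
    using 1 by (rule sum.cong[OF refl])
  also have "\<dots> = (\<Prod>i\<in>A. (if i \<in> S then 0 else 1 - a) + a)"
    by (rule prod_add[OF assms, symmetric])
  also have "\<dots> = (\<Prod>i\<in>A. if i \<in> S then a else 1)" by (rule prod.cong) auto
  also have "\<dots> = a ^ card (S \<inter> A)" using assms by (simp add: prod.If_cases Int_commute)
  finally show "(\<Sum>B\<in>Pow A. (1 - a) ^ card B * a ^ card (A - B) * avoid B S) = a ^ card (S \<inter> A)" .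
  show "(\<Sum>B\<in>Pow A. (1 - a) ^ card B * a ^ card (A - B)) = 1"
    using prod_add[OF assms, of "\<lambda>_. 1 - a" "\<lambda>_. a"] by simp
qed

text \<open>\<open>X\<close> fixes the type \<open>'a\<close> of the values, which does not occur in
  the type of \<open>bounded_mult\<close>.\<close>

locale cube_multipliers =
  fixes p :: real and X :: "'a::banach itself"
  assumes p: "1 < p"
begin

definition bounded_mult :: "nat \<Rightarrow> (nat set \<Rightarrow> real) \<Rightarrow> real \<Rightarrow> bool" where
  "bounded_mult n \<phi> C \<longleftrightarrow>
     (\<forall>f :: (nat \<Rightarrow> real) \<Rightarrow> 'a. cube_norm p n (walsh_mult n \<phi> f) \<le> C * cube_norm p n f)"

lemma seminorm_on_walsh_mult:
  "seminorm_on (Pow {1..n}) (\<lambda>\<phi>. cube_norm p n (walsh_mult n \<phi> (f :: _ \<Rightarrow> 'a)))"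
  unfolding seminorm_on_def
proof (intro conjI allI impI)
  fix x y :: "nat set \<Rightarrow> real" and c
  show "cube_norm p n (walsh_mult n x f) = cube_norm p n (walsh_mult n y f)" if "\<forall>S\<in>Pow {1..n}. x S = y S"
    using walsh_mult_cong[of n x y f] that by simp
  show "cube_norm p n (walsh_mult n (\<lambda>S. x S + y S) f)
      \<le> cube_norm p n (walsh_mult n x f) + cube_norm p n (walsh_mult n y f)"
    using cube_norm_triangle[of p n "walsh_mult n x f" "walsh_mult n y f"] p
    by (simp flip: walsh_mult_add)
  show "cube_norm p n (walsh_mult n (\<lambda>S. c * x S) f) = \<bar>c\<bar> * cube_norm p n (walsh_mult n x f)"
    using cube_norm_scaleR[of p n c "walsh_mult n x f"] p by (simp flip: walsh_mult_cmult)
qed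

lemma bounded_mult_cong:
  "bounded_mult n \<phi> C \<Longrightarrow> (\<And>S. S \<subseteq> {1..n} \<Longrightarrow> \<phi> S = \<psi> S) \<Longrightarrow> bounded_mult n \<psi> C"
  unfolding bounded_mult_def using walsh_mult_cong[of n \<phi> \<psi>] by metis

lemma bounded_mult_mono: "bounded_mult n \<phi> C \<Longrightarrow> C \<le> C' \<Longrightarrow> bounded_mult n \<phi> C'"
  unfolding bounded_mult_def by (meson cube_norm_nonneg mult_right_mono order_trans)

lemma bounded_mult_sum:
  assumes "finite J" "\<And>j. j \<in> J \<Longrightarrow> bounded_mult n (\<phi> j) (C j)"
  shows "bounded_mult n (\<lambda>S. \<Sum>j\<in>J. c j * \<phi> j S) (\<Sum>j\<in>J. \<bar>c j\<bar> * C j)"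
  unfolding bounded_mult_def
proof
  fix f :: "(nat \<Rightarrow> real) \<Rightarrow> 'a"
  have "cube_norm p n (walsh_mult n (\<lambda>S. \<Sum>j\<in>J. c j * \<phi> j S) f)
      \<le> (\<Sum>j\<in>J. \<bar>c j\<bar> * cube_norm p n (walsh_mult n (\<phi> j) f))"
    by (rule seminorm_on_sum[OF _ seminorm_on_walsh_mult assms(1)]) simp
  also have "\<dots> \<le> (\<Sum>j\<in>J. \<bar>c j\<bar> * (C j * cube_norm p n f))"
    using assms(2) by (intro sum_mono mult_left_mono) (auto simp: bounded_mult_def)
  finally show "cube_norm p n (walsh_mult n (\<lambda>S. \<Sum>j\<in>J. c j * \<phi> j S) f)
      \<le> (\<Sum>j\<in>J. \<bar>c j\<bar> * C j) * cube_norm p n f"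
    by (simp add: sum_distrib_right mult.assoc)
qed

lemma bounded_mult_cmult: "bounded_mult n \<phi> C \<Longrightarrow> bounded_mult n (\<lambda>S. c * \<phi> S) (\<bar>c\<bar> * C)"
  using bounded_mult_sum[of "{()}" n "\<lambda>_. \<phi>" "\<lambda>_. C" "\<lambda>_. c"] by simp

lemma bounded_mult_add:
  "bounded_mult n \<phi> C \<Longrightarrow> bounded_mult n \<psi> D \<Longrightarrow> bounded_mult n (\<lambda>S. \<phi> S + \<psi> S) (C + D)"
  using bounded_mult_sum[of "{True, False}" n "\<lambda>j. if j then \<phi> else \<psi>" "\<lambda>j. if j then C else D" "\<lambda>_. 1"]
  by simp

lemma bounded_mult_diff:
  "bounded_mult n \<phi> C \<Longrightarrow> bounded_mult n \<psi> D \<Longrightarrow> bounded_mult n (\<lambda>S. \<phi> S - \<psi> S) (C + D)"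
  using bounded_mult_add[OF _ bounded_mult_cmult[of n \<psi> D "-1"]] by simp

lemma bounded_mult_one: "bounded_mult n (\<lambda>_. 1) 1"
  unfolding bounded_mult_def
proof
  fix f :: "(nat \<Rightarrow> real) \<Rightarrow> 'a"
  show "cube_norm p n (walsh_mult n (\<lambda>_. 1) f) \<le> 1 * cube_norm p n f"
    using cube_norm_cong[of n "walsh_mult n (\<lambda>_. 1) f" f p] by (simp add: walsh_mult_one)
qed

lemma bounded_mult_mult:
  assumes "bounded_mult n \<phi> C" "bounded_mult n \<psi> D" "0 \<le> C"
  shows "bounded_mult n (\<lambda>S. \<phi> S * \<psi> S) (C * D)"
  unfolding bounded_mult_def
proof
  fix f :: "(nat \<Rightarrow> real) \<Rightarrow> 'a"
  have "cube_norm p n (walsh_mult n \<phi> (walsh_mult n \<psi> f)) \<le> C * cube_norm p n (walsh_mult n \<psi> f)"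
    using assms(1) by (simp add: bounded_mult_def)
  also have "\<dots> \<le> C * (D * cube_norm p n f)"
    using assms by (intro mult_left_mono) (auto simp: bounded_mult_def)
  finally show "cube_norm p n (walsh_mult n (\<lambda>S. \<phi> S * \<psi> S) f) \<le> C * D * cube_norm p n f"
    by (simp add: walsh_mult_walsh_mult mult_ac)
qed

lemma bounded_mult_prod:
  assumes "finite J" "\<And>j. j \<in> J \<Longrightarrow> bounded_mult n (\<phi> j) (C j)" "\<And>j. j \<in> J \<Longrightarrow> 0 \<le> C j"
  shows "bounded_mult n (\<lambda>S. \<Prod>j\<in>J. \<phi> j S) (\<Prod>j\<in>J. C j)"
  using assms
  by (induction J rule: finite_induct) (simp_all add: bounded_mult_one bounded_mult_mult)

lemma bounded_mult_power:
  "bounded_mult n \<phi> C \<Longrightarrow> 0 \<le> C \<Longrightarrow> bounded_mult n (\<lambda>S. \<phi> S ^ k) (C ^ k)"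
  using bounded_mult_prod[of "{..<k}" n "\<lambda>_. \<phi>" "\<lambda>_. C"] by simp

lemma bounded_mult_tendsto:
  assumes "\<And>m. bounded_mult n (\<phi> m) (C m)" "\<And>S. S \<subseteq> {1..n} \<Longrightarrow> (\<lambda>m. \<phi> m S) \<longlonglongrightarrow> \<psi> S" "C \<longlonglongrightarrow> c"
  shows "bounded_mult n \<psi> c"
  unfolding bounded_mult_def
proof
  fix f :: "(nat \<Rightarrow> real) \<Rightarrow> 'a"
  show "cube_norm p n (walsh_mult n \<psi> f) \<le> c * cube_norm p n f"
    by (rule seminorm_on_tendsto_le[OF _ seminorm_on_walsh_mult, where x = \<phi> and C = "\<lambda>m. C m * cube_norm p n f"])
      (use assms in \<open>auto simp: bounded_mult_def intro!: tendsto_mult_right\<close>)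
qed

lemma bounded_mult_integral:
  fixes a b :: real
  assumes "\<And>t. t \<in> {a..b} \<Longrightarrow> bounded_mult n (\<phi> t) (C t)"
    and "\<And>S. S \<subseteq> {1..n} \<Longrightarrow> ((\<lambda>t. \<phi> t S) has_integral \<psi> S) {a..b}" "(C has_integral c) {a..b}"
  shows "bounded_mult n \<psi> c"
  unfolding bounded_mult_def
proof
  fix f :: "(nat \<Rightarrow> real) \<Rightarrow> 'a"
  show "cube_norm p n (walsh_mult n \<psi> f) \<le> c * cube_norm p n f"
    by (rule seminorm_on_integral_le[OF _ seminorm_on_walsh_mult, where x = \<phi> and c = "\<lambda>m. C m * cube_norm p n f"])
      (use assms in \<open>auto simp: bounded_mult_def intro!: has_integral_mult_left\<close>)
qed

section \<open>Translations, conditional expectations and noise\<close>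

lemma bounded_mult_walsh:
  assumes \<eta>: "\<eta> \<in> hamming_cube n"
  shows "bounded_mult n (\<lambda>S. \<Prod>i\<in>S. \<eta> i) 1"
  unfolding bounded_mult_def
proof
  fix f :: "(nat \<Rightarrow> real) \<Rightarrow> 'a"
  let ?s = "\<lambda>\<epsilon>. \<lambda>i\<in>{1..n}. \<eta> i * \<epsilon> i"
  \<comment> \<open>Walsh functions are characters, so the multiplier is translation by
    \<open>\<eta>\<close> in the group of signs, which preserves the uniform measure.\<close>
  have "walsh_mult n (\<lambda>S. \<Prod>i\<in>S. \<eta> i) f \<epsilon> = f (?s \<epsilon>)" if "\<epsilon> \<in> hamming_cube n" for \<epsilon>
  proof -
    have "?s \<epsilon> \<in> hamming_cube n" using bij_betw_hamming_cube_shift[OF \<eta>] that by (auto simp: bij_betw_def)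
    then have "f (?s \<epsilon>) = multilinear_poly n (walsh_coeff n f) (?s \<epsilon>)"
      by (simp add: multilinear_poly_walsh_coeff)
    also have "\<dots> = walsh_mult n (\<lambda>S. \<Prod>i\<in>S. \<eta> i) f \<epsilon>"
      unfolding walsh_mult_def multilinear_poly_def
    proof (intro sum.cong refl)
      fix S assume "S \<in> Pow {1..n}"
      then have "(\<Prod>i\<in>S. ?s \<epsilon> i) = (\<Prod>i\<in>S. \<eta> i * \<epsilon> i)" by (intro prod.cong) auto
      then show "(\<Prod>i\<in>S. ?s \<epsilon> i) *\<^sub>R walsh_coeff n f S
          = (\<Prod>i\<in>S. \<epsilon> i) *\<^sub>R (\<Prod>i\<in>S. \<eta> i) *\<^sub>R walsh_coeff n f S"
        by (simp add: prod.distrib mult_ac)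
    qed
    finally show ?thesis by simp
  qed
  then have "cube_norm p n (walsh_mult n (\<lambda>S. \<Prod>i\<in>S. \<eta> i) f) = cube_norm p n (\<lambda>\<epsilon>. f (?s \<epsilon>))"
    by (rule cube_norm_cong)
  also have "\<dots> = cube_norm p n f"
    unfolding cube_norm_def using cube_mean_shift[OF \<eta>, of "\<lambda>\<epsilon>. norm (f \<epsilon>) powr p"] by simp
  finally show "cube_norm p n (walsh_mult n (\<lambda>S. \<Prod>i\<in>S. \<eta> i) f) \<le> 1 * cube_norm p n f" by simp
qed

lemma bounded_mult_walsh_Int:
  assumes \<eta>: "\<eta> \<in> hamming_cube n"
  shows "bounded_mult n (\<lambda>S. \<Prod>i\<in>S \<inter> A. \<eta> i) 1"
proof (rule bounded_mult_cong)
  let ?\<eta> = "\<lambda>i\<in>{1..n}. if i \<in> A then \<eta> i else 1"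
  have "?\<eta> \<in> hamming_cube n"
    unfolding hamming_cube_def using hamming_cube_cases[OF \<eta>] by (intro restrict_PiE[THEN iffD2]) auto
  then show "bounded_mult n (\<lambda>S. \<Prod>i\<in>S. ?\<eta> i) 1" by (rule bounded_mult_walsh)
  fix S assume S: "S \<subseteq> {1..n}"
  then have "(\<Prod>i\<in>S. ?\<eta> i) = (\<Prod>i\<in>S. if i \<in> A then \<eta> i else 1)" by (intro prod.cong) auto
  also have "\<dots> = (\<Prod>i\<in>S \<inter> A. \<eta> i)"
    using finite_subset[OF S] by (simp add: prod.inter_restrict)
  finally show "(\<Prod>i\<in>S. ?\<eta> i) = (\<Prod>i\<in>S \<inter> A. \<eta> i)" .
qed

text \<open>An average of translations in the variables of \<open>A\<close>: orthogonality to the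
  constant function leaves only those \<open>S\<close> that miss \<open>A\<close>.\<close>

lemma bounded_mult_avoid: "bounded_mult n (avoid A) 1"
proof (rule bounded_mult_cong)
  have "bounded_mult n (\<lambda>S. \<Sum>\<eta>\<in>hamming_cube n. 1 / 2 ^ n * (\<Prod>i\<in>S \<inter> A. \<eta> i))
      (\<Sum>\<eta>\<in>hamming_cube n. \<bar>1 / 2 ^ n\<bar> * 1)"
    using bounded_mult_walsh_Int by (intro bounded_mult_sum) auto
  then show "bounded_mult n (\<lambda>S. \<Sum>\<eta>\<in>hamming_cube n. 1 / 2 ^ n * (\<Prod>i\<in>S \<inter> A. \<eta> i)) 1"
    by (simp add: card_hamming_cube)
  fix S assume "S \<subseteq> {1..n}"
  then have "S \<inter> A \<subseteq> {1..n}" by auto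
  from walsh_orthogonal[OF this, of "{}"]
  show "(\<Sum>\<eta>\<in>hamming_cube n. 1 / 2 ^ n * (\<Prod>i\<in>S \<inter> A. \<eta> i)) = avoid A S"
    by (simp add: avoid_def flip: sum_divide_distrib)
qed

text \<open>A bound uniform in the random set \<open>B\<close> of \<open>sum_avoid_eq_power\<close>
  survives averaging. The spectator \<open>\<psi>\<close> holds the other factors of a product, so
  that conditional expectations can be exchanged for noise one factor at a time.\<close>

lemma bounded_mult_power_card:
  assumes "finite A" "0 \<le> a" "a \<le> 1" "\<And>B. B \<subseteq> A \<Longrightarrow> bounded_mult n (\<lambda>S. \<psi> S * (1 - avoid B S)) C"
  shows "bounded_mult n (\<lambda>S. \<psi> S * (1 - a ^ card (S \<inter> A))) C"
proof -
  let ?w = "\<lambda>B. (1 - a) ^ card B * a ^ card (A - B)"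
  have "bounded_mult n (\<lambda>S. \<Sum>B\<in>Pow A. ?w B * (\<psi> S * (1 - avoid B S))) (\<Sum>B\<in>Pow A. \<bar>?w B\<bar> * C)"
    using assms by (intro bounded_mult_sum) auto
  moreover have "(\<Sum>B\<in>Pow A. ?w B * (\<psi> S * (1 - avoid B S))) = \<psi> S * (1 - a ^ card (S \<inter> A))" for S
  proof -
    have "(\<Sum>B\<in>Pow A. ?w B * (\<psi> S * (1 - avoid B S)))
        = \<psi> S * ((\<Sum>B\<in>Pow A. ?w B) - (\<Sum>B\<in>Pow A. ?w B * avoid B S))"
      by (simp add: sum_distrib_left right_diff_distrib mult_ac flip: sum_subtractf)
    then show ?thesis by (simp add: sum_avoid_eq_power[OF assms(1)])
  qed
  moreover have "(\<Sum>B\<in>Pow A. \<bar>?w B\<bar> * C) = C"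
    using sum_avoid_eq_power(2)[OF assms(1), of a] assms(2,3) by (simp add: abs_mult flip: sum_distrib_right)
  ultimately show ?thesis by simp
qed

lemma bounded_mult_noise:
  assumes "finite A" "0 \<le> a" "a \<le> 1"
  shows "bounded_mult n (\<lambda>S. a ^ card (S \<inter> A)) 1"
proof -
  let ?w = "\<lambda>B. (1 - a) ^ card B * a ^ card (A - B)"
  have "bounded_mult n (\<lambda>S. \<Sum>B\<in>Pow A. ?w B * avoid B S) (\<Sum>B\<in>Pow A. \<bar>?w B\<bar> * 1)"
    using assms bounded_mult_avoid by (intro bounded_mult_sum) auto
  then show ?thesis
    using assms(2,3) by (simp add: sum_avoid_eq_power[OF assms(1)] abs_mult)
qed

end

section \<open>Powers of the noise operator\<close>

text \<open>Products of these conditional expectations are again of this kind, so for every choice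
  of signs the product is, up to its sign, a contraction.\<close>

lemma prod_if_sign_avoid:
  assumes "finite I"
  shows "(\<Prod>i\<in>I. if s i = (1::real) then - avoid (A i) S else 1)
    = (-1) ^ card {i \<in> I. s i = 1} * avoid (\<Union>i\<in>{i \<in> I. s i = 1}. A i) S"
proof -
  have "(\<Prod>i\<in>I. if s i = 1 then - avoid (A i) S else 1) = (\<Prod>i\<in>{i \<in> I. s i = 1}. - avoid (A i) S)"
    by (rule prod.inter_filter[OF assms, symmetric])
  also have "\<dots> = (\<Prod>i\<in>{i \<in> I. s i = 1}. (-1) * avoid (A i) S)" by simp
  also have "\<dots> = (-1) ^ card {i \<in> I. s i = 1} * avoid (\<Union>i\<in>{i \<in> I. s i = 1}. A i) S"
    using assms by (subst prod.distrib) (simp add: prod_avoid)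
  finally show ?thesis .
qed

text \<open>
  The hybrid terms on the left are, up to a scalar, an average over the signs \<open>s\<close> of contractions
  applied to Rademacher sums, so the type inequality makes them small.
\<close>

lemma sum_avoid_hybrid:
  "(\<Sum>j=1..N. avoid (A j) S * (\<Prod>i\<in>{1..N} - {j}. 1 - avoid (A i) S))
    = (\<Sum>s\<in>hamming_cube N. - 1 / 2 * ((\<Prod>i=1..N. if s i = 1 then - avoid (A i) S else 1)
         * (\<Sum>j=1..N. s j * avoid (A j) S)))"
proof -
  let ?h = "\<lambda>i x. if x = (1::real) then - avoid (A i) S else 1"
  have single: "(\<Sum>s\<in>hamming_cube N. (\<Prod>i=1..N. ?h i (s i)) * (s j * avoid (A j) S))
      = - 2 * (avoid (A j) S * (\<Prod>i\<in>{1..N} - {j}. 1 - avoid (A i) S))" if j: "j \<in> {1..N}" for j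
  proof -
    let ?k = "\<lambda>i x. ?h i x * (if i = j then x * avoid (A j) S else 1)"
    have "(\<Sum>s\<in>hamming_cube N. (\<Prod>i=1..N. ?h i (s i)) * (s j * avoid (A j) S))
        = (\<Sum>s\<in>{1..N} \<rightarrow>\<^sub>E {-1, 1}. \<Prod>i=1..N. ?k i (s i))"
      unfolding hamming_cube_def using j by (intro sum.cong refl) (simp add: prod.distrib)
    also have "\<dots> = (\<Prod>i=1..N. \<Sum>x\<in>{-1, 1}. ?k i x)" by (subst prod_sum_PiE) auto
    also have "\<dots> = (\<Sum>x\<in>{-1, 1}. ?k j x) * (\<Prod>i\<in>{1..N} - {j}. \<Sum>x\<in>{-1, 1}. ?k i x)"
      using j by (intro prod.remove) auto
    also have "(\<Prod>i\<in>{1..N} - {j}. \<Sum>x\<in>{-1, 1}. ?k i x) = (\<Prod>i\<in>{1..N} - {j}. 1 - avoid (A i) S)"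
      by (intro prod.cong) auto
    \<comment> \<open>At \<open>x = 1\<close> the square of \<open>avoid (A j) S\<close> appears
      with a minus sign and idempotence reduces it; at \<open>x = -1\<close> the first factor is 1
      and the second is already \<open>- avoid (A j) S\<close>.\<close>
    also have "(\<Sum>x\<in>{-1, 1}. ?k j x) = - 2 * avoid (A j) S" by (simp add: avoid_def)
    finally show ?thesis by simp
  qed
  have "(\<Sum>s\<in>hamming_cube N. (\<Prod>i=1..N. ?h i (s i)) * (\<Sum>j=1..N. s j * avoid (A j) S))
      = (\<Sum>j=1..N. \<Sum>s\<in>hamming_cube N. (\<Prod>i=1..N. ?h i (s i)) * (s j * avoid (A j) S))"
    unfolding sum_distrib_left by (rule sum.swap)
  also have "\<dots> = (\<Sum>j=1..N. - 2 * (avoid (A j) S * (\<Prod>i\<in>{1..N} - {j}. 1 - avoid (A i) S)))"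
    using single by (intro sum.cong) auto
  finally have "(\<Sum>s\<in>hamming_cube N. - 1 / 2 * ((\<Prod>i=1..N. ?h i (s i)) * (\<Sum>j=1..N. s j * avoid (A j) S)))
      = - 1 / 2 * (- 2 * (\<Sum>j=1..N. avoid (A j) S * (\<Prod>i\<in>{1..N} - {j}. 1 - avoid (A i) S)))"
    by (simp only: sum_distrib_left[symmetric])
  then show ?thesis by simp
qed

text \<open>The triangle inequality alone gives \<open>type\<close> with \<open>T = 1\<close> and
  \<open>b = 1\<close>; what non-trivial type adds is \<open>b < 1\<close>.\<close>

locale typed_cube_multipliers = cube_multipliers p X for p and X :: "'a::banach itself" +
  fixes T b :: real
  assumes T: "1 \<le> T" and b: "0 < b" "b < 1"
    and type: "\<And>n m (y :: nat \<Rightarrow> (nat \<Rightarrow> real) \<Rightarrow> 'a) B. \<lbrakk>1 \<le> m; \<And>j. j \<in> {1..m} \<Longrightarrow> cube_norm p n (y j) \<le> B\<rbrakk> \<Longrightarrow>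
       cube_mean m (\<lambda>s. cube_norm p n (\<lambda>\<epsilon>. \<Sum>j=1..m. s j *\<^sub>R y j \<epsilon>) powr p) \<le> (T * real m powr b * B) powr p"
begin

text \<open>Estimated one by one, the \<open>N\<close> terms would cost
  \<open>N * 2 ^ (N - 1)\<close>; type turns \<open>N\<close> into \<open>T * real N powr b\<close>.
  In \<open>sum_avoid_hybrid\<close> the \<open>2 ^ N\<close> sign patterns of weight
  \<open>1 / 2\<close> amount to \<open>2 ^ (N - 1)\<close> times a mean over signs,
  \<open>W s\<close> is a contraction, and Jensen with \<open>type\<close> bounds the mean norm of
  the Rademacher sum.\<close>

lemma bounded_mult_hybrid:
  assumes N: "1 \<le> N"
  shows "bounded_mult n (\<lambda>S. \<Sum>j=1..N. avoid (A j) S * (\<Prod>i\<in>{1..N} - {j}. 1 - avoid (A i) S))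
    (2 ^ (N - 1) * (T * real N powr b))"
  unfolding bounded_mult_def
proof
  fix f :: "(nat \<Rightarrow> real) \<Rightarrow> 'a"
  define W where "W s S = (\<Prod>i=1..N. if s i = (1::real) then - avoid (A i) S else 1)" for s :: "nat \<Rightarrow> real" and S
  define V where "V s S = (\<Sum>j=1..N. s j * avoid (A j) S)" for s :: "nat \<Rightarrow> real" and S
  define B where "B = cube_norm p n f"
  have W: "bounded_mult n (W s) 1" for s
    using bounded_mult_cmult[OF bounded_mult_avoid, of n "(-1) ^ card {i \<in> {1..N}. s i = 1}" "\<Union>i\<in>{i \<in> {1..N}. s i = 1}. A i"]
    unfolding W_def by (subst prod_if_sign_avoid) (simp_all add: power_abs)
  have "cube_mean N (\<lambda>s. cube_norm p n (walsh_mult n (V s) f)) powr p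
      \<le> cube_mean N (\<lambda>s. cube_norm p n (walsh_mult n (V s) f) powr p)"
    using p by (intro cube_mean_powr_le) auto
  also have "\<dots> = cube_mean N (\<lambda>s. cube_norm p n (\<lambda>\<epsilon>. \<Sum>j=1..N. s j *\<^sub>R walsh_mult n (avoid (A j)) f \<epsilon>) powr p)"
    unfolding V_def by (simp add: walsh_mult_sum[abs_def])
  also have "\<dots> \<le> (T * real N powr b * B) powr p"
    using bounded_mult_avoid N by (intro type) (auto simp: bounded_mult_def B_def)
  finally have mean: "cube_mean N (\<lambda>s. cube_norm p n (walsh_mult n (V s) f)) \<le> T * real N powr b * B"
    using p T powr_less_mono2[of p "T * real N powr b * B"
        "cube_mean N (\<lambda>s. cube_norm p n (walsh_mult n (V s) f))"]
    by (force simp: B_def intro: ccontr)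
  have "cube_norm p n (walsh_mult n (\<lambda>S. \<Sum>s\<in>hamming_cube N. - 1 / 2 * (W s S * V s S)) f)
      \<le> (\<Sum>s\<in>hamming_cube N. \<bar>- 1 / 2\<bar> * cube_norm p n (walsh_mult n (\<lambda>S. W s S * V s S) f))"
    by (rule seminorm_on_sum[OF _ seminorm_on_walsh_mult]) auto
  also have "\<dots> \<le> (\<Sum>s\<in>hamming_cube N. 1 / 2 * cube_norm p n (walsh_mult n (V s) f))"
  proof (rule sum_mono)
    fix s
    have "cube_norm p n (walsh_mult n (W s) (walsh_mult n (V s) f)) \<le> 1 * cube_norm p n (walsh_mult n (V s) f)"
      using W[of s] unfolding bounded_mult_def by blast
    then show "\<bar>- 1 / 2\<bar> * cube_norm p n (walsh_mult n (\<lambda>S. W s S * V s S) f)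
        \<le> 1 / 2 * cube_norm p n (walsh_mult n (V s) f)"
      by (simp add: walsh_mult_walsh_mult)
  qed
  also have "\<dots> = 2 ^ (N - 1) * cube_mean N (\<lambda>s. cube_norm p n (walsh_mult n (V s) f))"
  proof -
    have "(2::real) ^ (N - 1) * (1 / 2 ^ N) = 1 / 2" using N by (simp add: power_diff)
    then show ?thesis by (simp only: cube_mean_def real_scaleR_def mult.assoc[symmetric] sum_distrib_left[symmetric])
  qed
  also have "\<dots> \<le> 2 ^ (N - 1) * (T * real N powr b * B)" using mean by (intro mult_left_mono) auto
  finally show "cube_norm p n (walsh_mult n (\<lambda>S. \<Sum>j=1..N. avoid (A j) S * (\<Prod>i\<in>{1..N} - {j}. 1 - avoid (A i) S)) f)
      \<le> 2 ^ (N - 1) * (T * real N powr b) * cube_norm p n f"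
    unfolding sum_avoid_hybrid W_def V_def B_def by (simp add: mult.assoc)
qed

text \<open>With \<open>?P j\<close> the product without factor \<open>j\<close>, the full product
  is \<open>?P j\<close> minus its multiple by \<open>avoid (A j)\<close>, for every
  \<open>j\<close>. Averaged over \<open>j\<close>, the first part costs \<open>2 ^ (N - 1)\<close>
  and the hybrid sum at most half of that, together \<open>3 / 2 * 2 ^ (N - 1)\<close>.\<close>

lemma bounded_mult_prod_avoid:
  assumes N: "1 \<le> N" "T * real N powr (b - 1) \<le> 1 / 2"
  shows "bounded_mult n (\<lambda>S. \<Prod>i=1..N. 1 - avoid (A i) S) (3 / 4 * 2 ^ N)"
proof -
  let ?P = "\<lambda>j S. \<Prod>i\<in>{1..N} - {j}. 1 - avoid (A i) S"
  have factor: "bounded_mult n (\<lambda>S. 1 - avoid (A i) S) 2" for i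
    using bounded_mult_diff[OF bounded_mult_one bounded_mult_avoid] by simp
  have "bounded_mult n (?P j) (2 ^ (N - 1))" if "j \<in> {1..N}" for j
    using bounded_mult_prod[of "{1..N} - {j}" n "\<lambda>i S. 1 - avoid (A i) S" "\<lambda>_. 2"] factor that by simp
  then have "bounded_mult n (\<lambda>S. \<Sum>j=1..N. 1 * ?P j S) (\<Sum>j=1..N. \<bar>1\<bar> * 2 ^ (N - 1))"
    by (intro bounded_mult_sum) auto
  from bounded_mult_cmult[OF bounded_mult_diff[OF this bounded_mult_hybrid[OF N(1), of n A]], of "1 / N"]
  have "bounded_mult n (\<lambda>S. 1 / N * ((\<Sum>j=1..N. 1 * ?P j S) - (\<Sum>j=1..N. avoid (A j) S * ?P j S)))
      (\<bar>1 / real N\<bar> * ((\<Sum>j=1..N. \<bar>1\<bar> * 2 ^ (N - 1)) + 2 ^ (N - 1) * (T * real N powr b)))" .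
  moreover have "1 / N * ((\<Sum>j=1..N. 1 * ?P j S) - (\<Sum>j=1..N. avoid (A j) S * ?P j S)) = (\<Prod>i=1..N. 1 - avoid (A i) S)" for S
  proof -
    have "(\<Sum>j=1..N. 1 * ?P j S) - (\<Sum>j=1..N. avoid (A j) S * ?P j S)
        = (\<Sum>j=1..N. (1 - avoid (A j) S) * ?P j S)"
      by (simp add: left_diff_distrib sum_subtractf)
    also have "\<dots> = (\<Sum>j=1..N. \<Prod>i=1..N. 1 - avoid (A i) S)"
      by (intro sum.cong refl prod.remove[symmetric]) auto
    finally show ?thesis using N(1) by simp
  qed
  moreover have "\<bar>1 / real N\<bar> * ((\<Sum>j=1..N. \<bar>1\<bar> * 2 ^ (N - 1)) + 2 ^ (N - 1) * (T * real N powr b)) \<le> 3 / 4 * 2 ^ N"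
  proof -
    have "\<bar>1 / real N\<bar> * ((\<Sum>j=1..N. \<bar>1\<bar> * 2 ^ (N - 1)) + 2 ^ (N - 1) * (T * real N powr b))
        = 2 ^ (N - 1) * (1 + T * (real N powr b / N))"
      using N(1) by (simp add: field_simps)
    also have "real N powr b / N = real N powr (b - 1)" using N(1) by (simp add: powr_diff)
    also have "2 ^ (N - 1) * (1 + T * real N powr (b - 1)) \<le> 2 ^ (N - 1) * (1 + 1 / 2)"
      using N(2) by (intro mult_left_mono) auto
    also have "\<dots> = 3 / 4 * 2 ^ N" using N(1) by (simp add: power_diff)
    finally show ?thesis .
  qed
  ultimately show ?thesis by (simp only: bounded_mult_mono)
qed

lemma bounded_mult_one_minus_noise_power:
  assumes N: "1 \<le> N" "T * real N powr (b - 1) \<le> 1 / 2" and A: "finite A" and a: "0 \<le> a" "a \<le> 1"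
  shows "bounded_mult n (\<lambda>S. (1 - a ^ card (S \<inter> A)) ^ N) (3 / 4 * 2 ^ N)"
proof -
  \<comment> \<open>The first \<open>k\<close> factors have already become noise. \<open>D\<close>
    stays arbitrary because averaging the next factor over random sets uses the bound for every
    choice of its set.\<close>
  have "bounded_mult n (\<lambda>S. (1 - a ^ card (S \<inter> A)) ^ k * (\<Prod>i\<in>{k<..N}. 1 - avoid (D i) S)) (3 / 4 * 2 ^ N)"
    if "k \<le> N" for k D
    using that
  proof (induction k arbitrary: D)
    case 0
    then show ?case
      using bounded_mult_prod_avoid[OF N, of n D] by (simp add: atLeastSucAtMost_greaterThanAtMost)
  next
    case (Suc k)
    have "bounded_mult n (\<lambda>S. ((1 - a ^ card (S \<inter> A)) ^ k * (\<Prod>i\<in>{Suc k<..N}. 1 - avoid (D i) S))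
        * (1 - avoid E S)) (3 / 4 * 2 ^ N)" for E
    proof -
      have "{k<..N} = insert (Suc k) {Suc k<..N}" using Suc.prems by auto
      then have "(\<Prod>i\<in>{k<..N}. 1 - avoid ((D(Suc k := E)) i) S)
          = (1 - avoid E S) * (\<Prod>i\<in>{Suc k<..N}. 1 - avoid (D i) S)" for S
        by (simp add: prod.insert)
      then show ?thesis using Suc.IH[of "D(Suc k := E)"] Suc.prems by (simp add: mult_ac)
    qed
    from bounded_mult_power_card[OF A a this] show ?case by (simp add: mult_ac)
  qed
  from this[of N] show ?thesis by simp
qed

text \<open>With \<open>u\<close> as below, \<open>1 / (1 - u)\<close> is the sum of
  \<open>u ^ i\<close> over \<open>i < N\<close> times \<open>1 / (1 - u ^ N)\<close>. The sum costs
  \<open>N\<close> since \<open>u\<close> has bound 1, and the geometric series in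
  \<open>u ^ N\<close>, with ratio \<open>3 / 4\<close>, costs 4.\<close>

lemma bounded_mult_inverse_one_plus_noise:
  obtains M where "1 \<le> M"
    "\<And>n A a. \<lbrakk>finite A; 0 \<le> a; a \<le> 1\<rbrakk> \<Longrightarrow> bounded_mult n (\<lambda>S. 1 / (1 + a ^ card (S \<inter> A))) M"
proof -
  have "(\<lambda>N. T * real N powr (b - 1)) \<longlonglongrightarrow> T * 0"
    using b by (intro tendsto_mult_left tendsto_neg_powr filterlim_real_sequentially) auto
  then have "\<forall>\<^sub>F N in sequentially. T * real N powr (b - 1) < 1 / 2"
    by (rule order_tendstoD(2)) simp
  then obtain N where N: "1 \<le> N" "T * real N powr (b - 1) \<le> 1 / 2"
    using eventually_happens[OF eventually_conj[OF _ eventually_ge_at_top[of 1]]] less_imp_le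
    by (metis trivial_limit_sequentially)
  have "bounded_mult n (\<lambda>S. 1 / (1 + a ^ card (S \<inter> A))) (2 * real N)" if A: "finite A" and a: "0 \<le> a" "a \<le> 1" for n A a
  proof -
    define u where "u S = 1 / 2 * (1 - a ^ card (S \<inter> A))" for S
    have u01: "0 \<le> u S" "u S \<le> 1 / 2" for S
      using a power_le_one[of a "card (S \<inter> A)"] by (auto simp: u_def)
    have u: "bounded_mult n u 1"
      using bounded_mult_cmult[OF bounded_mult_diff[OF bounded_mult_one bounded_mult_noise[OF A a]], of n "1 / 2"]
      by (simp add: u_def[abs_def])
    have "bounded_mult n (\<lambda>S. u S ^ N) (3 / 4)"
      using bounded_mult_cmult[OF bounded_mult_one_minus_noise_power[OF N A a], of n "(1 / 2) ^ N"]
      by (simp add: u_def[abs_def] power_mult_distrib power_divide)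
    then have "bounded_mult n (\<lambda>S. \<Sum>i<k. 1 * (u S ^ N) ^ i) (\<Sum>i<k. \<bar>1\<bar> * (3 / 4) ^ i)" for k
      by (intro bounded_mult_sum bounded_mult_power) auto
    then have inv: "bounded_mult n (\<lambda>S. 1 / (1 - u S ^ N)) 4"
    proof (rule bounded_mult_tendsto)
      have "\<bar>u S ^ N\<bar> < 1" for S
        using power_mono[OF u01(2) u01(1), of S N] power_le_one[of "1/2::real" "N - 1"] N(1) u01(1)[of S]
        by (cases N) auto
      then show "(\<lambda>k. \<Sum>i<k. 1 * (u S ^ N) ^ i) \<longlonglongrightarrow> 1 / (1 - u S ^ N)" for S
        using geometric_sums[of "u S ^ N"] by (simp add: sums_def)
      show "(\<lambda>k. \<Sum>i<k. \<bar>1\<bar> * (3 / 4) ^ i) \<longlonglongrightarrow> (4::real)"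
        using geometric_sums[of "3 / 4 :: real"] by (simp add: sums_def)
    qed
    have "bounded_mult n (\<lambda>S. \<Sum>i<N. 1 * u S ^ i) (\<Sum>i<N. \<bar>1\<bar> * 1 ^ i)"
      by (intro bounded_mult_sum bounded_mult_power u) auto
    from bounded_mult_cmult[OF bounded_mult_mult[OF this inv], of "1 / 2"]
    have "bounded_mult n (\<lambda>S. 1 / 2 * ((\<Sum>i<N. u S ^ i) * (1 / (1 - u S ^ N)))) (2 * real N)" by simp
    moreover have "1 / 2 * ((\<Sum>i<N. u S ^ i) * (1 / (1 - u S ^ N))) = 1 / (1 + a ^ card (S \<inter> A))" for S
    proof -
      have "u S ^ N \<noteq> 1" using u01[of S] N(1) power_strict_mono[of "u S" 1 N] by auto
      moreover have "u S \<noteq> 1" using u01[of S] by auto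
      ultimately have "(\<Sum>i<N. u S ^ i) * (1 / (1 - u S ^ N)) = 1 / (1 - u S)"
        by (simp add: sum_gp_strict)
      moreover have "2 * (1 - u S) = 1 + a ^ card (S \<inter> A)" by (simp add: u_def field_simps)
      ultimately show ?thesis by (metis divide_divide_eq_left times_divide_times_eq mult_1)
    qed
    ultimately show ?thesis by simp
  qed
  then show ?thesis using N(1) by (intro that[of "2 * real N"]) auto
qed

end

section \<open>A cosine integral\<close>

lemma norm_exp_i_over_sum_squares_le:
  fixes x r :: real and z :: complex
  assumes "0 < x" "x < r" "0 \<le> Im z" "r \<le> norm z"
  shows "norm (exp (\<i> * z) / (z\<^sup>2 + (of_real x)\<^sup>2)) \<le> 1 / (r\<^sup>2 - x\<^sup>2)"
proof -
  have "r\<^sup>2 - x\<^sup>2 \<le> (norm z)\<^sup>2 - x\<^sup>2" using assms by (simp add: power_mono)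
  also have "\<dots> = norm (z\<^sup>2) - norm (- (of_real x)\<^sup>2 :: complex)" by (simp add: norm_power)
  also have "\<dots> \<le> norm (z\<^sup>2 - (- (of_real x)\<^sup>2))" by (rule norm_triangle_ineq2)
  finally have "r\<^sup>2 - x\<^sup>2 \<le> norm (z\<^sup>2 + (of_real x)\<^sup>2)" by simp
  moreover have "0 < r\<^sup>2 - x\<^sup>2" using assms by (simp add: power_strict_mono)
  moreover have "norm (exp (\<i> * z)) \<le> 1" using assms by simp
  ultimately show ?thesis unfolding norm_divide by (intro frac_le) auto
qed

text \<open>Cauchy's formula at the pole \<open>\<i> x\<close> of
  \<open>exp (\<i> z) / (z^2 + x^2)\<close>, on the rectangle of height \<open>r\<close> over
  [-r, r]. The other three sides have total length \<open>4 * r\<close>, and the integrand there is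
  at most \<open>1 / (r^2 - x^2)\<close>.\<close>

lemma cos_over_sum_squares_integral_bound:
  fixes x r :: real
  assumes x: "0 < x" and r: "x < r"
  shows "\<bar>integral {-r..r} (\<lambda>l. cos l / (l\<^sup>2 + x\<^sup>2)) - pi * exp (- x) / x\<bar> \<le> 4 * r / (r\<^sup>2 - x\<^sup>2)"
proof -
  define h where "h z = exp (\<i> * z) / (z\<^sup>2 + (of_real x)\<^sup>2)" for z :: complex
  \<comment> \<open>Contains the rectangle but not the second pole \<open>- \<i> x\<close>, so one
    factor of the denominator can be kept in the holomorphic part.\<close>
  define H where "H = {z. - x < Im z}"
  define a1 a2 a3 a4 where "a1 = Complex (- r) 0" and "a2 = Complex r 0" and "a3 = Complex r r"
    and "a4 = Complex (- r) r"
  define B where "B = 1 / (r\<^sup>2 - x\<^sup>2)"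
  have B: "0 \<le> B" using x r by (simp add: B_def power_mono)
  have rect: "rectpath a1 a3 = linepath a1 a2 +++ linepath a2 a3 +++ linepath a3 a4 +++ linepath a4 a1"
    by (simp add: rectpath_def Let_def a1_def a2_def a3_def a4_def)
  have conv: "convex H" unfolding H_def by (rule convex_halfspace_Im_gt)
  have op: "open H" unfolding H_def by (rule open_halfspace_Im_gt)
  have inH: "\<i> * of_real x \<in> interior H"
    unfolding interior_open[OF op] using x by (simp add: H_def)
  have img: "path_image (rectpath a1 a3) \<subseteq> H - {\<i> * of_real x}"
    using x r by (subst path_image_rectpath) (auto simp: H_def a1_def a3_def)
  have hol: "(\<lambda>z. exp (\<i> * z) / (z + \<i> * of_real x)) holomorphic_on H"
    using x by (intro holomorphic_intros) (auto simp: H_def complex_eq_iff)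
  have "((\<lambda>z. exp (\<i> * z) / (z + \<i> * of_real x) / (z - \<i> * of_real x)) has_contour_integral
      2 * pi * \<i> * winding_number (rectpath a1 a3) (\<i> * of_real x) *
        (exp (\<i> * (\<i> * of_real x)) / (\<i> * of_real x + \<i> * of_real x))) (rectpath a1 a3)"
    using x by (intro Cauchy_integral_formula_convex_simple[OF conv hol _ _ img])
      (use inH in auto)
  moreover have "winding_number (rectpath a1 a3) (\<i> * of_real x) = 1"
    using x r by (intro winding_number_rectpath) (auto simp: in_box_complex_iff a1_def a3_def)
  moreover have "2 * pi * \<i> * 1 * (exp (\<i> * (\<i> * of_real x)) / (\<i> * of_real x + \<i> * of_real x))
      = complex_of_real (pi * exp (- x) / x)"
  proof -
    have "\<i> * (\<i> * of_real x) = complex_of_real (- x)" by (simp flip: mult.assoc)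
    then have "exp (\<i> * (\<i> * of_real x)) = complex_of_real (exp (- x))" by (simp only: exp_of_real)
    moreover have "\<i> * of_real x + \<i> * of_real x = \<i> * complex_of_real (2 * x)" by simp
    ultimately show ?thesis using x by simp
  qed
  moreover have "exp (\<i> * z) / (z + \<i> * of_real x) / (z - \<i> * of_real x) = h z" for z
  proof -
    have "(z + \<i> * of_real x) * (z - \<i> * of_real x) = z\<^sup>2 + (of_real x)\<^sup>2"
      by (simp add: algebra_simps power2_eq_square)
    then show ?thesis by (simp add: h_def)
  qed
  ultimately have whole: "(h has_contour_integral complex_of_real (pi * exp (- x) / x)) (rectpath a1 a3)"
    by (simp flip: exp_of_real)
  have hc: "h contour_integrable_on linepath a b"
    if "closed_segment a b \<subseteq> path_image (rectpath a1 a3)" for a b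
  proof -
    have "z\<^sup>2 + (of_real x)\<^sup>2 \<noteq> 0" if "z \<in> H - {\<i> * of_real x}" for z :: complex
    proof -
      have "z\<^sup>2 + (of_real x)\<^sup>2 = (z + \<i> * of_real x) * (z - \<i> * of_real x)"
        by (simp add: algebra_simps power2_eq_square)
      moreover have "z + \<i> * of_real x \<noteq> 0" using that by (auto simp: H_def complex_eq_iff)
      ultimately show ?thesis using that by auto
    qed
    then have "continuous_on (closed_segment a b) h"
      unfolding h_def using img \<open>closed_segment a b \<subseteq> path_image (rectpath a1 a3)\<close>
      by (intro continuous_intros) blast
    then show ?thesis by (rule contour_integrable_continuous_linepath)
  qed
  have sub: "closed_segment a1 a2 \<subseteq> path_image (rectpath a1 a3)" "closed_segment a2 a3 \<subseteq> path_image (rectpath a1 a3)"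
    "closed_segment a3 a4 \<subseteq> path_image (rectpath a1 a3)" "closed_segment a4 a1 \<subseteq> path_image (rectpath a1 a3)"
    unfolding rect by (auto simp: path_image_join)
  note ints = sub[THEN hc]
  define I1 I2 I3 I4 where "I1 = contour_integral (linepath a1 a2) h" and "I2 = contour_integral (linepath a2 a3) h"
    and "I3 = contour_integral (linepath a3 a4) h" and "I4 = contour_integral (linepath a4 a1) h"
  have has: "(h has_contour_integral I1) (linepath a1 a2)" "(h has_contour_integral I2) (linepath a2 a3)"
    "(h has_contour_integral I3) (linepath a3 a4)" "(h has_contour_integral I4) (linepath a4 a1)"
    unfolding I1_def I2_def I3_def I4_def by (intro has_contour_integral_integral ints)+
  have "(h has_contour_integral (I1 + (I2 + (I3 + I4)))) (rectpath a1 a3)"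
    unfolding rect by (intro has_contour_integral_join has) auto
  then have sum: "I1 + (I2 + (I3 + I4)) = of_real (pi * exp (- x) / x)"
    using whole contour_integral_unique by metis
  have far: "norm (h z) \<le> B" if "0 \<le> Im z" "\<bar>Re z\<bar> = r \<or> Im z = r" for z
    unfolding h_def B_def
    using that x r abs_Re_le_cmod[of z] abs_Im_le_cmod[of z] by (intro norm_exp_i_over_sum_squares_le) auto
  have "norm I2 \<le> B * norm (a3 - a2)"
  proof (rule has_contour_integral_bound_linepath[OF has(2) B])
    fix z assume "z \<in> closed_segment a2 a3"
    then show "norm (h z) \<le> B" using x r
      by (intro far) (auto simp: closed_segment_same_Re a2_def a3_def closed_segment_eq_real_ivl split: if_splits)
  qed
  moreover have "norm I3 \<le> B * norm (a4 - a3)"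
  proof (rule has_contour_integral_bound_linepath[OF has(3) B])
    fix z assume "z \<in> closed_segment a3 a4"
    then show "norm (h z) \<le> B" using x r
      by (intro far) (auto simp: closed_segment_same_Im a3_def a4_def)
  qed
  moreover have "norm I4 \<le> B * norm (a1 - a4)"
  proof (rule has_contour_integral_bound_linepath[OF has(4) B])
    fix z assume "z \<in> closed_segment a4 a1"
    then show "norm (h z) \<le> B" using x r
      by (intro far) (auto simp: closed_segment_same_Re a4_def a1_def closed_segment_eq_real_ivl split: if_splits)
  qed
  moreover have "norm (a3 - a2) = r" "norm (a4 - a3) = 2 * r" "norm (a1 - a4) = r"
    using x r by (simp_all add: a1_def a2_def a3_def a4_def cmod_def real_sqrt_mult)
  ultimately have "norm (I2 + (I3 + I4)) \<le> B * r + (B * (2 * r) + B * r)"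
    by (metis norm_triangle_mono)
  then have "norm (I1 - of_real (pi * exp (- x) / x)) \<le> 4 * r / (r\<^sup>2 - x\<^sup>2)"
  proof -
    assume le: "norm (I2 + (I3 + I4)) \<le> B * r + (B * (2 * r) + B * r)"
    have "I1 - of_real (pi * exp (- x) / x) = - (I2 + (I3 + I4))" unfolding sum[symmetric] by simp
    moreover have "B * r + (B * (2 * r) + B * r) = 4 * r / (r\<^sup>2 - x\<^sup>2)" by (simp add: B_def)
    ultimately show ?thesis using le by (simp only: norm_minus_cancel)
  qed
  moreover have "Re I1 = integral {-r..r} (\<lambda>l. cos l / (l\<^sup>2 + x\<^sup>2))"
  proof -
    have "((\<lambda>l. h (of_real l)) has_integral I1) {-r..r}"
      using has(1) x r by (subst (asm) has_contour_integral_linepath_Reals_iff)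
        (auto simp: a1_def a2_def complex_is_Real_iff)
    then have "((\<lambda>l. Re (h (of_real l))) has_integral Re I1) {-r..r}"
      by (rule has_integral_Re)
    moreover have "Re (h (of_real l)) = cos l / (l\<^sup>2 + x\<^sup>2)" for l
    proof -
      have "h (of_real l) = cis l / of_real (l\<^sup>2 + x\<^sup>2)" by (simp add: h_def cis_conv_exp)
      then show ?thesis by (simp only: Re_divide_of_real cis.sel)
    qed
    ultimately show ?thesis by (simp add: integral_unique)
  qed
  ultimately show ?thesis
    using abs_Re_le_cmod[of "I1 - of_real (pi * exp (- x) / x)"] by simp
qed

text \<open>Recovers \<open>x * exp (- x)\<close> from values on the imaginary axis. Written this
  way, the kernel is 1 minus \<open>l\<close> times the imaginary part
  \<open>l / (l^2 + x^2)\<close> of the resolvent, so an \<open>M / l\<close> bound for that part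
  bounds the kernel by \<open>1 + M\<close>. Such a bound is not integrable at infinity.\<close>

lemma cos_poisson_tendsto:
  fixes x :: real
  assumes x: "0 < x"
  shows "(\<lambda>R. integral {0..real R} (\<lambda>l. cos l * (1 - l\<^sup>2 / (l\<^sup>2 + x\<^sup>2)))) \<longlonglongrightarrow> pi / 2 * (x * exp (- x))"
proof -
  let ?g = "\<lambda>l. cos l / (l\<^sup>2 + x\<^sup>2)"
  have "(\<lambda>R. 4 * real R / ((real R)\<^sup>2 - x\<^sup>2)) \<longlonglongrightarrow> 0" by real_asymp
  moreover have "\<forall>\<^sub>F R in sequentially. norm (integral {-real R..real R} ?g - pi * exp (- x) / x)
      \<le> 4 * real R / ((real R)\<^sup>2 - x\<^sup>2)"
  proof -
    have "\<forall>\<^sub>F R in sequentially. x < real R"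
      using filterlim_real_sequentially filterlim_at_top_dense by blast
    then show ?thesis
      by eventually_elim (use cos_over_sum_squares_integral_bound[OF x] in auto)
  qed
  ultimately have lim: "(\<lambda>R. integral {-real R..real R} ?g) \<longlonglongrightarrow> pi * exp (- x) / x"
    by (rule LIM_zero_cancel[OF Lim_null_comparison, rotated])
  have eq: "integral {0..real R} (\<lambda>l. cos l * (1 - l\<^sup>2 / (l\<^sup>2 + x\<^sup>2))) = x\<^sup>2 / 2 * integral {-real R..real R} ?g" for R
  proof -
    have int: "?g integrable_on {c..d}" for c d
      using x by (intro integrable_continuous_interval continuous_intros) (auto simp: add_nonneg_eq_0_iff)
    have "integral {-real R..real R} ?g = integral {-real R..0} ?g + integral {0..real R} ?g"
      by (intro Henstock_Kurzweil_Integration.integral_combine[symmetric] int) auto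
    also have "integral {-real R..0} ?g = integral {0..real R} ?g"
      using Henstock_Kurzweil_Integration.integral_reflect_real[of "real R" 0 "\<lambda>l. ?g l"] by simp
    finally have "x\<^sup>2 / 2 * integral {-real R..real R} ?g = x\<^sup>2 * integral {0..real R} ?g" by simp
    also have "\<dots> = integral {0..real R} (\<lambda>l. x\<^sup>2 * ?g l)"
      by (rule Henstock_Kurzweil_Integration.integral_mult_right[symmetric])
    also have "(\<lambda>l. x\<^sup>2 * ?g l) = (\<lambda>l. cos l * (1 - l\<^sup>2 / (l\<^sup>2 + x\<^sup>2)))"
    proof
      fix l
      have "l\<^sup>2 + x\<^sup>2 \<noteq> 0" using x by (simp add: add_nonneg_eq_0_iff)
      then show "x\<^sup>2 * ?g l = cos l * (1 - l\<^sup>2 / (l\<^sup>2 + x\<^sup>2))" by (simp add: field_simps)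
    qed
    finally show ?thesis by simp
  qed
  have "(\<lambda>R. x\<^sup>2 / 2 * integral {-real R..real R} ?g) \<longlonglongrightarrow> x\<^sup>2 / 2 * (pi * exp (- x) / x)"
    by (intro tendsto_mult_left lim)
  moreover have "x\<^sup>2 / 2 * (pi * exp (- x) / x) = pi / 2 * (x * exp (- x))"
    using x by (simp add: power2_eq_square)
  ultimately show ?thesis by (simp only: eq)
qed

text \<open>
  Two integrations by parts on \<open>[1, \<infinity>)\<close> gain the decay \<open>l\<^sup>-\<^sup>2\<close> of the second derivative of the
  kernel \<open>1 - l\<^sup>2 / (l\<^sup>2 + x\<^sup>2)\<close>.
\<close>

lemma cos_poisson_by_parts_tendsto:
  fixes x :: real
  assumes x: "0 \<le> x"
  defines "G \<equiv> \<lambda>l. 1 - l\<^sup>2 / (l\<^sup>2 + x\<^sup>2)"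
  defines "G' \<equiv> \<lambda>l. - 2 * l * (x / (l\<^sup>2 + x\<^sup>2))\<^sup>2"
  defines "G'' \<equiv> \<lambda>l. (x / (l\<^sup>2 + x\<^sup>2))\<^sup>2 * (8 * l * (l / (l\<^sup>2 + x\<^sup>2)) - 2)"
  shows "(\<lambda>R. integral {0..1} (\<lambda>l. cos l * G l) - sin 1 * G 1 - cos 1 * G' 1
      - integral {1..real (Suc R)} (\<lambda>l. cos l * G'' l)) \<longlonglongrightarrow> pi / 2 * (x * exp (- x))"
proof (cases "x = 0")
  case True
  \<comment> \<open>For \<open>x = 0\<close> the kernel vanishes except at \<open>l = 0\<close>,
    where \<open>0 / 0 = 0\<close> gives it the value 1.\<close>
  have "((\<lambda>l. cos l * G l) has_integral 0) {0..1}"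
    by (rule has_integral_spike_finite[of "{0}" _ _ "\<lambda>_. 0"]) (auto simp: G_def True)
  then show ?thesis using True by (simp add: integral_unique G_def G'_def G''_def)
next
  case False
  then have x: "0 < x" using x by simp
  have nz: "l\<^sup>2 + x\<^sup>2 \<noteq> 0" for l using x by (simp add: add_nonneg_eq_0_iff)
  have dG: "(G has_real_derivative G' l) (at l within A)" for l A
    unfolding G_def using nz[of l]
    by (auto intro!: derivative_eq_intros simp: G'_def power2_eq_square field_simps)
  have dG': "(G' has_real_derivative G'' l) (at l within A)" for l A
    
  proof -
    have "8 * (x * (l * (x * l))) / (D * D * D) - 2 * (x / D)\<^sup>2 = (x / D)\<^sup>2 * (8 * l * l / D - 2)" for D
      by (cases "D = 0") (auto simp: field_simps power2_eq_square)
    then show ?thesis unfolding G'_def using nz[of l] by (auto intro!: derivative_eq_intros simp: G''_def)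
  qed
  have int: "(\<lambda>l. cos l * G l) integrable_on {c..d}" "(\<lambda>l. cos l * G'' l) integrable_on {c..d}" for c d
    unfolding G_def G''_def using nz by (intro integrable_continuous_interval continuous_intros; simp)+
  have eq: "integral {0..real (Suc R)} (\<lambda>l. cos l * G l) - (sin (real (Suc R)) * G (real (Suc R)) + cos (real (Suc R)) * G' (real (Suc R)))
      = integral {0..1} (\<lambda>l. cos l * G l) - sin 1 * G 1 - cos 1 * G' 1
        - integral {1..real (Suc R)} (\<lambda>l. cos l * G'' l)" for R
  proof -
    let ?R = "real (Suc R)"
    \<comment> \<open>The derivative of \<open>sin l * G l + cos l * G' l\<close> is
      \<open>cos l * (G l + G'' l)\<close>, which does both integrations by parts at once. With
      \<open>Suc R\<close> the upper end is at least 1.\<close>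
    have "((\<lambda>l. cos l * G l + cos l * G'' l) has_integral (sin ?R * G ?R + cos ?R * G' ?R) - (sin 1 * G 1 + cos 1 * G' 1)) {1..?R}"
      by (rule fundamental_theorem_of_calculus)
        (auto intro!: derivative_eq_intros dG dG' simp flip: has_real_derivative_iff_has_vector_derivative)
    then have "integral {1..?R} (\<lambda>l. cos l * G l) + integral {1..?R} (\<lambda>l. cos l * G'' l)
        = (sin ?R * G ?R + cos ?R * G' ?R) - (sin 1 * G 1 + cos 1 * G' 1)"
      unfolding Henstock_Kurzweil_Integration.integral_add[OF int(1) int(2), symmetric]
      by (rule integral_unique)
    moreover have "integral {0..?R} (\<lambda>l. cos l * G l) = integral {0..1} (\<lambda>l. cos l * G l) + integral {1..?R} (\<lambda>l. cos l * G l)"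
      by (intro Henstock_Kurzweil_Integration.integral_combine[symmetric] int) auto
    ultimately show ?thesis by simp
  qed
  have "(\<lambda>R. G (real (Suc R))) \<longlonglongrightarrow> 0" "(\<lambda>R. G' (real (Suc R))) \<longlonglongrightarrow> 0"
    unfolding G_def G'_def using x by real_asymp+
  note G0 = this
  have "(\<lambda>R. sin (real (Suc R)) * G (real (Suc R))) \<longlonglongrightarrow> 0"
    by (rule Lim_null_comparison[OF _ tendsto_rabs_zero[OF G0(1)]])
      (simp add: abs_mult mult_left_le_one_le del: of_nat_Suc)
  moreover have "(\<lambda>R. cos (real (Suc R)) * G' (real (Suc R))) \<longlonglongrightarrow> 0"
    by (rule Lim_null_comparison[OF _ tendsto_rabs_zero[OF G0(2)]])
      (simp add: abs_mult mult_left_le_one_le del: of_nat_Suc)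
  ultimately have "(\<lambda>R. integral {0..real (Suc R)} (\<lambda>l. cos l * G l) - (sin (real (Suc R)) * G (real (Suc R)) + cos (real (Suc R)) * G' (real (Suc R))))
      \<longlonglongrightarrow> pi / 2 * (x * exp (- x)) - (0 + 0)"
    using LIMSEQ_Suc[OF cos_poisson_tendsto[OF x]] unfolding G_def by (intro tendsto_intros)
  then show ?thesis unfolding eq by simp
qed

section \<open>Resolvents and the derivative of the heat semigroup\<close>

text \<open>Real and imaginary parts of the truncated Laplace integral. At the upper end
  \<open>l * s = pi\<close>, where the sine vanishes and the cosine is -1; this produces the plus
  sign in the last factor.\<close>

lemma
  fixes l x :: real
  assumes l: "0 < l"
  shows has_integral_cos_exp: "((\<lambda>s. cos (l * s) * exp (- s * x)) has_integral
      x / (l\<^sup>2 + x\<^sup>2) * (1 + exp (- (pi / l) * x))) {0..pi / l}" (is ?C)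
    and has_integral_sin_exp: "((\<lambda>s. sin (l * s) * exp (- s * x)) has_integral
      l / (l\<^sup>2 + x\<^sup>2) * (1 + exp (- (pi / l) * x))) {0..pi / l}" (is ?S)
proof -
  define D where "D = l\<^sup>2 + x\<^sup>2"
  have D: "D \<noteq> 0" using l by (simp add: D_def add_nonneg_eq_0_iff)
  have ftc: "(f has_integral (F (pi / l) - F 0) / D) {0..pi / l}"
    if "\<And>s. (F has_real_derivative D * f s) (at s within {0..pi / l})" for f F
  proof -
    have "((\<lambda>s. D * f s) has_integral F (pi / l) - F 0) {0..pi / l}"
      using that l by (intro fundamental_theorem_of_calculus)
        (auto simp flip: has_real_derivative_iff_has_vector_derivative)
    from has_integral_mult_right[OF this, of "1 / D"] show ?thesis using D by simp
  qed
  have "((\<lambda>s. exp (- s * x) * (l * sin (l * s) - x * cos (l * s))) has_real_derivative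
      D * (cos (l * s) * exp (- s * x))) (at s within {0..pi / l})" for s
    by (auto intro!: derivative_eq_intros simp: D_def algebra_simps power2_eq_square)
  from ftc[OF this] show ?C using l by (simp add: D_def distrib_left mult_ac add_divide_distrib add.commute)
  have "((\<lambda>s. - exp (- s * x) * (l * cos (l * s) + x * sin (l * s))) has_real_derivative
      D * (sin (l * s) * exp (- s * x))) (at s within {0..pi / l})" for s
    by (auto intro!: derivative_eq_intros simp: D_def algebra_simps power2_eq_square)
  from ftc[OF this] show ?S using l by (simp add: D_def distrib_left mult_ac add_divide_distrib add.commute)
qed

context cube_multipliers
begin

lemma bounded_mult_integral_const:
  fixes a b :: real
  assumes "a \<le> b" "\<And>t. t \<in> {a..b} \<Longrightarrow> bounded_mult n (\<phi> t) C"
    and "\<And>S. S \<subseteq> {1..n} \<Longrightarrow> ((\<lambda>t. \<phi> t S) has_integral \<psi> S) {a..b}"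
  shows "bounded_mult n \<psi> ((b - a) * C)"
  using bounded_mult_integral[OF assms(2,3) has_integral_const_real[of C a b]] assms(1) by simp

end

context typed_cube_multipliers
begin

text \<open>These are the real and imaginary parts of \<open>1 / (x - \<i> l)\<close> at
  \<open>x = t * card (S \<inter> A)\<close>. The integrands over the half period are contractions,
  so the integral costs \<open>pi / l\<close>; dividing by the factor
  \<open>1 + exp (- (pi / l) * x)\<close> costs the constant of
  \<open>bounded_mult_inverse_one_plus_noise\<close>.\<close>

lemma bounded_mult_resolvent:
  obtains M where "1 \<le> M"
    "\<And>n A (t::real) (l::real). \<lbrakk>finite A; 0 < t; 0 < l\<rbrakk> \<Longrightarrow>
       bounded_mult n (\<lambda>S. t * card (S \<inter> A) / (l\<^sup>2 + (t * card (S \<inter> A))\<^sup>2)) (M / l)"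
    "\<And>n A (t::real) (l::real). \<lbrakk>finite A; 0 < t; 0 < l\<rbrakk> \<Longrightarrow>
       bounded_mult n (\<lambda>S. l / (l\<^sup>2 + (t * card (S \<inter> A))\<^sup>2)) (M / l)"
proof -
  obtain M where M: "1 \<le> M" and inv:
    "\<And>n A a. \<lbrakk>finite A; 0 \<le> a; a \<le> 1\<rbrakk> \<Longrightarrow> bounded_mult n (\<lambda>S. 1 / (1 + a ^ card (S \<inter> A))) M"
    by (rule bounded_mult_inverse_one_plus_noise) blast
  have pow: "exp (- c) ^ card (S \<inter> A) = exp (- c * card (S \<inter> A))" for c :: real and S A :: "nat set"
    by (simp add: exp_of_nat_mult[symmetric] mult.commute)
  have key: "bounded_mult n (\<lambda>S. q S * (1 + exp (- (pi / l) * (t * card (S \<inter> A)))) * (1 / (1 + exp (- (pi / l) * (t * card (S \<inter> A)))))) (pi * M / l)"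
    if "finite A" "0 < t" "0 < l" and u: "\<And>s. \<bar>u s\<bar> \<le> 1"
      and F: "\<And>S. ((\<lambda>s. u s * exp (- s * (t * card (S \<inter> A)))) has_integral
        q S * (1 + exp (- (pi / l) * (t * card (S \<inter> A))))) {0..pi / l}"
    for u :: "real \<Rightarrow> real" and q n A and t l :: real
  proof -
    have "bounded_mult n (\<lambda>S. u s * exp (- s * (t * card (S \<inter> A)))) 1" if "s \<in> {0..pi / l}" for s
    proof -
      have "bounded_mult n (\<lambda>S. exp (- (s * t)) ^ card (S \<inter> A)) 1"
        using that \<open>finite A\<close> \<open>0 < t\<close> by (intro bounded_mult_noise) auto
      from bounded_mult_mono[OF bounded_mult_cmult[OF this, of "u s"], of 1] u[of s]
      show ?thesis by (simp add: pow mult.assoc)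
    qed
    from bounded_mult_integral_const[OF _ this F]
    have 1: "bounded_mult n (\<lambda>S. q S * (1 + exp (- (pi / l) * (t * card (S \<inter> A))))) (pi / l)"
      using \<open>0 < l\<close> by simp
    have 2: "bounded_mult n (\<lambda>S. 1 / (1 + exp (- (pi / l) * (t * card (S \<inter> A))))) M"
      using inv[of A "exp (- ((pi / l) * t))" n] \<open>finite A\<close> \<open>0 < t\<close> \<open>0 < l\<close> unfolding pow by (simp add: mult.assoc)
    show ?thesis using bounded_mult_mult[OF 1 2] \<open>0 < l\<close> by simp
  qed
  have cancel: "c * (1 + exp y) * (1 / (1 + exp y)) = c" for c y :: real
  proof -
    have "1 + exp y \<noteq> 0" using exp_gt_zero[of y] by linarith
    then show ?thesis by simp
  qed
  show ?thesis
  proof (rule that[of "pi * M"])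
    have "1 * 1 \<le> pi * M" using M pi_gt3 by (intro mult_mono) auto
    then show "1 \<le> pi * M" by simp
    fix n and A :: "nat set" and t l :: real
    assume A: "finite A" and t: "0 < t" and l: "0 < l"
    have "bounded_mult n (\<lambda>S. t * card (S \<inter> A) / (l\<^sup>2 + (t * card (S \<inter> A))\<^sup>2) *
        (1 + exp (- (pi / l) * (t * card (S \<inter> A)))) * (1 / (1 + exp (- (pi / l) * (t * card (S \<inter> A)))))) (pi * M / l)"
    proof (rule key[OF A t l, where u = "\<lambda>s. cos (l * s)"])
      fix S
      define x where "x = t * card (S \<inter> A)"
      show "((\<lambda>s. cos (l * s) * exp (- s * x)) has_integral
          x / (l\<^sup>2 + x\<^sup>2) * (1 + exp (- (pi / l) * x))) {0..pi / l}"
        by (rule has_integral_cos_exp[OF l])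
    qed auto
    then show "bounded_mult n (\<lambda>S. t * card (S \<inter> A) / (l\<^sup>2 + (t * card (S \<inter> A))\<^sup>2)) (pi * M / l)"
      unfolding cancel .
    have "bounded_mult n (\<lambda>S. l / (l\<^sup>2 + (t * card (S \<inter> A))\<^sup>2) *
        (1 + exp (- (pi / l) * (t * card (S \<inter> A)))) * (1 / (1 + exp (- (pi / l) * (t * card (S \<inter> A)))))) (pi * M / l)"
    proof (rule key[OF A t l, where u = "\<lambda>s. sin (l * s)"])
      fix S
      define x where "x = t * card (S \<inter> A)"
      show "((\<lambda>s. sin (l * s) * exp (- s * x)) has_integral
          l / (l\<^sup>2 + x\<^sup>2) * (1 + exp (- (pi / l) * x))) {0..pi / l}"
        by (rule has_integral_sin_exp[OF l])
    qed auto
    then show "bounded_mult n (\<lambda>S. l / (l\<^sup>2 + (t * card (S \<inter> A))\<^sup>2)) (pi * M / l)"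
      unfolding cancel .
  qed
qed

text \<open>Up to the factor \<open>pi / 2\<close> the multiplier is the limit in
  \<open>cos_poisson_by_parts_tendsto\<close>. Each piece there has a bound from the resolvents: a
  constant on [0, 1], boundary terms at 1, and a tail of order \<open>1 / l^2\<close>, whose
  integral is bounded independently of the upper end.\<close>

lemma bounded_mult_derivative_noise:
  obtains C where "1 \<le> C"
    "\<And>n A (t::real). \<lbrakk>finite A; 0 < t\<rbrakk> \<Longrightarrow>
       bounded_mult n (\<lambda>S. t * card (S \<inter> A) * exp (- (t * card (S \<inter> A)))) C"
proof -
  obtain M where M: "1 \<le> M" and v:
    "\<And>n A (t::real) (l::real). \<lbrakk>finite A; 0 < t; 0 < l\<rbrakk> \<Longrightarrow>
       bounded_mult n (\<lambda>S. t * card (S \<inter> A) / (l\<^sup>2 + (t * card (S \<inter> A))\<^sup>2)) (M / l)" and w: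
    "\<And>n A (t::real) (l::real). \<lbrakk>finite A; 0 < t; 0 < l\<rbrakk> \<Longrightarrow>
       bounded_mult n (\<lambda>S. l / (l\<^sup>2 + (t * card (S \<inter> A))\<^sup>2)) (M / l)"
    by (rule bounded_mult_resolvent) blast
  have MM: "1 \<le> M ^ 3" "M \<le> M ^ 3" "M\<^sup>2 \<le> M ^ 3"
    using M power_increasing[of 0 3 M] power_increasing[of 1 3 M] power_increasing[of 2 3 M] by auto
  show ?thesis
  \<comment> \<open>The pieces add up to \<open>2 + 2 * M + 2 * M^2 + 10 * M^3\<close>, at most
    \<open>16 * M^3\<close> as \<open>M\<close> is at least 1; the factor \<open>2 / pi\<close> is
    estimated by 1.\<close>
  proof (rule that[of "17 * M ^ 3"])
    show "1 \<le> 17 * M ^ 3" using MM(1) by linarith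
    fix n and A :: "nat set" and t :: real
    assume A: "finite A" and t: "0 < t"
    define x where "x S = t * card (S \<inter> A)" for S
    have x: "0 \<le> x S" for S using t by (simp add: x_def)
    define G where "G S l = 1 - l\<^sup>2 / (l\<^sup>2 + (x S)\<^sup>2)" for S and l :: real
    define G' where "G' S l = - 2 * l * (x S / (l\<^sup>2 + (x S)\<^sup>2))\<^sup>2" for S and l :: real
    define G'' where "G'' S l = (x S / (l\<^sup>2 + (x S)\<^sup>2))\<^sup>2 * (8 * l * (l / (l\<^sup>2 + (x S)\<^sup>2)) - 2)" for S and l :: real
    note v = v[OF A t, of _ n, folded x_def] and w = w[OF A t, of _ n, folded x_def]
    have G: "bounded_mult n (\<lambda>S. G S l) (1 + M)" if "0 \<le> l" for l
    proof (cases "l = 0")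
      case True
      then show ?thesis using bounded_mult_mono[OF bounded_mult_one, of "1 + M"] M by (simp add: G_def)
    next
      case False
      then have l: "0 < l" using that by simp
      show ?thesis
        using bounded_mult_diff[OF bounded_mult_one bounded_mult_cmult[OF w[OF l], of l]] l
        by (simp add: G_def power2_eq_square)
    qed
    have G'1: "bounded_mult n (\<lambda>S. G' S 1) (2 * M\<^sup>2)"
      using bounded_mult_cmult[OF bounded_mult_power[OF v[of 1], of 2], of "-2"] M by (simp add: G'_def)
    \<comment> \<open>\<open>G''\<close> is the square of the real part of the resolvent times an
      affine function of \<open>l\<close> times its imaginary part. The square gains
      \<open>1 / l^2\<close>, and the other factor stays bounded.\<close>
    have G'': "bounded_mult n (\<lambda>S. G'' S l) (10 * M ^ 3 * (1 / l\<^sup>2))" if "1 \<le> l" for l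
    proof -
      have l: "0 < l" using that by simp
      have "bounded_mult n (\<lambda>S. 2 * 1) (\<bar>2\<bar> * 1)" by (rule bounded_mult_cmult[OF bounded_mult_one])
      from bounded_mult_mult[OF bounded_mult_power[OF v[OF l], of 2]
          bounded_mult_diff[OF bounded_mult_cmult[OF w[OF l], of "8 * l"] this]]
      have "bounded_mult n (\<lambda>S. G'' S l) ((M / l)\<^sup>2 * (8 * M + 2))"
        using l M by (simp add: G''_def)
      then show ?thesis
      proof (rule bounded_mult_mono)
        have "(M / l)\<^sup>2 * (8 * M + 2) \<le> (M / l)\<^sup>2 * (10 * M)"
          using M by (intro mult_left_mono) auto
        also have "\<dots> = 10 * M ^ 3 * (1 / l\<^sup>2)" by (simp add: power_divide power2_eq_square power3_eq_cube)
        finally show "(M / l)\<^sup>2 * (8 * M + 2) \<le> 10 * M ^ 3 * (1 / l\<^sup>2)" .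
      qed
    qed
    have cosb: "bounded_mult n (\<lambda>S. c * \<phi> S) C" if "bounded_mult n \<phi> C" "\<bar>c\<bar> \<le> 1" "0 \<le> C" for c \<phi> C
      using bounded_mult_mono[OF bounded_mult_cmult[OF that(1), of c], of C] that mult_right_mono[of "\<bar>c\<bar>" 1 C] by simp
    have I0: "bounded_mult n (\<lambda>S. integral {0..1} (\<lambda>l. cos l * G S l)) (1 + M)"
    proof -
      have "(\<lambda>l. cos l * G S l) integrable_on {0..1}" for S
      proof (cases "x S = 0")
        case True
        have "((\<lambda>l. cos l * G S l) has_integral 0) {0..1}"
          by (rule has_integral_spike_finite[of "{0}" _ _ "\<lambda>_. 0"]) (auto simp: G_def True)
        then show ?thesis by (rule has_integral_integrable)
      next
        case False
        then show ?thesis unfolding G_def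
          by (intro integrable_continuous_interval continuous_intros) (auto simp: add_nonneg_eq_0_iff)
      qed
      then show ?thesis
        using M G bounded_mult_integral_const[of 0 1 n "\<lambda>l S. cos l * G S l" "1 + M" "\<lambda>S. integral {0..1} (\<lambda>l. cos l * G S l)"]
        by (simp add: cosb integrable_integral)
    qed
    have I1: "bounded_mult n (\<lambda>S. integral {1..real (Suc R)} (\<lambda>l. cos l * G'' S l)) (10 * M ^ 3)" for R
    proof -
      have int: "(\<lambda>l. cos l * G'' S l) integrable_on {1..real (Suc R)}" for S
        unfolding G''_def by (intro integrable_continuous_interval continuous_intros) (auto simp: add_nonneg_eq_0_iff)
      have "((\<lambda>l. 1 / l\<^sup>2) has_integral (- 1 / real (Suc R) - (- 1 / 1))) {1..real (Suc R)}"
        by (rule fundamental_theorem_of_calculus)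
          (auto intro!: derivative_eq_intros simp: power2_eq_square simp flip: has_real_derivative_iff_has_vector_derivative)
      then have C: "((\<lambda>l. 10 * M ^ 3 * (1 / l\<^sup>2)) has_integral 10 * M ^ 3 * (- 1 / real (Suc R) - (- 1 / 1))) {1..real (Suc R)}"
        by (rule has_integral_mult_right)
      have "bounded_mult n (\<lambda>S. integral {1..real (Suc R)} (\<lambda>l. cos l * G'' S l))
          (10 * M ^ 3 * (- 1 / real (Suc R) - (- 1 / 1)))"
      proof (rule bounded_mult_integral[OF _ _ C])
        show "bounded_mult n (\<lambda>S. cos l * G'' S l) (10 * M ^ 3 * (1 / l\<^sup>2))" if "l \<in> {1..real (Suc R)}" for l
          using M that by (intro cosb G'') auto
        show "((\<lambda>l. cos l * G'' S l) has_integral integral {1..real (Suc R)} (\<lambda>l. cos l * G'' S l)) {1..real (Suc R)}" for S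
          by (rule integrable_integral[OF int])
      qed
      moreover have "10 * M ^ 3 * (- 1 / real (Suc R) - (- 1 / 1)) \<le> 10 * M ^ 3"
        using M by (intro mult_left_le) auto
      ultimately show ?thesis by (rule bounded_mult_mono)
    qed
    have "bounded_mult n (\<lambda>S. integral {0..1} (\<lambda>l. cos l * G S l) - sin 1 * G S 1 - cos 1 * G' S 1
        - integral {1..real (Suc R)} (\<lambda>l. cos l * G'' S l)) ((1 + M) + (1 + M) + 2 * M\<^sup>2 + 10 * M ^ 3)" for R
      using M by (intro bounded_mult_diff I0 I1 cosb G G'1) auto
    moreover have "(\<lambda>R. integral {0..1} (\<lambda>l. cos l * G S l) - sin 1 * G S 1 - cos 1 * G' S 1
        - integral {1..real (Suc R)} (\<lambda>l. cos l * G'' S l)) \<longlonglongrightarrow> pi / 2 * (x S * exp (- x S))" for S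
      using cos_poisson_by_parts_tendsto[OF x, of S] unfolding G_def G'_def G''_def .
    ultimately have "bounded_mult n (\<lambda>S. pi / 2 * (x S * exp (- x S))) ((1 + M) + (1 + M) + 2 * M\<^sup>2 + 10 * M ^ 3)"
      by (rule bounded_mult_tendsto[OF _ _ tendsto_const])
    from bounded_mult_cmult[OF this, of "2 / pi"]
    have "bounded_mult n (\<lambda>S. x S * exp (- x S)) (2 / pi * ((1 + M) + (1 + M) + 2 * M\<^sup>2 + 10 * M ^ 3))"
      by simp
    moreover have "2 / pi * ((1 + M) + (1 + M) + 2 * M\<^sup>2 + 10 * M ^ 3) \<le> 17 * M ^ 3"
    proof -
      have "2 / pi * ((1 + M) + (1 + M) + 2 * M\<^sup>2 + 10 * M ^ 3) \<le> 1 * ((1 + M) + (1 + M) + 2 * M\<^sup>2 + 10 * M ^ 3)"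
        using pi_gt3 M by (intro mult_right_mono) auto
      also have "\<dots> \<le> 17 * M ^ 3" using MM by simp
      finally show ?thesis .
    qed
    ultimately show "bounded_mult n (\<lambda>S. t * card (S \<inter> A) * exp (- (t * card (S \<inter> A)))) (17 * M ^ 3)"
      unfolding x_def by (rule bounded_mult_mono)
  qed
qed

end

section \<open>The Rademacher projection\<close>

text \<open>\<open>real i ^ i / fact i\<close> is one term of the exponential series at
  \<open>i\<close>.\<close>

lemma power_self_le_exp_fact: "real i ^ i \<le> exp (real i) * fact i"
proof -
  have "(\<Sum>k\<in>{i}. real i ^ k /\<^sub>R fact k) \<le> (\<Sum>k. real i ^ k /\<^sub>R fact k)"
    by (rule sum_le_suminf[OF summable_exp_generic]) auto
  then show ?thesis by (simp add: exp_def field_simps)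
qed

lemma cos_product_has_integral:
  "((\<lambda>\<theta>. cos \<theta> * cos (\<theta> * real k)) has_integral (if k = 1 then pi else 0)) {- pi..pi}"
proof (cases "k = 1")
  case True
  have "((\<lambda>\<theta>. cos \<theta> * cos \<theta>) has_integral (pi + sin pi * cos pi) / 2 - (- pi + sin (- pi) * cos (- pi)) / 2) {- pi..pi}"
  proof (rule fundamental_theorem_of_calculus)
    fix \<theta> :: real
    have "sin \<theta> * sin \<theta> = 1 - cos \<theta> * cos \<theta>" using sin_cos_squared_add3[of \<theta>] by linarith
    then show "((\<lambda>\<theta>. (\<theta> + sin \<theta> * cos \<theta>) / 2) has_vector_derivative cos \<theta> * cos \<theta>) (at \<theta> within {- pi..pi})"
      by (auto intro!: derivative_eq_intros simp flip: has_real_derivative_iff_has_vector_derivative)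
  qed simp
  then show ?thesis using True by simp
next
  case False
  define a b where "a = real k - 1" and "b = real k + 1"
  have ab: "a \<noteq> 0" "b \<noteq> 0" using False by (auto simp: a_def b_def)
  have z: "sin (a * pi) = 0" "sin (b * pi) = 0"
    by (auto simp: a_def b_def left_diff_distrib distrib_right sin_diff sin_add)
  have "((\<lambda>\<theta>. cos \<theta> * cos (\<theta> * real k)) has_integral
      (sin (a * pi) / a + sin (b * pi) / b) / 2 - (sin (a * (- pi)) / a + sin (b * (- pi)) / b) / 2) {- pi..pi}"
  proof (rule fundamental_theorem_of_calculus)
    fix \<theta> :: real
    have "a * \<theta> = \<theta> * real k - \<theta>" "b * \<theta> = \<theta> * real k + \<theta>"
      by (simp_all add: a_def b_def algebra_simps)
    then have "(cos (a * \<theta>) + cos (b * \<theta>)) / 2 = cos \<theta> * cos (\<theta> * real k)"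
      by (simp add: cos_diff cos_add)
    then show "((\<lambda>\<theta>. (sin (a * \<theta>) / a + sin (b * \<theta>) / b) / 2) has_vector_derivative cos \<theta> * cos (\<theta> * real k)) (at \<theta> within {- pi..pi})"
      using ab by (auto intro!: derivative_eq_intros simp flip: has_real_derivative_iff_has_vector_derivative)
  qed simp
  then show ?thesis using z False by simp
qed

context typed_cube_multipliers
begin

text \<open>
  \<open>exp (- \<tau> k) * cos (\<theta> k)\<close> is the real part of the heat semigroup at the complex time
  \<open>\<tau> + \<i> \<theta>\<close>; since \<open>k\<close> is an integer, integrating over a full period in \<open>\<theta>\<close> isolates \<open>k = 1\<close>.
\<close>

lemma bounded_mult_rademacher_projection:
  obtains K where "0 \<le> K"
    "\<And>n A. finite A \<Longrightarrow> bounded_mult n (\<lambda>S. if card (S \<inter> A) = 1 then 1 else 0) K"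
proof -
  obtain C where C: "1 \<le> C" and der:
    "\<And>n A (t::real). \<lbrakk>finite A; 0 < t\<rbrakk> \<Longrightarrow>
       bounded_mult n (\<lambda>S. t * card (S \<inter> A) * exp (- (t * card (S \<inter> A)))) C"
    by (rule bounded_mult_derivative_noise) blast
  \<comment> \<open>Makes the cosine series converge geometrically over the whole period: for
    \<theta> between \<open>- pi\<close> and \<open>pi\<close> its terms have bound at most
    \<open>(exp 1 * (pi * C / \<tau>)) ^ i\<close>, and the base is \<open>1 / 2\<close>.\<close>
  define \<tau> where "\<tau> = 2 * pi * exp 1 * C"
  have \<tau>: "0 < \<tau>" using C by (simp add: \<tau>_def)
  have "bounded_mult n (\<lambda>S. if card (S \<inter> A) = 1 then 1 else 0) (4 * exp \<tau>)" if A: "finite A" for n and A :: "nat set"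
  proof -
    define k where "k S = card (S \<inter> A)" for S
    \<comment> \<open>By the semigroup law this is, up to a scalar, the power \<open>i\<close> of
      the multiplier \<open>t * k S * exp (- (t * k S))\<close> at time
      \<open>t = \<tau> / i\<close>. The case \<open>i = 0\<close> is plain noise.\<close>
    have pow: "bounded_mult n (\<lambda>S. real (k S) ^ i * exp (- \<tau> * k S)) ((C * i / \<tau>) ^ i)" for i
    proof (cases "i = 0")
      case True
      have "bounded_mult n (\<lambda>S. exp (- \<tau>) ^ k S) 1"
        unfolding k_def using A \<tau> by (intro bounded_mult_noise) auto
      moreover have "exp (- \<tau>) ^ k S = exp (- \<tau> * k S)" for S
        by (simp add: exp_of_nat_mult[symmetric] mult.commute)
      ultimately show ?thesis using True by simp
    next
      case False
      define t where "t = \<tau> / i"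
      have t: "0 < t" using False \<tau> by (simp add: t_def)
      have "bounded_mult n (\<lambda>S. (1 / t) ^ i * (t * k S * exp (- (t * k S))) ^ i) (\<bar>(1 / t) ^ i\<bar> * C ^ i)"
        unfolding k_def using C by (intro bounded_mult_cmult bounded_mult_power der[OF A t]) auto
      moreover have "(1 / t) ^ i * (t * k S * exp (- (t * k S))) ^ i = real (k S) ^ i * exp (- \<tau> * k S)" for S
      proof -
        have "exp (- (t * k S)) ^ i = exp (- \<tau> * k S)"
          using False by (simp add: exp_of_nat_mult[symmetric] t_def)
        then show ?thesis using t by (simp add: power_mult_distrib power_divide)
      qed
      moreover have "\<bar>(1 / t) ^ i\<bar> * C ^ i = (C * i / \<tau>) ^ i"
        using t \<tau> by (simp add: t_def power_mult_distrib power_divide)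
      ultimately show ?thesis by simp
    qed
    have cosb: "bounded_mult n (\<lambda>S. cos (\<theta> * k S) * exp (- \<tau> * k S)) 2" if \<theta>: "\<theta> \<in> {- pi..pi}" for \<theta>
    proof (rule bounded_mult_tendsto[OF _ _ tendsto_const])
      show "bounded_mult n (\<lambda>S. \<Sum>i<m. (cos_coeff i * \<theta> ^ i) * (real (k S) ^ i * exp (- \<tau> * k S))) 2" for m
      proof (rule bounded_mult_mono)
        show "bounded_mult n (\<lambda>S. \<Sum>i<m. (cos_coeff i * \<theta> ^ i) * (real (k S) ^ i * exp (- \<tau> * k S)))
            (\<Sum>i<m. \<bar>cos_coeff i * \<theta> ^ i\<bar> * (C * i / \<tau>) ^ i)"
          by (intro bounded_mult_sum pow) auto
        have "\<bar>cos_coeff i * \<theta> ^ i\<bar> * (C * i / \<tau>) ^ i \<le> (1 / 2) ^ i" for i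
        proof -
          have "\<bar>cos_coeff i\<bar> \<le> 1 / fact i" by (simp add: cos_coeff_def)
          moreover have "\<bar>\<theta>\<bar> ^ i \<le> pi ^ i" using \<theta> by (intro power_mono) auto
          ultimately have "\<bar>cos_coeff i * \<theta> ^ i\<bar> * (C * i / \<tau>) ^ i \<le> 1 / fact i * pi ^ i * (C * i / \<tau>) ^ i"
            using C \<tau> unfolding abs_mult power_abs by (intro mult_mono) auto
          also have "\<dots> = real i ^ i / fact i * (pi * C / \<tau>) ^ i"
            by (simp add: power_mult_distrib power_divide)
          also have "\<dots> \<le> exp 1 ^ i * (pi * C / \<tau>) ^ i"
          proof (rule mult_right_mono)
            show "real i ^ i / fact i \<le> exp 1 ^ i"
              using power_self_le_exp_fact[of i] exp_of_nat_mult[of i "1::real"] by (simp add: field_simps)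
          qed (use C \<tau> in auto)
          also have "\<dots> = (exp 1 * (pi * C / \<tau>)) ^ i" by (simp only: power_mult_distrib)
          also have "exp 1 * (pi * C / \<tau>) = 1 / 2" using C by (simp add: \<tau>_def)
          finally show ?thesis .
        qed
        then have "(\<Sum>i<m. \<bar>cos_coeff i * \<theta> ^ i\<bar> * (C * i / \<tau>) ^ i) \<le> (\<Sum>i<m. (1 / 2) ^ i)"
          by (intro sum_mono)
        also have "\<dots> \<le> 2"
          by (simp add: sum_gp_strict)
        finally show "(\<Sum>i<m. \<bar>cos_coeff i * \<theta> ^ i\<bar> * (C * i / \<tau>) ^ i) \<le> 2" .
      qed
      show "(\<lambda>m. \<Sum>i<m. (cos_coeff i * \<theta> ^ i) * (real (k S) ^ i * exp (- \<tau> * k S)))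
          \<longlonglongrightarrow> cos (\<theta> * k S) * exp (- \<tau> * k S)" for S
        using sums_mult2[OF cos_converges[of "\<theta> * k S"], of "exp (- \<tau> * k S)"]
        by (simp add: sums_def power_mult_distrib mult_ac)
    qed
    have "bounded_mult n (\<lambda>S. (if k S = 1 then pi else 0) * exp (- \<tau> * k S)) ((pi - - pi) * 2)"
    proof (rule bounded_mult_integral_const)
      show "bounded_mult n (\<lambda>S. cos \<theta> * (cos (\<theta> * k S) * exp (- \<tau> * k S))) 2" if "\<theta> \<in> {- pi..pi}" for \<theta>
        using bounded_mult_mono[OF bounded_mult_cmult[OF cosb[OF that], of "cos \<theta>"], of 2] abs_cos_le_one[of \<theta>] by simp
      show "((\<lambda>\<theta>. cos \<theta> * (cos (\<theta> * k S) * exp (- \<tau> * k S))) has_integral (if k S = 1 then pi else 0) * exp (- \<tau> * k S)) {- pi..pi}" for S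
        using has_integral_mult_left[OF cos_product_has_integral[of "k S"], of "exp (- \<tau> * k S)"]
        by (simp add: mult.assoc)
    qed simp
    \<comment> \<open>At \<open>k S = 1\<close> the integral is \<open>pi * exp (- \<tau>)\<close>;
      rescaling it to 1 turns the bound \<open>2 * pi * 2\<close> into
      \<open>4 * exp \<tau>\<close>.\<close>
    from bounded_mult_cmult[OF this, of "exp \<tau> / pi"]
    have "bounded_mult n (\<lambda>S. exp \<tau> / pi * ((if k S = 1 then pi else 0) * exp (- \<tau> * k S))) (4 * exp \<tau>)"
      by (simp add: abs_mult mult.commute)
    moreover have "exp \<tau> / pi * ((if k S = 1 then pi else 0) * exp (- \<tau> * k S)) = (if card (S \<inter> A) = 1 then 1 else 0)" for S
      by (simp add: k_def exp_minus_inverse)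
    ultimately show ?thesis by simp
  qed
  then show ?thesis by (intro that[of "4 * exp \<tau>"]) auto
qed

end

section \<open>Random colourings\<close>

lemma cube_norm_mono:
  assumes "0 < p" "\<And>\<epsilon>. \<epsilon> \<in> hamming_cube n \<Longrightarrow> norm (f \<epsilon>) \<le> norm (g \<epsilon>)"
  shows "cube_norm p n f \<le> cube_norm p n g"
  unfolding cube_norm_def using assms by (intro powr_mono2 cube_mean_mono cube_mean_nonneg) auto

text \<open>\<open>w 0\<close> is the weight of the indices without a colour.\<close>

lemma sum_colouring:
  fixes w :: "nat \<Rightarrow> real" and n :: nat
  assumes S: "S \<subseteq> {1..n}" and j: "j \<in> S" and c: "c \<le> m" and w: "(\<Sum>x\<le>m. w x) = 1"
  shows "(\<Sum>\<kappa>\<in>{1..n} \<rightarrow>\<^sub>E {..m}. (\<Prod>i=1..n. w (\<kappa> i)) * (if S \<inter> {i \<in> {1..n}. \<kappa> i = c} = {j} then 1 else 0))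
    = w c * (1 - w c) ^ (card S - 1)"
proof -
  \<comment> \<open>The event that \<open>j\<close> has colour \<open>c\<close> and no other element
    of \<open>S\<close> does is a product of conditions on single indices, so the sum over
    colourings factorises.\<close>
  let ?f = "\<lambda>i x. if i = j then (if x = c then 1 else 0) else if i \<in> S then (if x = c then 0 else 1) else (1::real)"
  have fS: "finite S" by (rule finite_subset[OF S]) simp
  have ind: "(if S \<inter> {i \<in> {1..n}. \<kappa> i = c} = {j} then 1 else 0) = (\<Prod>i=1..n. ?f i (\<kappa> i))" for \<kappa> :: "nat \<Rightarrow> nat"
  proof (cases "S \<inter> {i \<in> {1..n}. \<kappa> i = c} = {j}")
    case True
    then have "(\<Prod>i=1..n. ?f i (\<kappa> i)) = (\<Prod>i=1..n. 1)"
      by (intro prod.cong refl) (auto simp: set_eq_iff)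
    then show ?thesis using True by simp
  next
    case False
    then have "\<exists>i\<in>{1..n}. ?f i (\<kappa> i) = 0" using S j by (auto simp: set_eq_iff)
    then have "(\<Prod>i=1..n. ?f i (\<kappa> i)) = 0" by (intro prod_zero) auto
    then show ?thesis using False by simp
  qed
  have wc: "(\<Sum>x\<le>m. w x * (if x = c then 1 else 0)) = w c" using c by (simp add: if_distrib[of "\<lambda>z. _ * z"] cong: if_cong)
  have wc': "(\<Sum>x\<le>m. w x * (if x = c then 0 else 1)) = 1 - w c"
  proof -
    have "(\<Sum>x\<le>m. w x * (if x = c then 0 else 1)) + (\<Sum>x\<le>m. w x * (if x = c then 1 else 0)) = (\<Sum>x\<le>m. w x)"
      by (subst sum.distrib[symmetric]) (intro sum.cong, auto)
    then show ?thesis using wc w by simp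
  qed
  have "(\<Sum>\<kappa>\<in>{1..n} \<rightarrow>\<^sub>E {..m}. (\<Prod>i=1..n. w (\<kappa> i)) * (if S \<inter> {i \<in> {1..n}. \<kappa> i = c} = {j} then 1 else 0))
      = (\<Sum>\<kappa>\<in>{1..n} \<rightarrow>\<^sub>E {..m}. \<Prod>i=1..n. w (\<kappa> i) * ?f i (\<kappa> i))"
    unfolding ind by (simp add: prod.distrib)
  also have "\<dots> = (\<Prod>i=1..n. \<Sum>x\<le>m. w x * ?f i x)"
    by (subst prod_sum_PiE) auto
  also have "\<dots> = (\<Prod>i=1..n. if i = j then w c else if i \<in> S then 1 - w c else 1)"
    using wc wc' w by (intro prod.cong refl) auto
  also have "\<dots> = (\<Prod>i\<in>S. if i = j then w c else if i \<in> S then 1 - w c else 1)"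
    using S j by (intro prod.mono_neutral_right) auto
  also have "\<dots> = w c * (\<Prod>i\<in>S - {j}. if i = j then w c else if i \<in> S then 1 - w c else 1)"
    using fS j by (subst prod.remove) auto
  also have "(\<Prod>i\<in>S - {j}. if i = j then w c else if i \<in> S then 1 - w c else 1) = (\<Prod>i\<in>S - {j}. 1 - w c)"
    by (intro prod.cong) auto
  also have "\<dots> = (1 - w c) ^ (card S - 1)" using fS j by simp
  finally show ?thesis .
qed

section \<open>The norm over both \<delta> and \<epsilon>\<close>

context cube_multipliers
begin

text \<open>The L^p norm in both variables when the multiplier depends on the signs \<delta>. Taking
  \<delta> and \<open>S\<close> as one index makes it a seminorm in the real array \<Phi>, so the
  results on \<open>seminorm_on\<close> apply to averages and integrals of such arrays.\<close>

definition decoupled_norm :: "nat \<Rightarrow> ((nat \<Rightarrow> real) \<Rightarrow> 'a) \<Rightarrow> ((nat \<Rightarrow> real) \<times> nat set \<Rightarrow> real) \<Rightarrow> real" where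
  "decoupled_norm n g \<Phi> = cube_norm p n (\<lambda>\<delta>. cube_norm p n (walsh_mult n (\<lambda>S. \<Phi> (\<delta>, S)) g))"

lemma seminorm_on_decoupled_norm:
  "seminorm_on (hamming_cube n \<times> Pow {1..n}) (decoupled_norm n g)"
  unfolding seminorm_on_def
proof (intro conjI allI impI)
  fix x y :: "(nat \<Rightarrow> real) \<times> nat set \<Rightarrow> real" and c
  show "decoupled_norm n g x = decoupled_norm n g y" if "\<forall>i\<in>hamming_cube n \<times> Pow {1..n}. x i = y i"
  proof -
    have "walsh_mult n (\<lambda>S. x (\<delta>, S)) g = walsh_mult n (\<lambda>S. y (\<delta>, S)) g" if "\<delta> \<in> hamming_cube n" for \<delta>
      using \<open>\<forall>i\<in>_. x i = y i\<close> that by (intro walsh_mult_cong) auto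
    then show ?thesis unfolding decoupled_norm_def by (intro cube_norm_cong) simp
  qed
  let ?N = "\<lambda>x \<delta>. cube_norm p n (walsh_mult n (\<lambda>S. x (\<delta>, S)) g)"
  have "decoupled_norm n g (\<lambda>i. x i + y i) \<le> cube_norm p n (\<lambda>\<delta>. ?N x \<delta> + ?N y \<delta>)"
    unfolding decoupled_norm_def
    using p by (intro cube_norm_mono) (auto simp: seminorm_onD(2)[OF _ seminorm_on_walsh_mult])
  also have "\<dots> \<le> decoupled_norm n g x + decoupled_norm n g y"
    unfolding decoupled_norm_def using p by (intro cube_norm_triangle) auto
  finally show "decoupled_norm n g (\<lambda>i. x i + y i) \<le> decoupled_norm n g x + decoupled_norm n g y" .
  have "?N (\<lambda>i. c * x i) \<delta> = \<bar>c\<bar> *\<^sub>R ?N x \<delta>" for \<delta>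
    using seminorm_onD(3)[OF _ seminorm_on_walsh_mult, of n c "\<lambda>S. x (\<delta>, S)" g] by simp
  then show "decoupled_norm n g (\<lambda>i. c * x i) = \<bar>c\<bar> * decoupled_norm n g x"
    unfolding decoupled_norm_def using p cube_norm_scaleR[of p n "\<bar>c\<bar>" "?N x"] by simp
qed

end

context typed_cube_multipliers
begin

text \<open>For fixed \<delta> each colour contributes a Rademacher projection composed with a sign
  change, hence has bound \<open>K\<close>. Multiplying \<delta> by a common sign on each class
  preserves its law, so independent signs, one per colour, may be inserted; type then yields
  \<open>m powr b\<close> instead of \<open>m\<close>.\<close>

lemma decoupled_norm_colouring_le:
  assumes K: "0 \<le> K" "\<And>n A. finite A \<Longrightarrow> bounded_mult n (\<lambda>S. if card (S \<inter> A) = 1 then 1 else 0) K"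
    and m: "1 \<le> m"
  shows "decoupled_norm n g (\<lambda>(\<delta>, S). \<Sum>c=1..m. (\<Prod>i\<in>S \<inter> {i \<in> {1..n}. \<kappa> i = c}. \<delta> i) *
      (if card (S \<inter> {i \<in> {1..n}. \<kappa> i = c}) = 1 then 1 else 0)) \<le> T * real m powr b * (K * cube_norm p n g)"
proof -
  define A where "A c = {i \<in> {1..n}. \<kappa> i = c}" for c
  define Y where "Y \<delta> c S = (\<Prod>i\<in>S \<inter> A c. \<delta> i) * (if card (S \<inter> A c) = 1 then 1 else 0)"
    for \<delta> :: "nat \<Rightarrow> real" and c S
  define N where "N \<delta> = cube_norm p n (walsh_mult n (\<lambda>S. \<Sum>c=1..m. Y \<delta> c S) g) powr p" for \<delta>
  define R where "R = T * real m powr b * (K * cube_norm p n g)"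
  have R: "0 \<le> R" using T K(1) by (simp add: R_def)
  have Y: "cube_norm p n (walsh_mult n (Y \<delta> c) g) \<le> K * cube_norm p n g" if "\<delta> \<in> hamming_cube n" for \<delta> c
    using bounded_mult_mult[OF bounded_mult_walsh_Int[OF that, of "A c"] K(2)[of "A c" n]]
    by (simp add: bounded_mult_def Y_def[abs_def] A_def)
  define \<eta> where "\<eta> s = (\<lambda>i\<in>{1..n}. if \<kappa> i \<in> {1..m} then s (\<kappa> i) else 1)" for s :: "nat \<Rightarrow> real"
  have \<eta>: "\<eta> s \<in> hamming_cube n" if "s \<in> hamming_cube m" for s
    unfolding hamming_cube_def \<eta>_def
    using hamming_cube_cases[OF that] by (intro restrict_PiE[THEN iffD2]) auto
  \<comment> \<open>Where \<open>Y\<close> does not vanish, exactly one index of \<open>S\<close>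
    lies in the class, so exactly one sign \<open>s c\<close> comes out.\<close>
  have flip: "Y (\<lambda>i\<in>{1..n}. \<eta> s i * \<delta> i) c S = s c * Y \<delta> c S" if "c \<in> {1..m}" for s \<delta> c S
  proof (cases "card (S \<inter> A c) = 1")
    case True
    then obtain j where j: "S \<inter> A c = {j}" by (auto simp: card_1_singleton_iff)
    then have "j \<in> A c" by auto
    then show ?thesis using that j unfolding Y_def j by (simp add: A_def \<eta>_def)
  qed (simp add: Y_def)
  have "N (\<lambda>i\<in>{1..n}. \<eta> s i * \<delta> i) = cube_norm p n (\<lambda>\<epsilon>. \<Sum>c=1..m. s c *\<^sub>R walsh_mult n (Y \<delta> c) g \<epsilon>) powr p" for s \<delta>
  proof -
    have "(\<lambda>S. \<Sum>c=1..m. Y (\<lambda>i\<in>{1..n}. \<eta> s i * \<delta> i) c S) = (\<lambda>S. \<Sum>c=1..m. s c * Y \<delta> c S)"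
      using flip by (intro ext sum.cong) auto
    then show ?thesis unfolding N_def by (simp add: walsh_mult_sum[abs_def])
  qed
  note N_flip = this
  have "cube_mean n N = cube_mean m (\<lambda>s. cube_mean n (\<lambda>\<delta>. N (\<lambda>i\<in>{1..n}. \<eta> s i * \<delta> i)))"
    using cube_mean_shift[OF \<eta>] by (subst cube_mean_cong[where g = "\<lambda>_. cube_mean n N"]) auto
  also have "\<dots> = cube_mean n (\<lambda>\<delta>. cube_mean m (\<lambda>s. cube_norm p n (\<lambda>\<epsilon>. \<Sum>c=1..m. s c *\<^sub>R walsh_mult n (Y \<delta> c) g \<epsilon>) powr p))"
    unfolding N_flip by (rule cube_mean_swap)
  also have "\<dots> \<le> cube_mean n (\<lambda>_. R powr p)"
    unfolding R_def using Y m by (intro cube_mean_mono type) auto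
  finally have "cube_mean n N powr (1 / p) \<le> (R powr p) powr (1 / p)"
    using p by (intro powr_mono2 cube_mean_nonneg) (auto simp: N_def)
  then have "cube_mean n N powr (1 / p) \<le> R" using p R by (simp add: powr_powr)
  moreover have "decoupled_norm n g (\<lambda>(\<delta>, S). \<Sum>c=1..m. Y \<delta> c S) = cube_mean n N powr (1 / p)"
    unfolding decoupled_norm_def N_def[abs_def]
    by (subst cube_norm_def[of p n "\<lambda>\<delta>. cube_norm p n (_ \<delta>)"]) simp
  ultimately show ?thesis unfolding Y_def A_def R_def by simp
qed

text \<open>Averaging the arrays of \<open>decoupled_norm_colouring_le\<close> over colourings gives
  \<open>m * h\<close> times the wanted array, by \<open>sum_colouring\<close> for each
  \<open>c\<close> and \<open>j\<close>. As \<open>m * h\<close> is at least \<open>1 / 2\<close>,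
  removing it costs a factor 2, and \<open>m \<le> 1 / h\<close> gives the power of
  \<open>h\<close>.\<close>

lemma decoupled_norm_noise_le:
  assumes K: "0 \<le> K" "\<And>n A. finite A \<Longrightarrow> bounded_mult n (\<lambda>S. if card (S \<inter> A) = 1 then 1 else 0) K"
    and h: "0 < h" "h \<le> 1"
  shows "decoupled_norm n g (\<lambda>(\<delta>, S). (1 - h) ^ (card S - 1) * (\<Sum>j\<in>S. \<delta> j))
    \<le> 2 * T * K * cube_norm p n g * h powr (- b)"
proof -
  \<comment> \<open>The largest number of colours of probability \<open>h\<close> that fit; the
    remaining \<open>1 - m * h\<close> is the probability of no colour.\<close>
  define m where "m = nat \<lfloor>1 / h\<rfloor>"
  have fl: "1 \<le> \<lfloor>1 / h\<rfloor>" using h by (simp add: le_floor_iff)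
  then have m: "1 \<le> m" unfolding m_def by linarith
  have rm: "real m = of_int \<lfloor>1 / h\<rfloor>" using fl unfolding m_def by (intro of_nat_nat) linarith
  have mh: "real m \<le> 1 / h" "1 / h < real m + 1" unfolding rm by linarith+
  then have mh1: "real m * h \<le> 1" and "1 < (real m + 1) * h" using h by (simp_all add: field_simps)
  moreover have "(real m + 1) * h \<le> 2 * (real m * h)" using m h by (simp add: distrib_right)
  ultimately have mh2: "1 / 2 \<le> real m * h" by linarith
  define w where "w x = (if x = 0 then 1 - m * h else h)" for x :: nat
  have "(\<Sum>x\<le>m. w x) = w 0 + (\<Sum>x=1..m. w x)"
    by (simp add: sum.atLeast_Suc_atMost[of 0 m] flip: atLeast0AtMost)
  also have "(\<Sum>x=1..m. w x) = (\<Sum>x=1..m. h)" by (intro sum.cong) (auto simp: w_def)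
  finally have w1: "(\<Sum>x\<le>m. w x) = 1" by (simp add: w_def)
  have w0: "0 \<le> w x" for x using mh1 h by (simp add: w_def)
  define P where "P = {1..n} \<rightarrow>\<^sub>E {..m}"
  have P: "finite P" unfolding P_def by (intro finite_PiE) auto
  have W: "0 \<le> (\<Prod>i=1..n. w (\<kappa> i))" for \<kappa> :: "nat \<Rightarrow> nat" by (intro prod_nonneg) (simp add: w0)
  have Wsum: "(\<Sum>\<kappa>\<in>P. \<Prod>i=1..n. w (\<kappa> i)) = 1"
    unfolding P_def using w1 by (subst prod_sum_PiE[symmetric]) auto
  define Z :: "(nat \<Rightarrow> nat) \<Rightarrow> (nat \<Rightarrow> real) \<times> nat set \<Rightarrow> real" where "Z \<kappa> = (\<lambda>(\<delta>, S). \<Sum>c=1..m. (\<Prod>i\<in>S \<inter> {i \<in> {1..n}. \<kappa> i = c}. \<delta> i) *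
      (if card (S \<inter> {i \<in> {1..n}. \<kappa> i = c}) = 1 then 1 else 0))" for \<kappa>
  define R where "R = T * real m powr b * (K * cube_norm p n g)"
  have Z: "decoupled_norm n g (Z \<kappa>) \<le> R" for \<kappa>
    unfolding Z_def R_def by (rule decoupled_norm_colouring_le[OF K m])
  have fin: "finite (hamming_cube n \<times> Pow {1..n})" by simp
  note semi = fin seminorm_on_decoupled_norm[of n g]
  have avg: "(\<Sum>\<kappa>\<in>P. (\<Prod>i=1..n. w (\<kappa> i)) * Z \<kappa> (\<delta>, S)) = (m * h) * ((1 - h) ^ (card S - 1) * (\<Sum>j\<in>S. \<delta> j))"
    if S: "S \<subseteq> {1..n}" for \<delta> S
  proof -
    have fS: "finite S" by (rule finite_subset[OF S]) simp
    \<comment> \<open>Splits the event of a single common element according to which element it is,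
      the form that \<open>sum_colouring\<close> averages.\<close>
    have one: "(\<Prod>i\<in>S \<inter> B. \<delta> i) * (if card (S \<inter> B) = 1 then 1 else 0) = (\<Sum>j\<in>S. \<delta> j * (if S \<inter> B = {j} then 1 else 0))" for B
    proof (cases "card (S \<inter> B) = 1")
      case True
      then obtain j where j: "S \<inter> B = {j}" by (auto simp: card_1_singleton_iff)
      then have "j \<in> S" by auto
      then show ?thesis using fS unfolding j by (simp add: if_distrib[of "\<lambda>z. _ * z"] cong: if_cong)
    next
      case False
      then have "S \<inter> B \<noteq> {j}" for j by auto
      then show ?thesis using False by simp
    qed
    have "(\<Sum>\<kappa>\<in>P. (\<Prod>i=1..n. w (\<kappa> i)) * Z \<kappa> (\<delta>, S))
        = (\<Sum>\<kappa>\<in>P. \<Sum>c=1..m. \<Sum>j\<in>S. \<delta> j * ((\<Prod>i=1..n. w (\<kappa> i)) * (if S \<inter> {i \<in> {1..n}. \<kappa> i = c} = {j} then 1 else 0)))"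
      unfolding Z_def case_prod_conv one sum_distrib_left by (intro sum.cong refl) simp
    also have "\<dots> = (\<Sum>c=1..m. \<Sum>j\<in>S. \<delta> j * (\<Sum>\<kappa>\<in>P. (\<Prod>i=1..n. w (\<kappa> i)) * (if S \<inter> {i \<in> {1..n}. \<kappa> i = c} = {j} then 1 else 0)))"
      unfolding sum_distrib_left by (subst sum.swap, intro sum.cong refl, rule sum.swap)
    also have "\<dots> = (\<Sum>c=1..m. \<Sum>j\<in>S. \<delta> j * (w c * (1 - w c) ^ (card S - 1)))"
      unfolding P_def using w1 S by (intro sum.cong refl arg_cong2[of _ _ _ _ "(*)"] sum_colouring) auto
    also have "\<dots> = (\<Sum>c=1..m. \<Sum>j\<in>S. \<delta> j * (h * (1 - h) ^ (card S - 1)))"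
      by (intro sum.cong refl) (simp add: w_def)
    also have "\<dots> = (m * h) * ((1 - h) ^ (card S - 1) * (\<Sum>j\<in>S. \<delta> j))"
      by (simp flip: sum_distrib_right)
    finally show ?thesis .
  qed
  let ?F = "\<lambda>(\<delta>, S). (1 - h) ^ (card S - 1) * (\<Sum>j\<in>S. \<delta> j)"
  have "(m * h) * decoupled_norm n g ?F = decoupled_norm n g (\<lambda>i. (m * h) * ?F i)"
    using seminorm_onD(3)[OF semi, of "m * h"] h by simp
  also have "\<dots> = decoupled_norm n g (\<lambda>i. \<Sum>\<kappa>\<in>P. (\<Prod>i=1..n. w (\<kappa> i)) * Z \<kappa> i)"
    by (intro seminorm_onD(1)[OF semi]) (use avg in auto)
  also have "\<dots> \<le> (\<Sum>\<kappa>\<in>P. \<bar>\<Prod>i=1..n. w (\<kappa> i)\<bar> * decoupled_norm n g (Z \<kappa>))"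
    by (rule seminorm_on_sum[OF semi P])
  also have "\<dots> \<le> (\<Sum>\<kappa>\<in>P. (\<Prod>i=1..n. w (\<kappa> i)) * R)"
    using Z W by (intro sum_mono) (simp add: mult_left_mono)
  also have "\<dots> = R" by (simp only: sum_distrib_right[symmetric] Wsum mult_1)
  finally have le: "(m * h) * decoupled_norm n g ?F \<le> R" .
  have "1 / 2 * decoupled_norm n g ?F \<le> (m * h) * decoupled_norm n g ?F"
    using mh2 by (intro mult_right_mono) (auto simp: decoupled_norm_def)
  also note le
  also have "R \<le> T * (1 / h) powr b * (K * cube_norm p n g)"
    unfolding R_def using T K(1) b mh(1) by (intro mult_mono powr_mono2) auto
  also have "(1 / h) powr b = h powr (- b)" using h by (simp add: powr_divide powr_minus_divide)
  finally show ?thesis by (simp add: mult_ac)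
qed

lemma decoupled_norm_inverse_card_le:
  obtains C where "0 \<le> C"
    "\<And>n g. decoupled_norm n g (\<lambda>(\<delta>, S). 1 / real (card S) * (\<Sum>j\<in>S. \<delta> j)) \<le> C * cube_norm p n g"
proof -
  obtain K where K: "0 \<le> K"
    "\<And>n A. finite A \<Longrightarrow> bounded_mult n (\<lambda>S. if card (S \<inter> A) = 1 then 1 else 0) K"
    by (rule bounded_mult_rademacher_projection) blast
  have "decoupled_norm n g (\<lambda>(\<delta>, S). 1 / real (card S) * (\<Sum>j\<in>S. \<delta> j)) \<le> 2 * T * K / (1 - b) * cube_norm p n g" for n g
  proof -
    have fin: "finite (hamming_cube n \<times> Pow {1..n})" by simp
    note semi = fin seminorm_on_decoupled_norm[of n g]
    define R where "R = 2 * T * K * cube_norm p n g"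
    \<comment> \<open>The value at \<open>h = 0\<close> is set to 0 because
      \<open>0 powr (- b) = 0\<close> makes the bound vanish there; changing one point leaves the
      integral as it is.\<close>
    define F :: "real \<Rightarrow> (nat \<Rightarrow> real) \<times> nat set \<Rightarrow> real"
      where "F h = (\<lambda>(\<delta>, S). if h = 0 then 0 else (1 - h) ^ (card S - 1) * (\<Sum>j\<in>S. \<delta> j))"
      for h :: real
    have "decoupled_norm n g (\<lambda>(\<delta>, S). 1 / real (card S) * (\<Sum>j\<in>S. \<delta> j)) \<le> R * (1 powr (- b + 1) / (- b + 1))"
    proof (rule seminorm_on_integral_le[OF semi])
      show "((\<lambda>h. R * h powr (- b)) has_integral R * (1 powr (- b + 1) / (- b + 1))) {0..1}"
        using b by (intro has_integral_mult_right has_integral_powr_from_0) auto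
      show "decoupled_norm n g (F h) \<le> R * h powr (- b)" if "h \<in> {0..1}" for h
      proof (cases "h = 0")
        case True
        then have "F h = (\<lambda>i. 0 * 0)" by (auto simp: F_def)
        then show ?thesis using True seminorm_onD(3)[OF semi, of 0 "\<lambda>_. 0"] by simp
      next
        case False
        then show ?thesis
          unfolding F_def R_def using that decoupled_norm_noise_le[OF K, of h n g] by simp
      qed
      fix i assume "i \<in> hamming_cube n \<times> Pow {1..n}"
      then obtain \<delta> S where i: "i = (\<delta>, S)" and "S \<subseteq> {1..n}" by auto
      then have fS: "finite S" by (auto intro: finite_subset)
      have "((\<lambda>h. (1 - h) ^ (card S - 1) * (\<Sum>j\<in>S. \<delta> j)) has_integral 1 / real (card S) * (\<Sum>j\<in>S. \<delta> j)) {0..1}"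
      proof (cases "S = {}")
        case False
        then have c: "card S \<noteq> 0" using fS by simp
        have "((\<lambda>h::real. (1 - h) ^ (card S - 1)) has_integral - ((1 - 1) ^ card S / card S) - (- ((1 - 0) ^ card S / card S))) {0..1}"
          by (rule fundamental_theorem_of_calculus)
            (use c in \<open>auto intro!: derivative_eq_intros simp flip: has_real_derivative_iff_has_vector_derivative\<close>)
        from has_integral_mult_left[OF this, of "\<Sum>j\<in>S. \<delta> j"] show ?thesis using c by (simp add: power_0_left)
      qed simp
      then show "((\<lambda>h. F h i) has_integral (\<lambda>(\<delta>, S). 1 / real (card S) * (\<Sum>j\<in>S. \<delta> j)) i) {0..1}"
        unfolding i case_prod_conv by (rule has_integral_spike_finite[of "{0}", rotated 2]) (auto simp: F_def)
    qed
    then show ?thesis by (simp add: R_def)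
  qed
  then show ?thesis using T K(1) b by (intro that[of "2 * T * K / (1 - b)"]) auto
qed

end

section \<open>From the sum of derivatives to a single multiplier\<close>

lemma sum_cube_Laplacian_inv_cube_D:
  fixes g :: "(nat \<Rightarrow> real) \<Rightarrow> 'a::real_normed_vector"
  assumes \<epsilon>: "\<epsilon> \<in> hamming_cube n"
  shows "(\<Sum>j=1..n. \<delta> j *\<^sub>R cube_Laplacian_inv n (cube_D n j g) \<epsilon>)
    = walsh_mult n (\<lambda>S. 1 / real (card S) * (\<Sum>j\<in>S. \<delta> j)) g \<epsilon>"
proof -
  let ?t = "\<lambda>S. (\<Prod>k\<in>S. \<epsilon> k) *\<^sub>R (1 / real (card S)) *\<^sub>R walsh_coeff n g S"
  have "(\<Sum>j=1..n. \<delta> j *\<^sub>R cube_Laplacian_inv n (cube_D n j g) \<epsilon>)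
      = (\<Sum>j=1..n. \<Sum>S\<in>Pow {1..n}. (if j \<in> S then \<delta> j else 0) *\<^sub>R ?t S)"
  proof (intro sum.cong refl)
    fix j assume j: "j \<in> {1..n}"
    have "\<delta> j *\<^sub>R cube_Laplacian_inv n (cube_D n j g) \<epsilon> = (\<Sum>S\<in>{S \<in> Pow {1..n}. j \<in> S}. \<delta> j *\<^sub>R ?t S)"
      unfolding cube_Laplacian_inv_cube_D[OF j \<epsilon>] scaleR_sum_right by (rule sum.cong) auto
    also have "\<dots> = (\<Sum>S\<in>Pow {1..n}. if j \<in> S then \<delta> j *\<^sub>R ?t S else 0)"
      by (rule sum.inter_filter) simp
    also have "\<dots> = (\<Sum>S\<in>Pow {1..n}. (if j \<in> S then \<delta> j else 0) *\<^sub>R ?t S)"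
      by (intro sum.cong) auto
    finally show "\<delta> j *\<^sub>R cube_Laplacian_inv n (cube_D n j g) \<epsilon> = (\<Sum>S\<in>Pow {1..n}. (if j \<in> S then \<delta> j else 0) *\<^sub>R ?t S)" .
  qed
  also have "\<dots> = (\<Sum>S\<in>Pow {1..n}. (\<Sum>j=1..n. if j \<in> S then \<delta> j else 0) *\<^sub>R ?t S)"
    unfolding scaleR_sum_left by (rule sum.swap)
  also have "\<dots> = walsh_mult n (\<lambda>S. 1 / real (card S) * (\<Sum>j\<in>S. \<delta> j)) g \<epsilon>"
    unfolding walsh_mult_def multilinear_poly_def
  proof (intro sum.cong refl)
    fix S assume "S \<in> Pow {1..n}"
    then have "(\<Sum>j=1..n. if j \<in> S then \<delta> j else 0) = (\<Sum>j\<in>S. \<delta> j)"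
      by (simp flip: sum.inter_restrict add: Int_absorb1)
    then show "(\<Sum>j=1..n. if j \<in> S then \<delta> j else 0) *\<^sub>R ?t S
        = (\<Prod>i\<in>S. \<epsilon> i) *\<^sub>R ((1 / real (card S) * (\<Sum>j\<in>S. \<delta> j)) *\<^sub>R walsh_coeff n g S)"
      by (simp add: mult_ac)
  qed
  finally show ?thesis .
qed

theorem theorem3p3:
  fixes p :: real
  assumes "nontrivial_type TYPE('a::banach)" and "1 < p"
  shows "\<exists>C::real. \<forall>n\<ge>1. \<forall>g :: (nat \<Rightarrow> real) \<Rightarrow> 'a.
    cube_mean n (\<lambda>\<delta>. cube_mean n (\<lambda>\<epsilon>.
        norm (\<Sum>j=1..n. \<delta> j *\<^sub>R cube_Laplacian_inv n (cube_D n j g) \<epsilon>) powr p))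
      \<le> C * cube_mean n (\<lambda>\<epsilon>. norm (g \<epsilon>) powr p)"
proof -
  obtain T b where Tb: "1 \<le> T" "0 < b" "b < 1"
    "\<And>n m (y :: nat \<Rightarrow> (nat \<Rightarrow> real) \<Rightarrow> 'a) B. \<lbrakk>1 \<le> m; \<And>j. j \<in> {1..m} \<Longrightarrow> cube_norm p n (y j) \<le> B\<rbrakk> \<Longrightarrow>
       cube_mean m (\<lambda>s. cube_norm p n (\<lambda>\<epsilon>. \<Sum>j=1..m. s j *\<^sub>R y j \<epsilon>) powr p) \<le> (T * real m powr b * B) powr p"
    by (rule cube_norm_type[OF assms]) blast
  interpret typed_cube_multipliers p "TYPE('a)" T b
    by unfold_locales (use assms(2) Tb in auto)
  obtain C where C: "0 \<le> C"
    "\<And>n g. decoupled_norm n g (\<lambda>(\<delta>, S). 1 / real (card S) * (\<Sum>j\<in>S. \<delta> j)) \<le> C * cube_norm p n g"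
    by (rule decoupled_norm_inverse_card_le) blast
  show ?thesis
  proof (intro exI allI impI)
    fix n :: nat and g :: "(nat \<Rightarrow> real) \<Rightarrow> 'a"
    have "cube_mean n (\<lambda>\<delta>. cube_mean n (\<lambda>\<epsilon>.
        norm (\<Sum>j=1..n. \<delta> j *\<^sub>R cube_Laplacian_inv n (cube_D n j g) \<epsilon>) powr p))
      = cube_mean n (\<lambda>\<delta>. cube_mean n (\<lambda>\<epsilon>.
        norm (walsh_mult n (\<lambda>S. 1 / real (card S) * (\<Sum>j\<in>S. \<delta> j)) g \<epsilon>) powr p))"
      by (intro cube_mean_cong) (simp only: sum_cube_Laplacian_inv_cube_D)
    also have "\<dots> = decoupled_norm n g (\<lambda>(\<delta>, S). 1 / real (card S) * (\<Sum>j\<in>S. \<delta> j)) powr p"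
      using assms(2) by (simp add: decoupled_norm_def cube_norm_powr)
    also have "\<dots> \<le> (C * cube_norm p n g) powr p"
      using assms(2) C(2)[of n g] by (intro powr_mono2) (auto simp: decoupled_norm_def)
    also have "\<dots> = C powr p * cube_mean n (\<lambda>\<epsilon>. norm (g \<epsilon>) powr p)"
      using assms(2) C(1) by (simp add: powr_mult cube_norm_powr)
    finally show "cube_mean n (\<lambda>\<delta>. cube_mean n (\<lambda>\<epsilon>.
        norm (\<Sum>j=1..n. \<delta> j *\<^sub>R cube_Laplacian_inv n (cube_D n j g) \<epsilon>) powr p))
      \<le> C powr p * cube_mean n (\<lambda>\<epsilon>. norm (g \<epsilon>) powr p)" .
  qed
qed

end
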